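(* Let $\boldsymbol{T_z}=(T_{z_1},T_{z_2},T_{z_3})$ be the commuting $3$-tuple of multiplication operators on the Hardy space $H^2(\mathbb E)$ of the tetrablock $\mathbb E$ by the coordinate functions $z_1,z_2,z_3$. Let $T$ be a bounded linear operator on $H^2(\mathbb E)$. Then $T$ is a Toeplitz operator (that is, $T=T_{\hat u}$ for some $\hat u\in L^\infty(S_{\mathbb E})$) if and only if $$T T_{z_1}=T_{z_2}^* T T_{z_3},\qquad T T_{z_2}=T_{z_1}^* T T_{z_3},\qquad T_{z_3}^* T T_{z_3}=T.$$
   Context: The tetrablock is $\mathbb E=\{(z_1,z_2,z_3)\in\mathbb C^3: 1-z_1z-z_2w+z_3zw\neq 0 \text{ for all } z,w\in\overline{\mathbb D}\}$, where $\mathbb D$ is the open unit disc. Its Shilov boundary is $S_{\mathbb E}=\{(z_1,z_2,z_3)\in\mathbb C^3: z_1=\bar z_2z_3,\ |z_3|=1,\ |z_2|\le 1\}$. The type-II Cartan domain of dimension 3 is $\mathfrak R_{\mathrm{II}}=\left\{(z_1,z_2,z_3)\in\mathbb C^3:\left\|\begin{pmatrix} z_1&z_3\\ z_3&z_2\end{pmatrix}\right\|<1\right\}$ (operator norm). Let $S_{\mathfrak R_{\mathrm{II}}}$ be its Shilov boundary (the triples $(z_1,z_2,z_3)\in\mathbb C^3$ for which the matrix $\begin{pmatrix} z_1&z_3\\ z_3&z_2\end{pmatrix}$ is unitary), let $K$ be the group of all linear biholomorphic automorphisms of $\mathfrak R_{\mathrm{II}}$, and let $d\Theta$ be the unique $K$-invariant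 probability measure supported on $S_{\mathfrak R_{\mathrm{II}}}$. The Hardy space $H^2(\mathfrak R_{\mathrm{II}})$ consists of the holomorphic $f$ on $\mathfrak R_{\mathrm{II}}$ with $\|f\|_{H^2(\mathfrak R_{\mathrm{II}})}=\sup_{0<r<1}\left(\int_{S_{\mathfrak R_{\mathrm{II}}}}|f(rz)|^2d\Theta(z)\right)^{1/2}<\infty$. Each such $f$ has a radial limit in $L^2(S_{\mathfrak R_{\mathrm{II}}})=L^2(S_{\mathfrak R_{\mathrm{II}}},d\Theta)$, and taking radial limits embeds $H^2(\mathfrak R_{\mathrm{II}})$ isometrically in $L^2(S_{\mathfrak R_{\mathrm{II}}})$. Let $\phi(z_1,z_2,z_3)=(z_1,z_2,z_1z_2-z_3^2)$. It is a proper holomorphic map of $\mathfrak R_{\mathrm{II}}$ onto $\mathbb E$ with $\phi(S_{\mathfrak R_{\mathrm{II}}})=S_{\mathbb E}$. Let $\mathcal J_\phi$ be the determinant of its Jacobian matrix. Let $d\Theta_{\mathbb E}$ be the measure on $S_{\mathbb E}$ defined by $\int_{S_{\mathbb E}}f\,d\Theta_{\mathbb E}=\frac1C\int_{S_{\mathfrak R_{\mathrm{II}}}}(f\circ\phi)\,|\mathcal J_\phi|^2\,d\Theta$, where $C>0$ is chosen so that $d\Theta_{\mathbb E}$ is a probability measure, and let $L^2(S_{\mathbb E})$, $L^\infty(S_{\mathbb E})$ be the corresponding Lebesgue spaces. The Hardy space of the tetrablock is $H^2(\mathbb E)=\{f \text{ holomorphic on }\mathbb E: \|\mathcal J_\phi\cdot(f\circ\phi)\|_{H^2(\mathfrak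 R_{\mathrm{II}})}<\infty\}$. Each $f\in H^2(\mathbb E)$ is identified with its boundary value in $L^2(S_{\mathbb E})$, namely the element $\tilde f\in L^2(S_{\mathbb E})$ such that $\mathcal J_\phi\cdot(\tilde f\circ\phi)$ is the radial limit of $\mathcal J_\phi\cdot(f\circ\phi)$. In this way $H^2(\mathbb E)$ is a closed subspace of $L^2(S_{\mathbb E})$, with the inherited inner product. Let $P_{H^2(\mathbb E)}$ be the orthogonal projection of $L^2(S_{\mathbb E})$ onto $H^2(\mathbb E)$. For $\hat u\in L^\infty(S_{\mathbb E})$, the Toeplitz operator with symbol $\hat u$ is $T_{\hat u}\hat f=P_{H^2(\mathbb E)}(\hat u\hat f)$, $\hat f\in H^2(\mathbb E)$. *)

theory Defs
  imports "HOL-Probability.Probability"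
begin

section \<open>Holomorphic functions of several complex variables\<close>

text \<open>Holomorphy on an open set: real Frechet differentiability at every point, with
  complex-linear derivative.  All functions are total; values outside \<open>U\<close> are irrelevant.\<close>

definition holomorphic_fun_on :: "(complex^'n \<Rightarrow> complex) \<Rightarrow> (complex^'n) set \<Rightarrow> bool" where
  "holomorphic_fun_on f U \<longleftrightarrow>
     (\<forall>z\<in>U. \<exists>D. (f has_derivative D) (at z) \<and> (\<forall>c v. D (c *s v) = c * D v))"

definition holomorphic_map_on :: "(complex^'n \<Rightarrow> complex^'m) \<Rightarrow> (complex^'n) set \<Rightarrow> bool" where
  "holomorphic_map_on F U \<longleftrightarrow> (\<forall>i. holomorphic_fun_on (\<lambda>z. F z $ i) U)"

definition biholomorphic_automorphism :: "(complex^'n) set \<Rightarrow> (complex^'n \<Rightarrow> complex^'n) \<Rightarrow> bool" where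
  "biholomorphic_automorphism U F \<longleftrightarrow>
     bij_betw F U U \<and> holomorphic_map_on F U \<and> holomorphic_map_on (inv_into U F) U"


section \<open>The domains and their Shilov boundaries\<close>

definition tetrablock :: "(complex^3) set" where
  "tetrablock = {z. \<forall>u\<in>cball 0 1. \<forall>w\<in>cball 0 1. 1 - z$1 * u - z$2 * w + z$3 * u * w \<noteq> 0}"

definition shilov_tetrablock :: "(complex^3) set" where
  "shilov_tetrablock = {z. z$1 = cnj (z$2) * z$3 \<and> cmod (z$3) = 1 \<and> cmod (z$2) \<le> 1}"

definition sym_mat :: "complex^3 \<Rightarrow> complex^2^2" where
  "sym_mat z = vector [vector [z$1, z$3], vector [z$3, z$2]]"

definition unitary_mat :: "complex^'n^'n \<Rightarrow> bool" where
  "unitary_mat A \<longleftrightarrow>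
     map_matrix cnj (transpose A) ** A = mat 1 \<and> A ** map_matrix cnj (transpose A) = mat 1"

text \<open>The norm on \<^typ>\<open>complex^2\<close> is the Euclidean one, so \<^const>\<open>onorm\<close> below is the
  operator norm of the matrix.\<close>

definition cartan_II :: "(complex^3) set" where
  "cartan_II = {z. onorm ((*v) (sym_mat z)) < 1}"

definition shilov_cartan_II :: "(complex^3) set" where
  "shilov_cartan_II = {z. unitary_mat (sym_mat z)}"

text \<open>A linear map is determined by its restriction to \<^const>\<open>cartan_II\<close>, so the automorphisms
  are represented by their linear extensions to the whole space.\<close>

definition linear_automorphisms :: "(complex^3 \<Rightarrow> complex^3) set" where
  "linear_automorphisms =
     {k. Vector_Spaces.linear (*s) (*s) k \<and> biholomorphic_automorphism cartan_II k}"

definition tetra_map :: "complex^3 \<Rightarrow> complex^3" where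
  "tetra_map z = vector [z$1, z$2, z$1 * z$2 - (z$3)^2]"

text \<open>\<^const>\<open>matrix\<close> is taken over the complex scalars: the columns are the values of the
  derivative at \<open>axis j 1\<close>, so this is the determinant of the complex 3 by 3 Jacobian matrix.\<close>

definition tetra_jac :: "complex^3 \<Rightarrow> complex" where
  "tetra_jac z = det (matrix (frechet_derivative tetra_map (at z)))"


section \<open>Lebesgue spaces and operators on their subspaces\<close>

text \<open>Elements of \<open>L\<^sup>2(M)\<close> are represented by functions; equality in \<open>L\<^sup>2(M)\<close> is equality almost
  everywhere.\<close>

definition L2 :: "'a measure \<Rightarrow> ('a \<Rightarrow> complex) set" where
  "L2 M = {f \<in> borel_measurable M. integrable M (\<lambda>x. (cmod (f x))^2)}"

definition Linf :: "'a measure \<Rightarrow> ('a \<Rightarrow> complex) set" where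
  "Linf M = {u \<in> borel_measurable M. \<exists>C. AE x in M. cmod (u x) \<le> C}"

definition L2_inner :: "'a measure \<Rightarrow> ('a \<Rightarrow> complex) \<Rightarrow> ('a \<Rightarrow> complex) \<Rightarrow> complex" where
  "L2_inner M f g = (\<integral>x. f x * cnj (g x) \<partial>M)"

definition L2_norm :: "'a measure \<Rightarrow> ('a \<Rightarrow> complex) \<Rightarrow> real" where
  "L2_norm M f = sqrt (\<integral>x. (cmod (f x))^2 \<partial>M)"

text \<open>In what follows \<open>H\<close> is a subset of \<^term>\<open>L2 M\<close> that is closed under almost everywhere
  equality and represents a closed subspace.  A bounded linear operator on it is represented by a
  map on functions; linearity and boundedness together force it to respect almost everywhere
  equality, and two such maps represent the same operator if their values agree almost
  everywhere.\<close>

definition bounded_operator_on ::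
    "'a measure \<Rightarrow> ('a \<Rightarrow> complex) set \<Rightarrow> (('a \<Rightarrow> complex) \<Rightarrow> ('a \<Rightarrow> complex)) \<Rightarrow> bool" where
  "bounded_operator_on M H T \<longleftrightarrow>
     (\<forall>f\<in>H. T f \<in> H) \<and>
     (\<forall>f\<in>H. \<forall>g\<in>H. \<forall>a b. AE x in M. T (\<lambda>y. a * f y + b * g y) x = a * T f x + b * T g x) \<and>
     (\<exists>C. \<forall>f\<in>H. L2_norm M (T f) \<le> C * L2_norm M f)"

definition operator_eq_on ::
    "'a measure \<Rightarrow> ('a \<Rightarrow> complex) set \<Rightarrow> (('a \<Rightarrow> complex) \<Rightarrow> ('a \<Rightarrow> complex)) \<Rightarrow>
     (('a \<Rightarrow> complex) \<Rightarrow> ('a \<Rightarrow> complex)) \<Rightarrow> bool" where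
  "operator_eq_on M H S T \<longleftrightarrow> (\<forall>f\<in>H. AE x in M. S f x = T f x)"

text \<open>The values of the adjoint and of the orthogonal projection are determined up to almost
  everywhere equality, so the choices below do not matter.\<close>

definition adjoint_on ::
    "'a measure \<Rightarrow> ('a \<Rightarrow> complex) set \<Rightarrow> (('a \<Rightarrow> complex) \<Rightarrow> ('a \<Rightarrow> complex)) \<Rightarrow>
     (('a \<Rightarrow> complex) \<Rightarrow> ('a \<Rightarrow> complex))" where
  "adjoint_on M H T =
     (SOME S. (\<forall>f\<in>H. S f \<in> H) \<and> (\<forall>f\<in>H. \<forall>g\<in>H. L2_inner M (T f) g = L2_inner M f (S g)))"

definition orth_proj ::
    "'a measure \<Rightarrow> ('a \<Rightarrow> complex) set \<Rightarrow> ('a \<Rightarrow> complex) \<Rightarrow> ('a \<Rightarrow> complex)" where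
  "orth_proj M H f =
     (SOME g. g \<in> H \<and> (\<forall>h\<in>H. L2_inner M (\<lambda>x. f x - g x) h = 0))"

definition toeplitz ::
    "'a measure \<Rightarrow> ('a \<Rightarrow> complex) set \<Rightarrow> ('a \<Rightarrow> complex) \<Rightarrow> (('a \<Rightarrow> complex) \<Rightarrow> ('a \<Rightarrow> complex))" where
  "toeplitz M H u f = orth_proj M H (\<lambda>x. u x * f x)"

definition coord_mult :: "3 \<Rightarrow> (complex^3 \<Rightarrow> complex) \<Rightarrow> (complex^3 \<Rightarrow> complex)" where
  "coord_mult i f = (\<lambda>z. z $ i * f z)"


section \<open>Boundary measures and Hardy spaces\<close>

text \<open>The measure \<open>\<Theta>\<close> is taken on the Borel sets of the Shilov boundary itself; the property below
  determines it uniquely.\<close>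

definition invariant_boundary_measure :: "(complex^3) measure \<Rightarrow> bool" where
  "invariant_boundary_measure \<Theta> \<longleftrightarrow>
     prob_space \<Theta> \<and> sets \<Theta> = sets (restrict_space borel shilov_cartan_II) \<and>
     (\<forall>k\<in>linear_automorphisms. distr \<Theta> \<Theta> k = \<Theta>)"

definition tetra_measure :: "(complex^3) measure \<Rightarrow> (complex^3) measure" where
  "tetra_measure \<Theta> =
     (let C = (\<integral>z. (cmod (tetra_jac z))^2 \<partial>\<Theta>)
      in distr (density \<Theta> (\<lambda>z. ennreal ((cmod (tetra_jac z))^2 / C)))
           (restrict_space borel shilov_tetrablock) tetra_map)"

text \<open>For holomorphic \<open>F\<close> the dilates are bounded and continuous on the Shilov boundary, so all the
  integrals in \<open>hardy_norm\<close> exist.\<close>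

definition hardy_norm :: "(complex^3) measure \<Rightarrow> (complex^3 \<Rightarrow> complex) \<Rightarrow> ennreal" where
  "hardy_norm \<Theta> F = (SUP r\<in>{0<..<1}. ennreal (L2_norm \<Theta> (\<lambda>z. F (r *\<^sub>R z))))"

definition radial_limit :: "(complex^3) measure \<Rightarrow> (complex^3 \<Rightarrow> complex) \<Rightarrow> (complex^3 \<Rightarrow> complex) \<Rightarrow> bool" where
  "radial_limit \<Theta> F G \<longleftrightarrow>
     G \<in> L2 \<Theta> \<and> ((\<lambda>r. L2_norm \<Theta> (\<lambda>z. F (r *\<^sub>R z) - G z)) \<longlongrightarrow> 0) (at_left 1)"

definition hardy_tetrablock :: "(complex^3) measure \<Rightarrow> (complex^3 \<Rightarrow> complex) set" where
  "hardy_tetrablock \<Theta> =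
     {f. holomorphic_fun_on f tetrablock \<and> hardy_norm \<Theta> (\<lambda>z. tetra_jac z * f (tetra_map z)) < \<infinity>}"

text \<open>The Hardy space as the set of boundary values in \<open>L\<^sup>2\<close> of \<^term>\<open>tetra_measure \<Theta>\<close>.\<close>

definition hardy_boundary :: "(complex^3) measure \<Rightarrow> (complex^3 \<Rightarrow> complex) set" where
  "hardy_boundary \<Theta> =
     {g \<in> L2 (tetra_measure \<Theta>). \<exists>f\<in>hardy_tetrablock \<Theta>.
        radial_limit \<Theta> (\<lambda>z. tetra_jac z * f (tetra_map z)) (\<lambda>z. tetra_jac z * g (tetra_map z))}"

end

theory Submission
  imports Defs "HOL-Complex_Analysis.Conformal_Mappings"
begin

text \<open>
  On the boundary of the tetrablock \<open>|z\<^sub>3| = 1\<close>, \<open>cnj z\<^sub>1 = cnj z\<^sub>3 z\<^sub>2\<close> and \<open>cnj z\<^sub>2 = cnj z\<^sub>3 z\<^sub>1\<close>.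
  The three operator relations say exactly that the form \<open>\<langle>T f, g\<rangle>\<close> respects these identities, so a
  Toeplitz operator, whose form is \<open>\<integral> u f cnj g\<close>, satisfies them.

  For the converse, the relation \<open>T\<^sub>3\<^sup>* T T\<^sub>3 = T\<close> makes \<open>\<langle>T z\<^sub>3\<^sup>n p, z\<^sub>3\<^sup>n q\<rangle>\<close> independent of \<open>n\<close>.
  This extends the form of \<open>T\<close> to a bounded form \<open>\<beta>\<close> on the fractions \<open>p\<close> with \<open>z\<^sub>3\<^sup>n p\<close> in the Hardy
  space \<open>H\<close>.  They are stable under all \<open>z\<^sub>i\<close> and \<open>cnj z\<^sub>i\<close>, hence contain every polynomial in the real
  coordinates, and the three relations let each such polynomial move across \<open>\<beta>\<close> to its conjugate:
  \<open>\<beta>(p, a) = \<beta>(cnj a p, 1)\<close>.  The functional \<open>\<beta>(_, 1)\<close> is integration against some \<open>u\<close> in \<open>L\<^sup>2\<close>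
  by Riesz' theorem.  Polynomials are dense in \<open>L\<^sup>2\<close> by the Stone-Weierstrass theorem, so the bound on
  \<open>\<beta>\<close> forces \<open>|u| \<le> \<parallel>T\<parallel>\<close>, and \<open>T\<close> is the Toeplitz operator with symbol \<open>u\<close>
  (lemma \<open>brown_halmos\<close>).

  Projections and adjoints on \<open>H\<close> exist because \<open>H\<close> is closed in \<open>L\<^sup>2\<close>, and this is where the function
  theory enters.  A function \<open>f\<close> on the tetrablock is studied through \<open>F = J (f \<circ> \<phi>)\<close> on the Cartan
  domain, with Jacobian \<open>J = -2 z\<^sub>3\<close>.  Poisson's formula on the discs \<open>s \<mapsto> s z\<close> and the invariance of
  \<open>\<Theta>\<close> under the circle show that the norms of the dilates of \<open>F\<close> increase to the norm of the boundary
  value.  If point evaluations are locally bounded by that norm, a Cauchy sequence of boundary values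
  comes from a locally uniformly convergent sequence of holomorphic functions, the limit is holomorphic
  (Weierstrass), and monotonicity gives its boundary value.

  The measure \<open>\<Theta>\<close> is known only through its invariance, so point evaluations are bounded by averaging.
  Let \<open>D(a,b)\<close> denote \<open>Z \<mapsto> diag(a,b) Z diag(a,b)\<close> and let \<open>R\<close> be the conjugation with the Hadamard
  matrix.  Any boundary point \<open>Z'\<close> is \<open>D R D R D Z\<close> with suitable unimodular parameters, for every
  boundary point \<open>Z\<close>.  Each \<open>D(a,b)\<close> extends holomorphically to the closed bidisc, and shrinking all six
  parameters by \<open>\<rho>\<close> turns \<open>Z'\<close> into \<open>\<rho>\<^sup>6 Z'\<close>; hence \<open>|F(\<rho>\<^sup>6 Z')|\<^sup>2\<close> is at most a constant times the
  average of \<open>|F(D R D R D Z)|\<^sup>2\<close> over the six circles.  Integrating over \<open>Z\<close> and using invariance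
  yields \<open>\<integral> |F|\<^sup>2 d\<Theta>\<close> (lemma \<open>submean_bound\<close>).  To reach all points of the tetrablock and to remove the
  factor \<open>J\<close>, write a point as the value at \<open>s = w\<^sub>3\<close> of the disc
  \<open>s \<mapsto> (a + cnj b s, b + cnj a s, s)\<close> with \<open>|a| + |b| < 1\<close>.  Its boundary lies in the Shilov boundary at
  points with \<open>|z\<^sub>2| \<le> |a| + |b|\<close>, where \<open>|J|\<close> is bounded below, and the maximum principle applies
  (lemma \<open>evaluation_bound\<close>).
\<close>

section \<open>Square-integrable functions\<close>

lemma borel_measurable_cnj [measurable (raw)]:
  "f \<in> borel_measurable M \<Longrightarrow> (\<lambda>x. cnj (f x)) \<in> borel_measurable M"
  using measurable_compose[OF _ borel_measurable_continuous_onI[of cnj]] by (simp add: continuous_on_cnj)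

lemma L2_measurable: "f \<in> L2 M \<Longrightarrow> f \<in> borel_measurable M"
  by (simp add: L2_def)

lemma L2_integrable: "f \<in> L2 M \<Longrightarrow> integrable M (\<lambda>x. (cmod (f x))^2)"
  by (simp add: L2_def)

lemma mult_le_sum_squares: "(a::real) * b \<le> a^2 + b^2"
  using sum_squares_bound[of a b] zero_le_power2[of a] zero_le_power2[of b]
  by (cases "0 \<le> a * b") (auto simp: mult.assoc intro: order_trans[of _ 0])

lemma L2_mult_integrable:
  assumes "f \<in> L2 M" "g \<in> L2 M"
  shows "integrable M (\<lambda>x. f x * cnj (g x))" "integrable M (\<lambda>x. cmod (f x) * cmod (g x))"
proof -
  note [measurable] = assms[THEN L2_measurable]
  have i: "integrable M (\<lambda>x. (cmod (f x))^2 + (cmod (g x))^2)"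
    using assms by (intro Bochner_Integration.integrable_add L2_integrable)
  show "integrable M (\<lambda>x. f x * cnj (g x))"
    by (rule Bochner_Integration.integrable_bound[OF i])
       (auto simp: norm_mult intro!: AE_I2 order_trans[OF mult_le_sum_squares])
  show "integrable M (\<lambda>x. cmod (f x) * cmod (g x))"
    by (rule Bochner_Integration.integrable_bound[OF i])
       (auto simp: norm_mult intro!: AE_I2 order_trans[OF mult_le_sum_squares])
qed

lemma L2_cmult: "f \<in> L2 M \<Longrightarrow> (\<lambda>x. c * f x) \<in> L2 M"
  by (auto simp: L2_def norm_mult power_mult_distrib)

lemma L2_add:
  assumes "f \<in> L2 M" "g \<in> L2 M" shows "(\<lambda>x. f x + g x) \<in> L2 M"
proof -
  note [measurable] = assms[THEN L2_measurable]
  have i: "integrable M (\<lambda>x. 2 * (cmod (f x))^2 + 2 * (cmod (g x))^2)"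
    using assms by (intro Bochner_Integration.integrable_add integrable_mult_right L2_integrable)
  have "integrable M (\<lambda>x. (cmod (f x + g x))^2)"
  proof (rule Bochner_Integration.integrable_bound[OF i], measurable, intro AE_I2)
    fix x
    have "(cmod (f x + g x))^2 \<le> (cmod (f x) + cmod (g x))^2"
      by (intro power_mono norm_triangle_ineq) auto
    also have "\<dots> \<le> 2 * (cmod (f x))^2 + 2 * (cmod (g x))^2"
      using sum_squares_bound[of "cmod (f x)" "cmod (g x)"] by (simp add: power2_sum)
    finally show "norm ((cmod (f x + g x))^2) \<le> norm (2 * (cmod (f x))^2 + 2 * (cmod (g x))^2)"
      by simp
  qed
  then show ?thesis by (simp add: L2_def)
qed

lemma L2_lin: "f \<in> L2 M \<Longrightarrow> g \<in> L2 M \<Longrightarrow> (\<lambda>x. a * f x + b * g x) \<in> L2 M"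
  by (intro L2_add L2_cmult)

lemma L2_diff: "f \<in> L2 M \<Longrightarrow> g \<in> L2 M \<Longrightarrow> (\<lambda>x. f x - g x) \<in> L2 M"
  using L2_lin[of f M g 1 "-1"] by simp

lemma L2_zero: "(\<lambda>x. 0) \<in> L2 M" by (simp add: L2_def)

lemma L2_bounded_mult:
  assumes "f \<in> L2 M" "w \<in> borel_measurable M" "AE x in M. cmod (w x) \<le> C"
  shows "(\<lambda>x. w x * f x) \<in> L2 M"
proof -
  note [measurable] = L2_measurable[OF assms(1)] assms(2)
  have "integrable M (\<lambda>x. (cmod (w x * f x))^2)"
  proof (rule Bochner_Integration.integrable_bound)
    show "integrable M (\<lambda>x. C^2 * (cmod (f x))^2)" using L2_integrable[OF assms(1)] by simp
    show "AE x in M. norm ((cmod (w x * f x))^2) \<le> norm (C^2 * (cmod (f x))^2)"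
      using assms(3) by eventually_elim (auto simp: norm_mult power_mult_distrib intro!: mult_right_mono power_mono)
  qed simp
  then show ?thesis by (simp add: L2_def)
qed

lemma L2_bounded:
  assumes "finite_measure M" "w \<in> borel_measurable M" "AE x in M. cmod (w x) \<le> C"
  shows "w \<in> L2 M"
proof -
  have "(\<lambda>x. 1) \<in> L2 M"
    using finite_measure.integrable_const[OF assms(1), of "1::real"] by (simp add: L2_def)
  from L2_bounded_mult[OF this assms(2,3)] show ?thesis by simp
qed

lemma L2_norm_nonneg [simp]: "0 \<le> L2_norm M f" by (simp add: L2_norm_def)

lemma L2_norm_sq: "(L2_norm M f)^2 = (\<integral>x. (cmod (f x))^2 \<partial>M)"
  by (simp add: L2_norm_def)

lemma L2_norm_uminus: "L2_norm M (\<lambda>x. f x - g x) = L2_norm M (\<lambda>x. g x - f x)"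
  by (simp add: L2_norm_def norm_minus_commute)

lemma L2_norm_cmult: "L2_norm M (\<lambda>x. c * f x) = cmod c * L2_norm M f"
  by (simp add: L2_norm_def norm_mult power_mult_distrib real_sqrt_mult)

lemma L2_norm_zero [simp]: "L2_norm M (\<lambda>x. 0) = 0" by (simp add: L2_norm_def)

lemma L2_norm_bounded_mult:
  assumes f: "f \<in> L2 M" and w: "w \<in> borel_measurable M" "AE x in M. cmod (w x) \<le> C" and C: "0 \<le> C"
  shows "L2_norm M (\<lambda>x. w x * f x) \<le> C * L2_norm M f"
proof -
  have "L2_norm M (\<lambda>x. w x * f x) \<le> L2_norm M (\<lambda>x. of_real C * f x)"
    unfolding L2_norm_def
    by (intro real_sqrt_le_mono integral_mono_AE L2_integrable L2_bounded_mult[OF f w] f L2_cmult)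
       (use w(2) C in \<open>auto elim!: eventually_mono simp: norm_mult power_mult_distrib intro!: mult_right_mono power_mono\<close>)
  then show ?thesis using C by (simp add: L2_norm_cmult)
qed

lemma L2_norm_cong_AE:
  assumes "f \<in> borel_measurable M" "g \<in> borel_measurable M" "AE x in M. f x = g x"
  shows "L2_norm M f = L2_norm M g"
  unfolding L2_norm_def
  by (intro arg_cong[where f=sqrt] integral_cong_AE) (use assms in \<open>auto elim!: AE_mp\<close>)

lemma L2_inner_cong_AE:
  assumes "AE x in M. f x = f' x" "AE x in M. g x = g' x"
  assumes [measurable]: "f \<in> borel_measurable M" "f' \<in> borel_measurable M"
    "g \<in> borel_measurable M" "g' \<in> borel_measurable M"
  shows "L2_inner M f g = L2_inner M f' g'"
  unfolding L2_inner_def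
  by (intro integral_cong_AE) (use assms in \<open>auto elim!: AE_mp\<close>)

lemma L2_inner_cong:
  assumes "\<And>x. x \<in> space M \<Longrightarrow> f x * cnj (g x) = f' x * cnj (g' x)"
  shows "L2_inner M f g = L2_inner M f' g'"
  unfolding L2_inner_def by (intro Bochner_Integration.integral_cong refl assms)

lemma L2_inner_self: "L2_inner M f f = of_real ((L2_norm M f)^2)"
proof -
  have "L2_inner M f f = (\<integral>x. complex_of_real ((cmod (f x))^2) \<partial>M)"
    unfolding L2_inner_def by (intro Bochner_Integration.integral_cong refl)
      (simp add: complex_norm_square del: of_real_power)
  also have "\<dots> = of_real ((L2_norm M f)^2)" unfolding L2_norm_sq by (rule integral_complex_of_real)
  finally show ?thesis .
qed

lemma L2_inner_commute: "L2_inner M g f = cnj (L2_inner M f g)"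
  unfolding L2_inner_def Bochner_Integration.integral_cnj[symmetric]
  by (simp add: mult.commute)

lemma L2_inner_lin_left:
  assumes "f \<in> L2 M" "g \<in> L2 M" "h \<in> L2 M"
  shows "L2_inner M (\<lambda>x. a * f x + b * g x) h = a * L2_inner M f h + b * L2_inner M g h"
proof -
  have "L2_inner M (\<lambda>x. a * f x + b * g x) h = (\<integral>x. a * (f x * cnj (h x)) + b * (g x * cnj (h x)) \<partial>M)"
    unfolding L2_inner_def by (simp add: algebra_simps)
  also have "\<dots> = a * L2_inner M f h + b * L2_inner M g h"
    unfolding L2_inner_def using L2_mult_integrable(1)[OF assms(1,3)] L2_mult_integrable(1)[OF assms(2,3)]
    by (subst Bochner_Integration.integral_add) auto
  finally show ?thesis .
qed

lemma L2_inner_lin_right: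
  assumes "f \<in> L2 M" "g \<in> L2 M" "h \<in> L2 M"
  shows "L2_inner M h (\<lambda>x. a * f x + b * g x) = cnj a * L2_inner M h f + cnj b * L2_inner M h g"
  by (subst (1 2 3) L2_inner_commute) (simp add: L2_inner_lin_left[OF assms])

lemma L2_inner_diff_left:
  assumes "f \<in> L2 M" "g \<in> L2 M" "h \<in> L2 M"
  shows "L2_inner M (\<lambda>x. f x - g x) h = L2_inner M f h - L2_inner M g h"
  using L2_inner_lin_left[OF assms, of 1 "-1"] by simp

lemma L2_inner_diff_right:
  assumes "f \<in> L2 M" "g \<in> L2 M" "h \<in> L2 M"
  shows "L2_inner M h (\<lambda>x. f x - g x) = L2_inner M h f - L2_inner M h g"
  using L2_inner_lin_right[OF assms, of 1 "-1"] by simp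

text \<open>Each product satisfies \<open>|f| |g| \<le> (t |f|\<^sup>2 + |g|\<^sup>2 / t) / 2\<close> for \<open>t > 0\<close>.  The best \<open>t\<close> is
  \<open>\<parallel>g\<parallel> / \<parallel>f\<parallel>\<close>; adding a small \<open>e\<close> to both norms makes it meaningful also when one of them vanishes.\<close>

lemma L2_Cauchy_Schwarz_abs:
  assumes "f \<in> L2 M" "g \<in> L2 M"
  shows "(\<integral>x. cmod (f x) * cmod (g x) \<partial>M) \<le> L2_norm M f * L2_norm M g"
proof -
  let ?I = "\<integral>x. cmod (f x) * cmod (g x) \<partial>M"
  let ?a = "L2_norm M f" and ?b = "L2_norm M g"
  have key: "?I \<le> (?a + e) * (?b + e)" if "e > 0" for e
  proof -
    define a b where "a = ?a + e" and "b = ?b + e"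
    have pos: "a > 0" "b > 0" using that by (auto simp: a_def b_def add_nonneg_pos)
    have "?I \<le> (\<integral>x. (b/a) * (cmod (f x))^2 / 2 + (a/b) * (cmod (g x))^2 / 2 \<partial>M)"
    proof (rule integral_mono)
      show "integrable M (\<lambda>x. cmod (f x) * cmod (g x))" using L2_mult_integrable(2)[OF assms] .
      show "integrable M (\<lambda>x. (b/a) * (cmod (f x))^2 / 2 + (a/b) * (cmod (g x))^2 / 2)"
        using assms[THEN L2_integrable] by simp
      fix x
      have "0 \<le> (b * cmod (f x) - a * cmod (g x))^2" by simp
      then show "cmod (f x) * cmod (g x) \<le> (b/a) * (cmod (f x))^2 / 2 + (a/b) * (cmod (g x))^2 / 2"
        using pos by (simp add: field_simps power2_eq_square)
    qed
    also have "\<dots> = (b/a) * ?a^2 / 2 + (a/b) * ?b^2 / 2"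
      using assms[THEN L2_integrable] by (simp add: L2_norm_sq)
    also have "\<dots> \<le> (b/a) * a^2 / 2 + (a/b) * b^2 / 2"
      using pos that by (intro add_mono divide_right_mono mult_left_mono power_mono) (auto simp: a_def b_def)
    also have "\<dots> = a * b" using pos by (simp add: power2_eq_square)
    finally show ?thesis by (simp add: a_def b_def)
  qed
  have "((\<lambda>e. (?a + e) * (?b + e)) \<longlongrightarrow> (?a + 0) * (?b + 0)) (at_right 0)"
    by (intro tendsto_intros)
  then show ?thesis
    by (intro tendsto_lowerbound[of _ _ "at_right 0"]) (auto intro!: eventually_at_rightI[of 0 1] key)
qed

lemma L2_Cauchy_Schwarz:
  assumes "f \<in> L2 M" "g \<in> L2 M"
  shows "cmod (L2_inner M f g) \<le> L2_norm M f * L2_norm M g"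
proof -
  have "cmod (L2_inner M f g) \<le> (\<integral>x. cmod (f x * cnj (g x)) \<partial>M)"
    unfolding L2_inner_def by (rule integral_norm_bound)
  then show ?thesis using L2_Cauchy_Schwarz_abs[OF assms] by (simp add: norm_mult)
qed

lemma L2_norm_sq_add:
  assumes "f \<in> L2 M" "g \<in> L2 M"
  shows "(L2_norm M (\<lambda>x. f x + g x))^2 = (L2_norm M f)^2 + 2 * Re (L2_inner M f g) + (L2_norm M g)^2"
proof -
  have 1: "f \<in> L2 M" "g \<in> L2 M" "(\<lambda>x. f x + g x) \<in> L2 M" using assms L2_add by auto
  have "complex_of_real ((L2_norm M (\<lambda>x. f x + g x))^2) = L2_inner M (\<lambda>x. f x + g x) (\<lambda>x. f x + g x)"
    by (simp only: L2_inner_self)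
  also have "\<dots> = L2_inner M f f + L2_inner M f g + cnj (L2_inner M f g) + L2_inner M g g"
    using L2_inner_lin_left[OF 1(1,2,3), of 1 1] L2_inner_lin_right[OF 1(1,2,1), of 1 1]
      L2_inner_lin_right[OF 1(1,2,2), of 1 1] L2_inner_commute[of M g f] by simp
  also have "\<dots> = of_real ((L2_norm M f)^2 + 2 * Re (L2_inner M f g) + (L2_norm M g)^2)"
    by (simp add: L2_inner_self complex_eq_iff)
  finally show ?thesis using of_real_eq_iff by blast
qed

lemma L2_triangle:
  assumes "f \<in> L2 M" "g \<in> L2 M"
  shows "L2_norm M (\<lambda>x. f x + g x) \<le> L2_norm M f + L2_norm M g"
proof (rule power2_le_imp_le)
  have "Re (L2_inner M f g) \<le> L2_norm M f * L2_norm M g"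
    using L2_Cauchy_Schwarz[OF assms] complex_Re_le_cmod order_trans by blast
  then show "(L2_norm M (\<lambda>x. f x + g x))^2 \<le> (L2_norm M f + L2_norm M g)^2"
    unfolding L2_norm_sq_add[OF assms] by (simp add: power2_sum)
qed simp

lemma L2_triangle_diff:
  assumes "f \<in> L2 M" "g \<in> L2 M" "h \<in> L2 M"
  shows "L2_norm M (\<lambda>x. f x - h x) \<le> L2_norm M (\<lambda>x. f x - g x) + L2_norm M (\<lambda>x. g x - h x)"
  using L2_triangle[OF L2_diff[OF assms(1,2)] L2_diff[OF assms(2,3)]] by simp

lemma L2_norm_diff_bound:
  assumes "f \<in> L2 M" "g \<in> L2 M"
  shows "\<bar>L2_norm M f - L2_norm M g\<bar> \<le> L2_norm M (\<lambda>x. f x - g x)"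
  using L2_triangle_diff[OF assms L2_zero] L2_triangle_diff[OF assms(2,1) L2_zero]
  by (simp add: L2_norm_uminus[of M g f])

lemma L2_norm_eq_0:
  assumes "f \<in> L2 M" shows "L2_norm M f = 0 \<longleftrightarrow> (AE x in M. f x = 0)"
  unfolding L2_norm_def real_sqrt_eq_0_iff
  by (subst integral_nonneg_eq_0_iff_AE[OF L2_integrable[OF assms]]) auto

lemma L2_nn_integral:
  assumes "f \<in> L2 M" shows "(\<integral>\<^sup>+x. ennreal ((cmod (f x))^2) \<partial>M) = ennreal ((L2_norm M f)^2)"
  unfolding L2_norm_sq by (rule nn_integral_eq_integral[OF L2_integrable[OF assms]]) simp

lemma L2_by_nn_integral:
  assumes [measurable]: "f \<in> borel_measurable M"
    and le: "(\<integral>\<^sup>+x. ennreal ((cmod (f x))^2) \<partial>M) \<le> ennreal (e^2)" and "0 \<le> e"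
  shows "f \<in> L2 M" "L2_norm M f \<le> e"
proof -
  have "integrable M (\<lambda>x. (cmod (f x))^2)"
    by (rule integrableI_bounded) (use le in \<open>auto intro: le_less_trans\<close>)
  then show f: "f \<in> L2 M" by (simp add: L2_def)
  have "(L2_norm M f)^2 \<le> e^2"
    using le L2_nn_integral[OF f] by simp
  then show "L2_norm M f \<le> e" using \<open>0 \<le> e\<close> power2_le_imp_le by blast
qed

text \<open>Norm bounds survive pointwise limits.  This is how bounds pass from a sequence to its limit
  both in the completeness of \<open>L\<^sup>2\<close> and for dilates of holomorphic functions.\<close>

lemma L2_limit_by_Fatou:
  assumes "\<And>n. f n \<in> L2 M" "g \<in> borel_measurable M"
    and lim: "AE x in M. (\<lambda>n. f n x) \<longlonglongrightarrow> g x"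
    and bnd: "\<forall>\<^sub>F n in sequentially. L2_norm M (f n) \<le> e"
  shows "g \<in> L2 M" "L2_norm M g \<le> e"
proof -
  note [measurable] = assms(1)[THEN L2_measurable] assms(2)
  from bnd have e0: "0 \<le> e" using order_trans[OF L2_norm_nonneg]
    by (metis (no_types, lifting) eventually_sequentially order_refl)
  have "(\<integral>\<^sup>+x. ennreal ((cmod (g x))^2) \<partial>M) = (\<integral>\<^sup>+x. liminf (\<lambda>n. ennreal ((cmod (f n x))^2)) \<partial>M)"
  proof (rule nn_integral_cong_AE, use lim in eventually_elim)
    fix x assume "(\<lambda>n. f n x) \<longlonglongrightarrow> g x"
    then have "(\<lambda>n. ennreal ((cmod (f n x))^2)) \<longlonglongrightarrow> ennreal ((cmod (g x))^2)"
      by (intro tendsto_ennrealI tendsto_intros)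
    then show "ennreal ((cmod (g x))^2) = liminf (\<lambda>n. ennreal ((cmod (f n x))^2))"
      by (metis lim_imp_Liminf trivial_limit_sequentially)
  qed
  also have "\<dots> \<le> liminf (\<lambda>n. \<integral>\<^sup>+x. ennreal ((cmod (f n x))^2) \<partial>M)"
    by (rule nn_integral_liminf) simp
  also have "\<dots> \<le> liminf (\<lambda>n. ennreal (e^2))"
    by (rule Liminf_mono, use bnd in eventually_elim)
       (simp add: L2_nn_integral[OF assms(1)] ennreal_leI power_mono)
  also have "\<dots> = ennreal (e^2)" by (simp add: Liminf_const)
  finally have *: "(\<integral>\<^sup>+x. ennreal ((cmod (g x))^2) \<partial>M) \<le> ennreal (e^2)" .
  show "g \<in> L2 M" "L2_norm M g \<le> e" using L2_by_nn_integral[OF assms(2) * e0] by auto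
qed

text \<open>On a finite measure space an \<open>L\<^sup>2\<close>-Cauchy sequence is Cauchy in \<open>L\<^sup>1\<close>, so a subsequence
  converges almost everywhere; Fatou's lemma turns its pointwise limit into the \<open>L\<^sup>2\<close>-limit.\<close>

lemma L2_complete:
  assumes "finite_measure M" and f: "\<And>n. f n \<in> L2 M"
    and cau: "\<And>e. e > 0 \<Longrightarrow> \<exists>N. \<forall>i\<ge>N. \<forall>j\<ge>N. L2_norm M (\<lambda>x. f i x - f j x) < e"
  shows "\<exists>g\<in>L2 M. (\<lambda>n. L2_norm M (\<lambda>x. f n x - g x)) \<longlonglongrightarrow> 0"
proof -
  interpret finite_measure M by fact
  note [measurable] = f[THEN L2_measurable]
  have one: "(\<lambda>x. 1) \<in> L2 M" by (rule L2_bounded[of M _ 1]) (auto simp: assms)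
  define K where "K = L2_norm M (\<lambda>x. 1)"
  have L1: "integrable M h" "(\<integral>x. norm (h x) \<partial>M) \<le> L2_norm M h * K" if "h \<in> L2 M" for h
    using L2_mult_integrable(1)[OF that one] L2_Cauchy_Schwarz_abs[OF that one] by (auto simp: K_def)
  have K0: "K \<ge> 0" by (simp add: K_def)
  have "\<exists>N. \<forall>i\<ge>N. \<forall>j\<ge>N. (LINT x|M. norm (f i x - f j x)) < e" if "e > 0" for e
  proof -
    obtain N where N: "\<And>i j. i \<ge> N \<Longrightarrow> j \<ge> N \<Longrightarrow> L2_norm M (\<lambda>x. f i x - f j x) < e / (K + 1)"
      using cau[of "e / (K + 1)"] \<open>e > 0\<close> K0 by auto
    have "(LINT x|M. norm (f i x - f j x)) < e" if "i \<ge> N" "j \<ge> N" for i j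
    proof -
      have "(LINT x|M. norm (f i x - f j x)) \<le> L2_norm M (\<lambda>x. f i x - f j x) * K"
        using L1(2)[OF L2_diff[OF f f]] .
      also have "\<dots> \<le> e / (K + 1) * K" using N[OF that] K0 by (intro mult_right_mono) auto
      also have "\<dots> < e" using K0 \<open>e > 0\<close> by (simp add: field_simps)
      finally show ?thesis .
    qed
    then show ?thesis by blast
  qed
  from cauchy_L1_AE_cauchy_subseq[OF L1(1)[OF f] this] obtain r where
    r: "strict_mono r" "AE x in M. Cauchy (\<lambda>i. f (r i) x)" by blast
  define g where "g = (\<lambda>x. lim (\<lambda>i. f (r i) x))"
  have g[measurable]: "g \<in> borel_measurable M" unfolding g_def by measurable
  have lim: "AE x in M. (\<lambda>i. f (r i) x) \<longlonglongrightarrow> g x"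
    using r(2) by eventually_elim (simp add: g_def Cauchy_convergent_iff convergent_LIMSEQ_iff)
  have close: "(\<lambda>x. f n x - g x) \<in> L2 M \<and> L2_norm M (\<lambda>x. f n x - g x) \<le> e"
    if N: "\<forall>i\<ge>N. \<forall>j\<ge>N. L2_norm M (\<lambda>x. f i x - f j x) < e" and "n \<ge> N" for N n e
  proof -
    have "AE x in M. (\<lambda>i. f n x - f (r i) x) \<longlonglongrightarrow> f n x - g x"
      using lim by eventually_elim (intro tendsto_intros)
    moreover have "\<forall>\<^sub>F i in sequentially. L2_norm M (\<lambda>x. f n x - f (r i) x) \<le> e"
      using eventually_ge_at_top[of N] 
      by eventually_elim (use N \<open>n \<ge> N\<close> r(1) in \<open>meson less_imp_le le_trans seq_suble\<close>)
    ultimately show ?thesis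
      using L2_limit_by_Fatou[of "\<lambda>i x. f n x - f (r i) x" M "\<lambda>x. f n x - g x" e] L2_diff[OF f f] by auto
  qed
  obtain N where N: "\<forall>i\<ge>N. \<forall>j\<ge>N. L2_norm M (\<lambda>x. f i x - f j x) < 1" using cau[of 1] by auto
  have gL: "g \<in> L2 M" using L2_diff[OF f[of N] close[OF N, of N, THEN conjunct1]] by simp
  have "(\<lambda>n. L2_norm M (\<lambda>x. f n x - g x)) \<longlonglongrightarrow> 0"
  proof (rule LIMSEQ_I)
    fix e :: real assume "e > 0"
    then obtain N where N: "\<forall>i\<ge>N. \<forall>j\<ge>N. L2_norm M (\<lambda>x. f i x - f j x) < e/2" using cau[of "e/2"] by auto
    then show "\<exists>no. \<forall>n\<ge>no. norm (L2_norm M (\<lambda>x. f n x - g x) - 0) < e"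
      using close[OF N] \<open>e > 0\<close> by (intro exI[of _ N]) (fastforce intro: le_less_trans)
  qed
  with gL show ?thesis by blast
qed

lemma L2_convergent_imp_Cauchy:
  assumes f: "\<And>n. f n \<in> L2 M" and g: "g \<in> L2 M"
    and lim: "(\<lambda>n. L2_norm M (\<lambda>x. f n x - g x)) \<longlonglongrightarrow> 0" and "e > 0"
  shows "\<exists>N. \<forall>i\<ge>N. \<forall>j\<ge>N. L2_norm M (\<lambda>x. f i x - f j x) < e"
proof -
  obtain N where N: "\<And>n. n \<ge> N \<Longrightarrow> L2_norm M (\<lambda>x. f n x - g x) < e/2"
    using LIMSEQ_D[OF lim, of "e/2"] \<open>e > 0\<close> by auto
  have "L2_norm M (\<lambda>x. f i x - f j x) < e" if "i \<ge> N" "j \<ge> N" for i j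
    using L2_triangle_diff[OF f[of i] g f[of j]] N[OF that(1)] N[OF that(2)]
    by (simp add: L2_norm_uminus[of M g])
  then show ?thesis by blast
qed

lemma L2_norm_tendsto:
  assumes f: "\<And>n. f n \<in> L2 M" and g: "g \<in> L2 M"
    and lim: "(\<lambda>n. L2_norm M (\<lambda>x. f n x - g x)) \<longlonglongrightarrow> 0"
  shows "(\<lambda>n. L2_norm M (f n)) \<longlonglongrightarrow> L2_norm M g"
proof (rule LIM_zero_cancel, rule tendsto_0_le[OF lim, of _ 1])
  show "\<forall>\<^sub>F x in sequentially. norm (L2_norm M (f x) - L2_norm M g) \<le> norm (L2_norm M (\<lambda>y. f x y - g y)) * 1"
    using L2_norm_diff_bound[OF f g] by simp
qed

lemma L2_inner_tendsto:
  assumes f: "\<And>n. f n \<in> L2 M" and g: "g \<in> L2 M" and h: "h \<in> L2 M"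
    and lim: "(\<lambda>n. L2_norm M (\<lambda>x. f n x - g x)) \<longlonglongrightarrow> 0"
  shows "(\<lambda>n. L2_inner M (f n) h) \<longlonglongrightarrow> L2_inner M g h" 
    and "(\<lambda>n. L2_inner M h (f n)) \<longlonglongrightarrow> L2_inner M h g"
proof -
  show *: "(\<lambda>n. L2_inner M (f n) h) \<longlonglongrightarrow> L2_inner M g h" 
  proof (rule LIM_zero_cancel, rule tendsto_0_le[OF lim, of _ "L2_norm M h"])
    show "\<forall>\<^sub>F x in sequentially. norm (L2_inner M (f x) h - L2_inner M g h) \<le> norm (L2_norm M (\<lambda>y. f x y - g y)) * L2_norm M h"
      using L2_Cauchy_Schwarz[OF L2_diff[OF f g] h] by (simp add: L2_inner_diff_left[OF f g h])
  qed
  show "(\<lambda>n. L2_inner M h (f n)) \<longlonglongrightarrow> L2_inner M h g"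
    using tendsto_cnj[OF *] by (simp add: L2_inner_commute[symmetric])
qed

section \<open>Riesz representation, projections and adjoints\<close>

definition L2_subspace :: "'a measure \<Rightarrow> ('a \<Rightarrow> complex) set \<Rightarrow> bool" where
  "L2_subspace M V \<longleftrightarrow> V \<subseteq> L2 M \<and> V \<noteq> {} \<and>
     (\<forall>f\<in>V. \<forall>g\<in>V. \<forall>a b. (\<lambda>x. a * f x + b * g x) \<in> V)"

definition L2_closed :: "'a measure \<Rightarrow> ('a \<Rightarrow> complex) set \<Rightarrow> bool" where
  "L2_closed M V \<longleftrightarrow> (\<forall>v u. (\<forall>n::nat. v n \<in> V) \<longrightarrow> u \<in> L2 M \<longrightarrow>
     (\<lambda>n. L2_norm M (\<lambda>x. v n x - u x)) \<longlonglongrightarrow> 0 \<longrightarrow> u \<in> V)"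

lemma L2_subspaceD:
  assumes V: "L2_subspace M V"
  shows "f \<in> V \<Longrightarrow> f \<in> L2 M"
    and "f \<in> V \<Longrightarrow> g \<in> V \<Longrightarrow> (\<lambda>x. a * f x + b * g x) \<in> V"
    and "f \<in> V \<Longrightarrow> g \<in> V \<Longrightarrow> (\<lambda>x. f x - g x) \<in> V"
    and "f \<in> V \<Longrightarrow> (\<lambda>x. c * f x) \<in> V"
proof -
  have *: "\<forall>f\<in>V. \<forall>g\<in>V. \<forall>a b. (\<lambda>x. a * f x + b * g x) \<in> V" and 1: "V \<subseteq> L2 M"
    using V by (simp_all add: L2_subspace_def)
  show "f \<in> V \<Longrightarrow> f \<in> L2 M" using 1 by auto
  show lin: "(\<lambda>x. a * f x + b * g x) \<in> V" if "f \<in> V" "g \<in> V" for f g a b using that by (rule *[rule_format])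
  show "(\<lambda>x. f x - g x) \<in> V" if "f \<in> V" "g \<in> V" using lin[OF that, of 1 "-1"] by simp
  show "(\<lambda>x. c * f x) \<in> V" if "f \<in> V" using lin[OF that that, of c 0] by simp
qed

text \<open>The functional \<open>J f = \<parallel>f\<parallel>\<^sup>2 - 2 Re (l f)\<close> is bounded below, and by the parallelogram identity
  any minimizing sequence in \<open>V\<close> is Cauchy.  Its limit \<open>u\<close> represents \<open>l\<close>, because the first
  variation of \<open>J\<close> vanishes there.  The limit lies in the closure of \<open>V\<close>, so the
  lemma covers orthogonal projections (\<open>V\<close> closed), symbols of operators (\<open>V\<close> the
  space of fractions) and density statements (\<open>V\<close> the polynomials).\<close>

lemma L2_Riesz:
  assumes "finite_measure M" and V: "L2_subspace M V"
    and lin: "\<And>f g a b. f \<in> V \<Longrightarrow> g \<in> V \<Longrightarrow> l (\<lambda>x. a * f x + b * g x) = a * l f + b * l g"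
    and bnd: "\<And>f. f \<in> V \<Longrightarrow> cmod (l f) \<le> K * L2_norm M f"
  obtains u v where "u \<in> L2 M" "\<And>n::nat. v n \<in> V" "(\<lambda>n. L2_norm M (\<lambda>x. v n x - u x)) \<longlonglongrightarrow> 0"
    "\<And>f. f \<in> V \<Longrightarrow> l f = L2_inner M f u"
proof -
  note VL = L2_subspaceD(1)[OF V] and Vlin = L2_subspaceD(2)[OF V]
  define J where "J = (\<lambda>f. (L2_norm M f)^2 - 2 * Re (l f))"
  have below: "- (K^2) \<le> J f" if "f \<in> V" for f
  proof -
    have "Re (l f) \<le> K * L2_norm M f" using bnd[OF that] complex_Re_le_cmod order_trans by blast
    moreover have "0 \<le> (L2_norm M f - K)^2" by simp
    ultimately show ?thesis unfolding J_def power2_diff by (simp add: algebra_simps)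
  qed
  define m where "m = Inf (J ` V)"
  have bb: "bdd_below (J ` V)" using below by (intro bdd_belowI2) auto
  have m: "m \<le> J f" if "f \<in> V" for f unfolding m_def by (rule cINF_lower[OF bb that])
  have "\<exists>f\<in>V. J f < m + 1 / (real n + 1)" for n
  proof -
    have "m < m + 1 / (real n + 1)" by (simp add: add_pos_nonneg)
    then show ?thesis using cINF_less_iff[OF _ bb] V unfolding m_def L2_subspace_def by blast
  qed
  then obtain v where v: "\<And>n. v n \<in> V" "\<And>n. J (v n) < m + 1 / (real n + 1)" by metis
  have dist2: "(L2_norm M (\<lambda>x. v i x - v j x))^2 \<le> 2 / (real i + 1) + 2 / (real j + 1)" for i j
  proof -
    let ?f = "v i" and ?g = "v j"
    let ?h = "\<lambda>x. (1/2) * v i x + (1/2) * v j x"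
    have f: "?f \<in> L2 M" and g: "?g \<in> L2 M" using VL v by auto
    have g': "(\<lambda>x. - 1 * ?g x) \<in> L2 M" by (rule L2_cmult[OF g])
    have ff: "(\<lambda>x. (1/2) * ?f x) \<in> L2 M" "(\<lambda>x. (1/2) * ?g x) \<in> L2 M" using L2_cmult f g by blast+
    have "L2_inner M ?f (\<lambda>x. - 1 * ?g x) = - L2_inner M ?f ?g"
      using L2_inner_lin_right[OF g g f, of "-1" 0] by simp
    then have 1: "(L2_norm M (\<lambda>x. ?f x - ?g x))^2 = (L2_norm M ?f)^2 - 2 * Re (L2_inner M ?f ?g) + (L2_norm M ?g)^2"
      using L2_norm_sq_add[OF f g'] L2_norm_cmult[of M "-1" ?g] by simp
    have "L2_inner M (\<lambda>x. (1/2) * ?f x) (\<lambda>x. (1/2) * ?g x) = (1/2) * L2_inner M (\<lambda>x. (1/2) * ?f x) ?g"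
      using L2_inner_lin_right[OF g g ff(1), of "1/2" 0] by simp
    also have "\<dots> = (1/2) * ((1/2) * L2_inner M ?f ?g)"
      using L2_inner_lin_left[OF f f g, of "1/2" 0] by (simp add: mult.commute)
    finally have "4 * Re (L2_inner M (\<lambda>x. (1/2) * ?f x) (\<lambda>x. (1/2) * ?g x)) = 4 * Re ((1/2) * ((1/2) * L2_inner M ?f ?g))"
      by (rule arg_cong)
    then have "4 * Re (L2_inner M (\<lambda>x. (1/2) * ?f x) (\<lambda>x. (1/2) * ?g x)) = Re (L2_inner M ?f ?g)" by simp
    then have 2: "4 * (L2_norm M ?h)^2 = (L2_norm M ?f)^2 + 2 * Re (L2_inner M ?f ?g) + (L2_norm M ?g)^2"
      using L2_norm_sq_add[OF ff] unfolding L2_norm_cmult by (simp add: power_mult_distrib power_divide)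
    have 3: "l ?h = (l ?f + l ?g) / 2" using lin[OF v(1) v(1), of "1/2" i "1/2" j] by (simp add: add_divide_distrib)
    have "(L2_norm M (\<lambda>x. ?f x - ?g x))^2 = 2 * J ?f + 2 * J ?g - 4 * J ?h"
      unfolding J_def 1 3 using 2 by (simp add: field_simps)
    also have "\<dots> \<le> 2 / (real i + 1) + 2 / (real j + 1)"
      using v(2)[of i] v(2)[of j] m[OF Vlin[OF v(1) v(1)], of "1/2" i "1/2" j] by simp
    finally show ?thesis .
  qed
  have "\<exists>N. \<forall>i\<ge>N. \<forall>j\<ge>N. L2_norm M (\<lambda>x. v i x - v j x) < e" if "e > 0" for e
  proof -
    obtain N :: nat where N: "4 / e^2 < real N" using reals_Archimedean2 by blast
    moreover have "0 < 4 / e^2" using that by simp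
    ultimately have N0: "real N > 0" by linarith
    have "L2_norm M (\<lambda>x. v i x - v j x) < e" if "i \<ge> N" "j \<ge> N" for i j
    proof (rule power2_less_imp_less)
      have "(L2_norm M (\<lambda>x. v i x - v j x))^2 \<le> 2 / (real i + 1) + 2 / (real j + 1)" by (rule dist2)
      also have "\<dots> \<le> 2 / real N + 2 / real N" using that N0 by (intro add_mono divide_left_mono) auto
      also have "\<dots> < e^2" using N N0 \<open>e > 0\<close> by (simp add: field_simps)
      finally show "(L2_norm M (\<lambda>x. v i x - v j x))^2 < e^2" .
    qed (use \<open>e > 0\<close> in simp)
    then show ?thesis by blast
  qed
  from L2_complete[OF assms(1) VL[OF v(1)] this] obtain u where
    u: "u \<in> L2 M" "(\<lambda>n. L2_norm M (\<lambda>x. v n x - u x)) \<longlonglongrightarrow> 0" by blast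
  have "l f = L2_inner M f u" if f: "f \<in> V" for f
  proof -
    define d where "d = L2_inner M f u - l f"
    have ineq: "0 \<le> 2 * Re (t * d) + (cmod t)^2 * (L2_norm M f)^2" for t
    proof (rule tendsto_lowerbound)
      let ?g = "\<lambda>n. 2 * Re (t * (L2_inner M f (v n) - l f)) + (cmod t)^2 * (L2_norm M f)^2 + 1 / (real n + 1)"
      have "?g \<longlonglongrightarrow> 2 * Re (t * (L2_inner M f u - l f)) + (cmod t)^2 * (L2_norm M f)^2 + 0"
        using LIMSEQ_inverse_real_of_nat
        by (intro tendsto_intros L2_inner_tendsto(2)[OF VL[OF v(1)] u(1) VL[OF f] u(2)])
           (simp add: inverse_eq_divide add.commute)
      then show "?g \<longlonglongrightarrow> 2 * Re (t * d) + (cmod t)^2 * (L2_norm M f)^2" by (simp add: d_def)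
      show "\<forall>\<^sub>F n in sequentially. 0 \<le> ?g n"
      proof (rule always_eventually, rule allI)
        fix n
        have tf: "(\<lambda>x. t * f x) \<in> L2 M" and vn: "v n \<in> L2 M" using L2_cmult VL f v by blast+
        have "m \<le> J (\<lambda>x. v n x + t * f x)" using m[OF Vlin[OF v(1) f], of 1 n t] by simp
        also have "\<dots> = J (v n) + 2 * Re (t * (L2_inner M f (v n) - l f)) + (cmod t)^2 * (L2_norm M f)^2"
        proof -
          have "L2_inner M (v n) (\<lambda>x. t * f x) = cnj (t * L2_inner M f (v n))"
            using L2_inner_lin_right[OF VL[OF f] VL[OF f] vn, of t 0] L2_inner_commute[of M "v n" f] by simp
          then have "Re (L2_inner M (v n) (\<lambda>x. t * f x)) = Re (t * L2_inner M f (v n))" by simp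
          then show ?thesis
            using lin[OF v(1) f, of 1 n t] unfolding J_def L2_norm_sq_add[OF vn tf] L2_norm_cmult
            by (simp add: power_mult_distrib algebra_simps)
        qed
        finally show "0 \<le> ?g n" using v(2)[of n] by simp
      qed
    qed simp
    have "d = 0"
    proof (rule ccontr)
      assume "d \<noteq> 0"
      \<comment> \<open>In the direction \<open>- cnj d\<close> the linear term decreases; this step size keeps the quadratic
    term below it.\<close>
      define s where "s = 1 / (1 + (L2_norm M f)^2)"
      have s: "s > 0" "s * (L2_norm M f)^2 < 1" unfolding s_def 
        by (auto simp: add_pos_nonneg field_simps)
      have "0 \<le> 2 * Re (- of_real s * cnj d * d) + (cmod (- of_real s * cnj d))^2 * (L2_norm M f)^2"
        by (rule ineq)
      also have "- of_real s * cnj d * d = of_real (- s * (cmod d)^2)"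
        by (simp add: complex_norm_square mult.commute del: of_real_power)
      also have "(cmod (- of_real s * cnj d))^2 = s^2 * (cmod d)^2" using s by (simp add: norm_mult power_mult_distrib)
      finally have "0 \<le> s * (cmod d)^2 * (s * (L2_norm M f)^2 - 2)"
        by (simp add: algebra_simps power2_eq_square)
      moreover have "s * (cmod d)^2 * (s * (L2_norm M f)^2 - 2) < 0"
        using s \<open>d \<noteq> 0\<close> by (intro mult_pos_neg mult_pos_pos) auto
      ultimately show False by simp
    qed
    then show ?thesis by (simp add: d_def)
  qed
  then show ?thesis using that[OF u(1) v(1) u(2)] by blast
qed

text \<open>The projection of \<open>f\<close> represents the functional \<open>h \<mapsto> \<langle>h, f\<rangle>\<close> on \<open>H\<close>.\<close>

lemma L2_projection_exists:
  assumes "finite_measure M" "L2_subspace M H" "L2_closed M H" "f \<in> L2 M"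
  shows "\<exists>g\<in>H. \<forall>h\<in>H. L2_inner M (\<lambda>x. f x - g x) h = 0"
proof -
  have HL: "h \<in> L2 M" if "h \<in> H" for h using assms(2) that by (auto simp: L2_subspace_def)
  obtain u v where uv: "u \<in> L2 M" "\<And>n::nat. v n \<in> H" "(\<lambda>n. L2_norm M (\<lambda>x. v n x - u x)) \<longlonglongrightarrow> 0"
    "\<And>h. h \<in> H \<Longrightarrow> L2_inner M h f = L2_inner M h u"
  proof (rule L2_Riesz[OF assms(1,2), of "\<lambda>h. L2_inner M h f" "L2_norm M f"])
    show "L2_inner M (\<lambda>x. a * g x + b * h x) f = a * L2_inner M g f + b * L2_inner M h f"
      if "g \<in> H" "h \<in> H" for g h a b
      by (rule L2_inner_lin_left[OF HL[OF that(1)] HL[OF that(2)] assms(4)])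
    show "cmod (L2_inner M h f) \<le> L2_norm M f * L2_norm M h" if "h \<in> H" for h
      using L2_Cauchy_Schwarz[OF HL[OF that] assms(4)] by (simp add: mult.commute)
  qed (rule that)
  have "u \<in> H" using assms(3)[unfolded L2_closed_def, rule_format, OF uv(2,1,3)] .
  moreover have "L2_inner M (\<lambda>x. f x - u x) h = 0" if "h \<in> H" for h
    using uv(4)[OF that] L2_inner_diff_left[OF assms(4) uv(1) HL[OF that]]
    by (simp add: L2_inner_commute[of M f] L2_inner_commute[of M u])
  ultimately show ?thesis by blast
qed

lemma orth_proj:
  assumes "finite_measure M" "L2_subspace M H" "L2_closed M H" "f \<in> L2 M"
  shows "orth_proj M H f \<in> H" "\<And>h. h \<in> H \<Longrightarrow> L2_inner M (orth_proj M H f) h = L2_inner M f h"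
proof -
  have HL: "h \<in> L2 M" if "h \<in> H" for h using assms(2) that by (auto simp: L2_subspace_def)
  have *: "orth_proj M H f \<in> H \<and> (\<forall>h\<in>H. L2_inner M (\<lambda>x. f x - orth_proj M H f x) h = 0)"
    using someI_ex[OF L2_projection_exists[OF assms, unfolded Bex_def]] unfolding orth_proj_def by simp
  then show 1: "orth_proj M H f \<in> H" by blast
  show "L2_inner M (orth_proj M H f) h = L2_inner M f h" if "h \<in> H" for h
    using * that L2_inner_diff_left[OF assms(4) HL[OF 1] HL[OF that]] by auto
qed

text \<open>The adjoint of multiplication by \<open>w\<close> is \<open>g \<mapsto> P (cnj w g)\<close>, so adjoints exist as soon as
  projections do, and the choice in the definition of the adjoint is one with the adjoint property.\<close>

lemma adjoint_on_mult:
  assumes "finite_measure M" "L2_subspace M H" "L2_closed M H"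
    and w: "w \<in> borel_measurable M" "AE x in M. cmod (w x) \<le> C"
  defines "S \<equiv> adjoint_on M H (\<lambda>f x. w x * f x)"
  assumes g: "g \<in> H"
  shows "S g \<in> H" "f \<in> H \<Longrightarrow> L2_inner M (S g) f = L2_inner M g (\<lambda>x. w x * f x)"
proof -
  have HL: "h \<in> L2 M" if "h \<in> H" for h using assms(2) that by (auto simp: L2_subspace_def)
  let ?P = "\<lambda>S. (\<forall>f\<in>H. S f \<in> H) \<and> (\<forall>f\<in>H. \<forall>g\<in>H. L2_inner M (\<lambda>x. w x * f x) g = L2_inner M f (S g))"
  have wg: "(\<lambda>x. cnj (w x) * g x) \<in> L2 M" if "g \<in> H" for g
    by (rule L2_bounded_mult[OF HL[OF that]]) (use w in auto)
  have "?P (\<lambda>g. orth_proj M H (\<lambda>x. cnj (w x) * g x))"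
  proof (intro conjI ballI)
    fix f g assume fg: "f \<in> H" "g \<in> H"
    have "L2_inner M f (orth_proj M H (\<lambda>x. cnj (w x) * g x)) = L2_inner M f (\<lambda>x. cnj (w x) * g x)"
      by (subst (1 2) L2_inner_commute) (simp add: orth_proj(2)[OF assms(1-3) wg[OF fg(2)] fg(1)])
    then show "L2_inner M (\<lambda>x. w x * f x) g = L2_inner M f (orth_proj M H (\<lambda>x. cnj (w x) * g x))"
      by (simp add: L2_inner_def mult_ac)
  qed (simp add: orth_proj(1)[OF assms(1-3) wg])
  then have *: "?P S" unfolding S_def adjoint_on_def by (rule someI[of ?P])
  then show "S g \<in> H" using g by blast
  show "L2_inner M (S g) f = L2_inner M g (\<lambda>x. w x * f x)" if "f \<in> H"
    using * g that by (subst (1 2) L2_inner_commute) simp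
qed

lemma eq_AE_by_inner:
  assumes V: "L2_subspace M V" and fg: "f \<in> V" "g \<in> V"
    and eq: "\<And>h. h \<in> V \<Longrightarrow> L2_inner M f h = L2_inner M g h"
  shows "AE x in M. f x = g x"
proof -
  have VL: "h \<in> L2 M" if "h \<in> V" for h using V that by (auto simp: L2_subspace_def)
  have d: "(\<lambda>x. f x - g x) \<in> V" using L2_subspaceD(3)[OF V fg] .
  have "L2_inner M (\<lambda>x. f x - g x) (\<lambda>x. f x - g x) = 0"
    using eq[OF d] L2_inner_diff_left[OF VL[OF fg(1)] VL[OF fg(2)] VL[OF d]] by simp
  then show ?thesis using L2_norm_eq_0[OF VL[OF d]] by (simp add: L2_inner_self)
qed

section \<open>The Shilov boundary of the tetrablock and density of polynomials\<close>

lemma shilov_tetrablockD: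
  assumes "z \<in> shilov_tetrablock"
  shows "cnj (z$3) * z$3 = 1" "cnj (z$1) = cnj (z$3) * z$2" "cnj (z$2) = cnj (z$3) * z$1"
    "cmod (z$3) = 1" "cmod (z$1) \<le> 1" "cmod (z$2) \<le> 1" "cmod (z$i) \<le> 1"
proof -
  have z: "z$1 = cnj (z$2) * z$3" "cmod (z$3) = 1" "cmod (z$2) \<le> 1"
    using assms by (auto simp: shilov_tetrablock_def)
  then show "cmod (z$3) = 1" "cmod (z$2) \<le> 1" "cmod (z$1) \<le> 1" by (auto simp: norm_mult)
  then show "cmod (z$i) \<le> 1" using exhaust_3[of i] by auto
  show 3: "cnj (z$3) * z$3 = 1" using z(2) by (simp add: complex_norm_square[symmetric] mult.commute)
  show "cnj (z$1) = cnj (z$3) * z$2" by (simp add: z(1) mult.commute)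
  have "cnj (z$3) * z$1 = cnj (z$2) * (cnj (z$3) * z$3)" unfolding z(1) by (simp only: mult_ac)
  then show "cnj (z$2) = cnj (z$3) * z$1" using 3 by simp
qed

lemma compact_shilov_tetrablock: "compact shilov_tetrablock"
proof -
  have "closed shilov_tetrablock" unfolding shilov_tetrablock_def
    by (intro closed_Collect_conj closed_Collect_eq closed_Collect_le continuous_intros)
  moreover have "norm z \<le> (\<Sum>i\<in>(UNIV::3 set). 1)" if "z \<in> shilov_tetrablock" for z
    using that unfolding norm_vec_def
    by (intro order_trans[OF L2_set_le_sum] sum_mono shilov_tetrablockD(7)) auto
  then have "bounded shilov_tetrablock" by (auto simp: bounded_iff)
  ultimately show ?thesis by (simp add: compact_eq_bounded_closed)
qed

definition L2_dense :: "'a measure \<Rightarrow> ('a \<Rightarrow> complex) set \<Rightarrow> bool" where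
  "L2_dense M A \<longleftrightarrow> (\<forall>f\<in>L2 M. \<exists>v. (\<forall>n::nat. v n \<in> A) \<and> (\<lambda>n. L2_norm M (\<lambda>x. v n x - f x)) \<longlonglongrightarrow> 0)"

text \<open>Encoded by real and imaginary part, so that the real Stone-Weierstrass theorem and induction over
  real polynomials apply.\<close>

definition complex_polys :: "('a::euclidean_space \<Rightarrow> complex) set" where
  "complex_polys = {\<lambda>z. of_real (p z) + \<i> * of_real (q z) | p q.
     real_polynomial_function p \<and> real_polynomial_function q}"

lemma continuous_on_real_polynomial_function:
  "real_polynomial_function p \<Longrightarrow> continuous_on S p"
  by (simp add: continuous_at_imp_continuous_on continuous_real_polymonial_function)

lemma complex_polysI:
  "real_polynomial_function p \<Longrightarrow> real_polynomial_function q \<Longrightarrow>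
    (\<lambda>z. of_real (p z) + \<i> * of_real (q z)) \<in> complex_polys"
  by (auto simp: complex_polys_def)

lemma complex_polys_continuous:
  assumes "a \<in> complex_polys" shows "continuous_on S a"
  using assms unfolding complex_polys_def
  by (auto intro!: continuous_intros continuous_on_real_polynomial_function)

lemma complex_polys_lin:
  assumes "a \<in> complex_polys" "b \<in> complex_polys"
  shows "(\<lambda>z. c * a z + d * b z) \<in> complex_polys"
proof -
  obtain p q p' q' where *: "real_polynomial_function p" "real_polynomial_function q"
    "real_polynomial_function p'" "real_polynomial_function q'"
    "a = (\<lambda>z. of_real (p z) + \<i> * of_real (q z))" "b = (\<lambda>z. of_real (p' z) + \<i> * of_real (q' z))"
    using assms by (auto simp: complex_polys_def)
  have "(\<lambda>z. c * a z + d * b z) = (\<lambda>z. of_real ((Re c * p z + (- Im c) * q z) + (Re d * p' z + (- Im d) * q' z))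
     + \<i> * of_real ((Re c * q z + Im c * p z) + (Re d * q' z + Im d * p' z)))"
    by (auto simp: *(5,6) complex_eq_iff algebra_simps)
  also have "\<dots> \<in> complex_polys"
    by (intro complex_polysI real_polynomial_function.intros(2-4) *(1-4))
  finally show ?thesis .
qed

lemma complex_polys_cnj:
  assumes "a \<in> complex_polys" shows "(\<lambda>z. cnj (a z)) \<in> complex_polys"
proof -
  obtain p q where *: "real_polynomial_function p" "real_polynomial_function q"
    "a = (\<lambda>z. of_real (p z) + \<i> * of_real (q z))"
    using assms by (auto simp: complex_polys_def)
  have "(\<lambda>z. cnj (a z)) = (\<lambda>z. of_real (p z) + \<i> * of_real ((-1) * q z))" by (auto simp: *(3))
  also have "\<dots> \<in> complex_polys"
    by (intro complex_polysI real_polynomial_function.intros(2-4) *(1,2))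
  finally show ?thesis .
qed

context
  fixes M :: "'a::euclidean_space measure" and S
  assumes S: "compact S" and M: "finite_measure M" "sets M = sets (restrict_space borel S)"
begin

lemma continuous_measurable: 
  fixes f :: "'a \<Rightarrow> 'b::topological_space"
  shows "continuous_on S f \<Longrightarrow> f \<in> borel_measurable M"
  using borel_measurable_continuous_on_restrict measurable_cong_sets[OF M(2) refl] by blast

lemma space_compact_measure: "space M = S"
  using sets_eq_imp_space_eq[OF M(2)] by (simp add: space_restrict_space)

lemma continuous_L2:
  assumes "continuous_on S f" shows "f \<in> L2 M" 
proof -
  obtain B where "\<And>x. x \<in> S \<Longrightarrow> cmod (f x) \<le> B"
    using compact_imp_bounded[OF compact_continuous_image[OF assms S]] unfolding bounded_iff by blast
  then show ?thesis
    by (intro L2_bounded[OF M(1) continuous_measurable[OF assms], of B]) (auto simp: space_compact_measure)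
qed

text \<open>By Stone-Weierstrass \<open>cnj v\<close> integrates to zero against every continuous function, hence by
  dominated convergence over every closed set, hence (by the \<open>\<pi>\<close>-\<open>\<lambda>\<close> theorem) over every Borel set.\<close>

lemma orthogonal_polys_zero:
  assumes v: "v \<in> L2 M" and orth: "\<And>a. a \<in> complex_polys \<Longrightarrow> L2_inner M a v = 0"
  shows "AE x in M. v x = 0"
proof -
  interpret finite_measure M by (rule M)
  have one: "(\<lambda>x. 1) \<in> L2 M" by (rule continuous_L2) (rule continuous_on_const)
  have vi: "integrable M (\<lambda>x. cnj (v x))" using L2_mult_integrable(1)[OF one v] by simp
  note [measurable] = L2_measurable[OF v]
  have cont: "(\<integral>x. of_real (g x) * cnj (v x) \<partial>M) = 0" if g: "continuous_on S g" for g :: "'a \<Rightarrow> real"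
  proof -
    let ?I = "\<integral>x. of_real (g x) * cnj (v x) \<partial>M"
    let ?K = "\<integral>x. cmod (v x) \<partial>M"
    have cg: "continuous_on S (\<lambda>x. complex_of_real (g x))" using g by (intro continuous_intros)
    have "cmod ?I \<le> e * ?K" if "e > 0" for e
    proof -
      obtain p where p: "real_polynomial_function p" "\<And>x. x \<in> S \<Longrightarrow> \<bar>g x - p x\<bar> < e"
        using Stone_Weierstrass_real_polynomial_function[OF S g \<open>e > 0\<close>] by blast
      have cp: "continuous_on S (\<lambda>x. complex_of_real (p x))" 
        using continuous_on_real_polynomial_function[OF p(1)] by (intro continuous_intros)
      have "(\<lambda>z. of_real (p z) + \<i> * of_real ((\<lambda>_. 0) z)) \<in> complex_polys"
        by (intro complex_polysI p(1) real_polynomial_function.intros(2))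
      from orth[OF this] have 0: "(\<integral>x. of_real (p x) * cnj (v x) \<partial>M) = 0" by (simp add: L2_inner_def)
      have "?I = ?I - (\<integral>x. of_real (p x) * cnj (v x) \<partial>M)" using 0 by simp
      also have "\<dots> = (\<integral>x. of_real (g x) * cnj (v x) - of_real (p x) * cnj (v x) \<partial>M)"
        by (rule Bochner_Integration.integral_diff[symmetric, OF L2_mult_integrable(1)[OF continuous_L2[OF cg] v] L2_mult_integrable(1)[OF continuous_L2[OF cp] v]])
      also have "cmod \<dots> \<le> (\<integral>x. e * cmod (v x) \<partial>M)"
      proof (rule Bochner_Integration.integral_norm_bound_integral)
        show "integrable M (\<lambda>x. of_real (g x) * cnj (v x) - of_real (p x) * cnj (v x))"
          by (intro Bochner_Integration.integrable_diff L2_mult_integrable(1) continuous_L2 cg cp v)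
        show "integrable M (\<lambda>x. e * cmod (v x))" using integrable_norm[OF vi] by simp
        fix x assume "x \<in> space M"
        then have "\<bar>g x - p x\<bar> \<le> e" using p(2)[of x] by (simp add: space_compact_measure)
        moreover have "cmod (of_real (g x) * cnj (v x) - of_real (p x) * cnj (v x)) = \<bar>g x - p x\<bar> * cmod (v x)"
          by (simp flip: left_diff_distrib of_real_diff add: norm_mult)
        ultimately show "cmod (of_real (g x) * cnj (v x) - of_real (p x) * cnj (v x)) \<le> e * cmod (v x)"
          by (simp add: mult_right_mono)
      qed
      finally show ?thesis by simp
    qed
    moreover have "((\<lambda>e. e * ?K) \<longlongrightarrow> 0 * ?K) (at_right 0)" by (intro tendsto_intros)
    ultimately have "cmod ?I \<le> 0 * ?K"
      by (intro tendsto_lowerbound[of "\<lambda>e. e * ?K" _ "at_right 0"]) (auto intro!: eventually_at_rightI[of 0 1])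
    then show ?thesis by simp
  qed
  have clos: "(\<integral>x. indicator C x * cnj (v x) \<partial>M) = 0" if C: "closed C" for C :: "'a set"
  proof (cases "C = {}")
    case False
    \<comment> \<open>Continuous functions decreasing to the indicator of \<open>C\<close>.\<close>
    define g where "g = (\<lambda>k::nat. \<lambda>x. max 0 (1 - real k * infdist x C))"
    have "(\<lambda>k. \<integral>x. of_real (g k x) * cnj (v x) \<partial>M) \<longlonglongrightarrow> (\<integral>x. indicator C x * cnj (v x) \<partial>M)"
    proof (rule integral_dominated_convergence[where w="\<lambda>x. cmod (v x)"])
      show "(\<lambda>x. indicator C x * cnj (v x)) \<in> borel_measurable M"
        using C M(2) by (intro borel_measurable_times borel_measurable_indicator')
           (auto simp: sets_restrict_space space_compact_measure simp flip: sets_eq_imp_space_eq)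
      show "(\<lambda>x. of_real (g k x) * cnj (v x)) \<in> borel_measurable M" for k
        by (intro borel_measurable_times continuous_measurable borel_measurable_cnj L2_measurable v)
           (auto simp: g_def intro!: continuous_intros)
      show "integrable M (\<lambda>x. cmod (v x))" using integrable_norm[OF vi] by simp
      show "AE x in M. (\<lambda>k. of_real (g k x) * cnj (v x)) \<longlonglongrightarrow> indicator C x * cnj (v x)"
      proof (rule AE_I2)
        fix x
        have "(\<lambda>k. g k x) \<longlonglongrightarrow> indicator C x"
        proof (cases "x \<in> C")
          case True then show ?thesis by (simp add: g_def)
        next
          case F: False
          then have pos: "infdist x C > 0" using C False
            by (metis infdist_nonneg in_closed_iff_infdist_zero order_less_le)
          obtain N :: nat where N: "1 / infdist x C < real N" using reals_Archimedean2 by blast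
          have "g k x = 0" if "k \<ge> N" for k
          proof -
            have "1 < real N * infdist x C" using N pos by (simp add: field_simps)
            also have "\<dots> \<le> real k * infdist x C" using that pos by (intro mult_right_mono) auto
            finally show ?thesis by (simp add: g_def)
          qed
          then have "(\<lambda>k. g k x) \<longlonglongrightarrow> 0" by (intro tendsto_eventually eventually_sequentiallyI[of N])
          then show ?thesis using F by simp
        qed
        then have "(\<lambda>k. complex_of_real (g k x) * cnj (v x)) \<longlonglongrightarrow> of_real (indicator C x) * cnj (v x)"
          by (intro tendsto_intros)
        then show "(\<lambda>k. of_real (g k x) * cnj (v x)) \<longlonglongrightarrow> indicator C x * cnj (v x)"
          by (cases "x \<in> C") auto
      qed
      show "AE x in M. cmod (of_real (g k x) * cnj (v x)) \<le> cmod (v x)" for k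
        by (rule AE_I2) (auto simp: norm_mult g_def infdist_nonneg intro!: mult_left_le_one_le)
    qed
    moreover have "(\<integral>x. of_real (g k x) * cnj (v x) \<partial>M) = 0" for k
      by (rule cont) (auto simp: g_def intro!: continuous_intros)
    ultimately show ?thesis by (simp add: LIMSEQ_unique)
  qed simp
  have ind_int: "integrable M (\<lambda>x. indicator B x * cnj (v x))" if "B \<in> sets borel" for B
  proof (rule Bochner_Integration.integrable_bound[OF vi])
    show "(\<lambda>x. indicator B x * cnj (v x)) \<in> borel_measurable M"
      using that M(2) by (intro borel_measurable_times borel_measurable_indicator')
        (auto simp: sets_restrict_space space_compact_measure)
  qed (auto simp: indicator_def)
  have borel: "(\<integral>x. indicator B x * cnj (v x) \<partial>M) = 0" if "B \<in> sets borel" for B :: "'a set"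
  proof -
    have "Int_stable (Collect (closed :: 'a set \<Rightarrow> bool))" "Collect (closed :: 'a set \<Rightarrow> bool) \<subseteq> Pow UNIV"
      "B \<in> sigma_sets UNIV (Collect closed)" 
      using that by (auto simp: Int_stable_def borel_eq_closed)
    then show ?thesis
    proof (induction rule: sigma_sets_induct_disjoint)
      case (basic A) then show ?case using clos by simp
    next
      case (compl A)
      then have A: "A \<in> sets borel" by (simp add: borel_eq_closed)
      have "(\<integral>x. indicator (UNIV - A) x * cnj (v x) \<partial>M) = (\<integral>x. indicator UNIV x * cnj (v x) - indicator A x * cnj (v x) \<partial>M)"
        by (intro Bochner_Integration.integral_cong) (auto simp: indicator_def)
      also have "\<dots> = 0" using ind_int[OF A] compl clos[of UNIV] vi by simp
      finally show ?case .
    next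
      case (union A)
      then have A: "A i \<in> sets borel" for i by (auto simp: borel_eq_closed)
      have "(\<lambda>n. \<integral>x. (\<Sum>i<n. indicator (A i) x * cnj (v x)) \<partial>M) \<longlonglongrightarrow> (\<integral>x. indicator (\<Union>i. A i) x * cnj (v x) \<partial>M)"
      proof (rule integral_dominated_convergence[where w="\<lambda>x. cmod (v x)"])
        show "(\<lambda>x. indicator (\<Union>i. A i) x * cnj (v x)) \<in> borel_measurable M"
          using ind_int[of "\<Union>i. A i"] A by (auto intro: borel_measurable_integrable)
        show "(\<lambda>x. \<Sum>i<n. indicator (A i) x * cnj (v x)) \<in> borel_measurable M" for n
          using ind_int[OF A] by (intro borel_measurable_sum) (auto intro: borel_measurable_integrable)
        show "integrable M (\<lambda>x. cmod (v x))" using integrable_norm[OF vi] by simp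
        have sum_ind: "(\<Sum>i<n. indicator (A i) x * cnj (v x)) = indicator (\<Union>i<n. A i) x * cnj (v x)" for n x
          using union(1) by (subst indicator_UN_disjoint) (auto simp: sum_distrib_right disjoint_family_on_def)
        show "AE x in M. (\<lambda>n. \<Sum>i<n. indicator (A i) x * cnj (v x)) \<longlonglongrightarrow> indicator (\<Union>i. A i) x * cnj (v x)"
        proof (rule AE_I2, subst sum_ind)
          fix x
          show "(\<lambda>n. indicator (\<Union>i<n. A i) x * cnj (v x)) \<longlonglongrightarrow> indicator (\<Union>i. A i) x * cnj (v x)"
          proof (cases "x \<in> (\<Union>i. A i)")
            case True
            then obtain i where i: "x \<in> A i" by blast
            show ?thesis
              by (rule tendsto_eventually, rule eventually_sequentiallyI[of "Suc i"]) (use i True in \<open>auto simp: indicator_def\<close>)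
          qed (simp add: indicator_def)
        qed
        show "AE x in M. cmod (\<Sum>i<n. indicator (A i) x * cnj (v x)) \<le> cmod (v x)" for n
          unfolding sum_ind by (simp add: indicator_def)
      qed
      moreover have "(\<integral>x. (\<Sum>i<n. indicator (A i) x * cnj (v x)) \<partial>M) = 0" for n
        using ind_int[OF A] union by (subst Bochner_Integration.integral_sum) auto
      ultimately show ?case by (simp add: LIMSEQ_unique)
    qed simp
  qed
  have "AE x in M. cnj (v x) = 0"
  proof (rule density_zero[OF vi])
    fix A assume "A \<in> sets M"
    then obtain B where B: "B \<in> sets borel" "A = S \<inter> B" unfolding M(2) sets_restrict_space by blast
    have "set_lebesgue_integral M A (\<lambda>x. cnj (v x)) = (\<integral>x. indicator B x * cnj (v x) \<partial>M)"
      unfolding set_lebesgue_integral_def by (intro Bochner_Integration.integral_cong)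
        (auto simp: B(2) space_compact_measure indicator_def)
    then show "set_lebesgue_integral M A (\<lambda>x. cnj (v x)) = 0" using borel[OF B(1)] by simp
  qed
  then show ?thesis by simp
qed

lemma polys_subspace: "L2_subspace M complex_polys"
  unfolding L2_subspace_def
proof (intro conjI ballI allI)
  show "complex_polys \<subseteq> L2 M" using continuous_L2 complex_polys_continuous by blast
  have "(\<lambda>z. of_real ((\<lambda>_. 0) z) + \<i> * of_real ((\<lambda>_. 0) z)) \<in> complex_polys"
    by (intro complex_polysI real_polynomial_function.intros)
  then show "(complex_polys :: ('a \<Rightarrow> complex) set) \<noteq> {}" by blast
qed (rule complex_polys_lin)

text \<open>The element representing \<open>h \<mapsto> \<langle>h, f\<rangle>\<close> on the polynomials is a limit of polynomials, and it
  differs from \<open>f\<close> by a function orthogonal to all polynomials.\<close>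

lemma polys_dense: "L2_dense M complex_polys"
  unfolding L2_dense_def
proof
  fix f assume f: "f \<in> L2 M"
  note PL = L2_subspaceD(1)[OF polys_subspace]
  obtain u v where uv: "u \<in> L2 M" "\<And>n::nat. v n \<in> complex_polys" "(\<lambda>n. L2_norm M (\<lambda>x. v n x - u x)) \<longlonglongrightarrow> 0"
    "\<And>a. a \<in> complex_polys \<Longrightarrow> L2_inner M a f = L2_inner M a u"
  proof (rule L2_Riesz[OF M(1) polys_subspace, of "\<lambda>h. L2_inner M h f" "L2_norm M f"])
    show "L2_inner M (\<lambda>x. a * g x + b * h x) f = a * L2_inner M g f + b * L2_inner M h f"
      if "g \<in> complex_polys" "h \<in> complex_polys" for g h a b
      by (rule L2_inner_lin_left[OF PL[OF that(1)] PL[OF that(2)] f])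
    show "cmod (L2_inner M h f) \<le> L2_norm M f * L2_norm M h" if "h \<in> complex_polys" for h
      using L2_Cauchy_Schwarz[OF PL[OF that] f] by (simp add: mult.commute)
  qed (rule that)
  have "AE x in M. u x - f x = 0"
    by (rule orthogonal_polys_zero[OF L2_diff[OF uv(1) f]])
       (simp add: L2_inner_diff_right[OF uv(1) f PL] uv(4))
  note PLm = PL[THEN L2_measurable] and [measurable] = L2_measurable[OF uv(1)] L2_measurable[OF f]
  have "L2_norm M (\<lambda>x. v n x - f x) = L2_norm M (\<lambda>x. v n x - u x)" for n
    using \<open>AE x in M. u x - f x = 0\<close> PLm[OF uv(2)[of n]]
    by (intro L2_norm_cong_AE) (auto elim!: AE_mp)
  then have "(\<lambda>n. L2_norm M (\<lambda>x. v n x - f x)) \<longlonglongrightarrow> 0" using uv(3) by simp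
  then show "\<exists>v. (\<forall>n::nat. v n \<in> complex_polys) \<and> (\<lambda>n. L2_norm M (\<lambda>x. v n x - f x)) \<longlonglongrightarrow> 0"
    using uv(2) by blast
qed

end

section \<open>Toeplitz operators on a Hardy space over the Shilov boundary of the tetrablock\<close>

lemma L2_closedD:
  assumes "L2_closed M V" "\<And>n::nat. v n \<in> V" "u \<in> L2 M" "(\<lambda>n. L2_norm M (\<lambda>x. v n x - u x)) \<longlonglongrightarrow> 0"
  shows "u \<in> V"
  using assms(1)[unfolded L2_closed_def, rule_format, of v u] assms(2-4) by blast

text \<open>The part of the argument that concerns only the boundary.  All that is used of the Hardy space
  is that it is a closed subspace of \<open>L\<^sup>2\<close> which contains the constants and is stable under the coordinate
  functions.\<close>

locale boundary_hardy_space =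
  fixes M :: "(complex^3) measure" and H :: "(complex^3 \<Rightarrow> complex) set"
  assumes fin: "finite_measure M" and sets_M: "sets M = sets (restrict_space borel shilov_tetrablock)"
    and sub: "L2_subspace M H" and closed: "L2_closed M H"
    and coord: "f \<in> H \<Longrightarrow> coord_mult i f \<in> H" and one: "(\<lambda>_. 1) \<in> H"
begin

lemma space_M: "space M = shilov_tetrablock"
  by (rule space_compact_measure[OF compact_shilov_tetrablock fin sets_M])

lemma continuous_measurable_M:
  fixes f :: "complex^3 \<Rightarrow> 'b::topological_space"
  shows "continuous_on shilov_tetrablock f \<Longrightarrow> f \<in> borel_measurable M"
  by (rule continuous_measurable[OF compact_shilov_tetrablock fin sets_M])

lemma measurable_nth [measurable]: "(\<lambda>z. z $ i) \<in> borel_measurable M"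
  by (intro continuous_measurable_M continuous_intros)

lemma nth_le_1: "AE z in M. cmod (z $ i) \<le> 1"
  by (rule AE_I2) (simp add: space_M shilov_tetrablockD(7))

lemmas HL = L2_subspaceD(1)[OF sub]
lemmas Hlin = L2_subspaceD(2)[OF sub]

lemma L2_coord: "f \<in> L2 M \<Longrightarrow> (\<lambda>z. z$i * f z) \<in> L2 M"
  by (rule L2_bounded_mult[OF _ measurable_nth nth_le_1])

lemma L2_coord_cnj: "f \<in> L2 M \<Longrightarrow> (\<lambda>z. cnj (z$i) * f z) \<in> L2 M"
  by (rule L2_bounded_mult[of _ _ _ 1]) (use nth_le_1 in auto)

lemma L2_coord_power: "f \<in> L2 M \<Longrightarrow> (\<lambda>z. z$i ^ n * f z) \<in> L2 M"
  by (rule L2_bounded_mult[of _ _ _ 1]) 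
     (use nth_le_1[of i] in \<open>auto simp: norm_power elim!: eventually_mono intro: power_le_one\<close>)

text \<open>The measure lives on the Shilov boundary, and closedness makes \<open>H\<close> insensitive to changes
  elsewhere.  The identities between coordinates hold only on that boundary.\<close>

lemma H_cong:
  assumes "f \<in> H" "g \<in> borel_measurable M" "\<And>z. z \<in> shilov_tetrablock \<Longrightarrow> f z = g z"
  shows "g \<in> H"
proof -
  note [measurable] = L2_measurable[OF HL[OF assms(1)]] assms(2)
  have *: "AE z in M. f z = g z" by (rule AE_I2) (simp add: space_M assms(3))
  have "integrable M (\<lambda>z. (cmod (f z))^2) \<longleftrightarrow> integrable M (\<lambda>z. (cmod (g z))^2)"
    by (rule integrable_cong_AE) (use * in \<open>auto elim!: eventually_mono\<close>)
  then have g: "g \<in> L2 M" using HL[OF assms(1)] by (simp add: L2_def)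
  have "L2_norm M (\<lambda>x. f x - g x) = L2_norm M (\<lambda>x. 0)"
    by (rule L2_norm_cong_AE) (use * in \<open>auto elim!: eventually_mono\<close>)
  then have "(\<lambda>n::nat. L2_norm M (\<lambda>x. f x - g x)) \<longlonglongrightarrow> 0" by simp
  then show ?thesis
    by (rule L2_closedD[OF closed assms(1) g])
qed

lemma operator_eq_iff_inner:
  assumes "\<And>f. f \<in> H \<Longrightarrow> A f \<in> H" "\<And>f. f \<in> H \<Longrightarrow> B f \<in> H"
  shows "operator_eq_on M H A B \<longleftrightarrow> (\<forall>f\<in>H. \<forall>g\<in>H. L2_inner M (A f) g = L2_inner M (B f) g)"
proof
  assume *: "operator_eq_on M H A B"
  show "\<forall>f\<in>H. \<forall>g\<in>H. L2_inner M (A f) g = L2_inner M (B f) g"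
  proof (intro ballI)
    fix f g assume fg: "f \<in> H" "g \<in> H"
    show "L2_inner M (A f) g = L2_inner M (B f) g"
      using * fg(1) unfolding operator_eq_on_def
      by (intro L2_inner_cong_AE L2_measurable HL assms fg) auto
  qed
qed (auto simp: operator_eq_on_def intro!: eq_AE_by_inner[OF sub] assms)

lemma adjoint_coord:
  assumes "g \<in> H"
  shows "adjoint_on M H (coord_mult i) g \<in> H"
    and "f \<in> H \<Longrightarrow> L2_inner M (adjoint_on M H (coord_mult i) g) f = L2_inner M g (coord_mult i f)"
proof -
  have *: "coord_mult i = (\<lambda>f z. z $ i * f z)" by (simp add: coord_mult_def fun_eq_iff)
  note a = adjoint_on_mult[OF fin sub closed measurable_nth[of i] nth_le_1[of i] assms]
  show "adjoint_on M H (coord_mult i) g \<in> H" using a(1) unfolding * .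
  show "f \<in> H \<Longrightarrow> L2_inner M (adjoint_on M H (coord_mult i) g) f = L2_inner M g (coord_mult i f)"
    using a(2) unfolding * .
qed

lemma adjoint_relation_iff:
  assumes "\<And>f. f \<in> H \<Longrightarrow> A f \<in> H" "\<And>f. f \<in> H \<Longrightarrow> B f \<in> H"
  shows "operator_eq_on M H A (adjoint_on M H (coord_mult i) \<circ> B) \<longleftrightarrow>
     (\<forall>f\<in>H. \<forall>g\<in>H. L2_inner M (A f) g = L2_inner M (B f) (coord_mult i g))"
  using operator_eq_iff_inner[of A "adjoint_on M H (coord_mult i) \<circ> B"] assms
  by (simp add: adjoint_coord)

end

locale boundary_operator = boundary_hardy_space +
  fixes T assumes T: "bounded_operator_on M H T"
begin

lemma T_H: "f \<in> H \<Longrightarrow> T f \<in> H"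
  using T by (simp add: bounded_operator_on_def)

lemma T_L2: "f \<in> H \<Longrightarrow> T f \<in> L2 M"
  using T_H HL by blast

lemma T_lin_AE: "f \<in> H \<Longrightarrow> g \<in> H \<Longrightarrow> AE x in M. T (\<lambda>y. a * f y + b * g y) x = a * T f x + b * T g x"
  using T by (simp add: bounded_operator_on_def)

lemma T_bound: obtains K where "K \<ge> 0" "\<And>f. f \<in> H \<Longrightarrow> L2_norm M (T f) \<le> K * L2_norm M f"
proof -
  obtain C where C: "\<And>f. f \<in> H \<Longrightarrow> L2_norm M (T f) \<le> C * L2_norm M f"
    using T unfolding bounded_operator_on_def by blast
  have "L2_norm M (T f) \<le> max C 0 * L2_norm M f" if "f \<in> H" for f
    by (rule order_trans[OF C[OF that]]) (intro mult_right_mono; simp)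
  then show ?thesis using that[of "max C 0"] by simp
qed

lemma inner_T_lin:
  assumes "f \<in> H" "g \<in> H" "h \<in> L2 M"
  shows "L2_inner M (T (\<lambda>y. a * f y + b * g y)) h = a * L2_inner M (T f) h + b * L2_inner M (T g) h"
proof -
  have "L2_inner M (T (\<lambda>y. a * f y + b * g y)) h = L2_inner M (\<lambda>x. a * T f x + b * T g x) h"
    by (rule L2_inner_cong_AE[OF T_lin_AE[OF assms(1,2)]])
       (use assms in \<open>auto intro!: L2_measurable L2_lin T_L2 Hlin\<close>)
  also have "\<dots> = a * L2_inner M (T f) h + b * L2_inner M (T g) h"
    by (intro L2_inner_lin_left T_L2 assms)
  finally show ?thesis .
qed

text \<open>Boundedness and linearity make \<open>T\<close> respect equality on the Shilov boundary.\<close>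

lemma inner_T_cong:
  assumes "f \<in> H" "f' \<in> H" "h \<in> L2 M" "\<And>z. z \<in> shilov_tetrablock \<Longrightarrow> f z = f' z"
  shows "L2_inner M (T f) h = L2_inner M (T f') h"
proof -
  obtain K where K: "\<And>f. f \<in> H \<Longrightarrow> L2_norm M (T f) \<le> K * L2_norm M f" using T_bound by blast
  let ?d = "\<lambda>y. 1 * f y + (-1) * f' y"
  have d: "?d \<in> H" by (rule Hlin[OF assms(1,2)])
  have "L2_norm M ?d = L2_norm M (\<lambda>x. 0)"
    by (rule L2_norm_cong_AE[OF L2_measurable[OF HL[OF d]]]) (auto intro!: AE_I2 simp: space_M assms(4))
  then have "L2_norm M (T ?d) = 0" using K[OF d] by (simp add: order.antisym)
  then have "cmod (L2_inner M (T ?d) h) \<le> 0" using L2_Cauchy_Schwarz[OF T_L2[OF d] assms(3)] by simp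
  then show ?thesis using inner_T_lin[OF assms(1-3), of 1 "-1"] by simp
qed

lemma toeplitz_iff_inner:
  assumes u: "u \<in> Linf M"
  shows "operator_eq_on M H T (toeplitz M H u) \<longleftrightarrow>
    (\<forall>f\<in>H. \<forall>g\<in>H. L2_inner M (T f) g = L2_inner M (\<lambda>z. u z * f z) g)"
proof -
  have uf: "(\<lambda>z. u z * f z) \<in> L2 M" if "f \<in> H" for f
    using u L2_bounded_mult[OF HL[OF that]] by (auto simp: Linf_def)
  note P = orth_proj[OF fin sub closed uf]
  show ?thesis
    by (subst operator_eq_iff_inner) (auto simp: toeplitz_def P T_H)
qed

text \<open>Operator equations on \<open>H\<close> are tested by inner products, which removes adjoints and projections
  from the three relations.\<close>

lemma relations_iff_inner:
  "operator_eq_on M H (T \<circ> coord_mult i) (adjoint_on M H (coord_mult j) \<circ> T \<circ> coord_mult k) \<longleftrightarrow>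
     (\<forall>f\<in>H. \<forall>g\<in>H. L2_inner M (T (coord_mult i f)) g = L2_inner M (T (coord_mult k f)) (coord_mult j g))"
  "operator_eq_on M H (adjoint_on M H (coord_mult j) \<circ> T \<circ> coord_mult k) T \<longleftrightarrow>
     (\<forall>f\<in>H. \<forall>g\<in>H. L2_inner M (T f) g = L2_inner M (T (coord_mult k f)) (coord_mult j g))"
proof -
  show "operator_eq_on M H (T \<circ> coord_mult i) (adjoint_on M H (coord_mult j) \<circ> T \<circ> coord_mult k) \<longleftrightarrow>
     (\<forall>f\<in>H. \<forall>g\<in>H. L2_inner M (T (coord_mult i f)) g = L2_inner M (T (coord_mult k f)) (coord_mult j g))"
    using adjoint_relation_iff[of "T \<circ> coord_mult i" "T \<circ> coord_mult k" j] by (simp add: T_H coord o_assoc)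
  have "operator_eq_on M H (adjoint_on M H (coord_mult j) \<circ> T \<circ> coord_mult k) T \<longleftrightarrow>
     operator_eq_on M H T (adjoint_on M H (coord_mult j) \<circ> (T \<circ> coord_mult k))"
    by (simp add: operator_eq_on_def o_assoc eq_commute)
  then show "operator_eq_on M H (adjoint_on M H (coord_mult j) \<circ> T \<circ> coord_mult k) T \<longleftrightarrow>
     (\<forall>f\<in>H. \<forall>g\<in>H. L2_inner M (T f) g = L2_inner M (T (coord_mult k f)) (coord_mult j g))"
    using adjoint_relation_iff[of T "T \<circ> coord_mult k" j] by (simp add: T_H coord)
qed

definition relations :: bool where
  "relations \<longleftrightarrow> (\<forall>f\<in>H. \<forall>g\<in>H.
     L2_inner M (T (coord_mult 1 f)) g = L2_inner M (T (coord_mult 3 f)) (coord_mult 2 g) \<and>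
     L2_inner M (T (coord_mult 2 f)) g = L2_inner M (T (coord_mult 3 f)) (coord_mult 1 g) \<and>
     L2_inner M (T f) g = L2_inner M (T (coord_mult 3 f)) (coord_mult 3 g))"

text \<open>Each relation is a pointwise identity of integrands on the Shilov boundary.\<close>

lemma toeplitz_imp_relations:
  assumes "\<And>f g. f \<in> H \<Longrightarrow> g \<in> H \<Longrightarrow> L2_inner M (T f) g = L2_inner M (\<lambda>z. u z * f z) g"
  shows relations
  unfolding relations_def
proof (intro ballI conjI)
  fix f g assume fg: "f \<in> H" "g \<in> H"
  note c = assms[OF coord[OF fg(1)] fg(2)] assms[OF coord[OF fg(1)] coord[OF fg(2)]] assms[OF fg]
  show "L2_inner M (T (coord_mult 1 f)) g = L2_inner M (T (coord_mult 3 f)) (coord_mult 2 g)"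
    unfolding c
  proof (rule L2_inner_cong)
    fix z assume "z \<in> space M"
    then have "cnj (cnj (z$1)) = cnj (cnj (z$3) * z$2)" using shilov_tetrablockD(2)[of z] space_M by simp
    then show "u z * coord_mult 1 f z * cnj (g z) = u z * coord_mult 3 f z * cnj (coord_mult 2 g z)"
      by (simp add: coord_mult_def)
  qed
  show "L2_inner M (T (coord_mult 2 f)) g = L2_inner M (T (coord_mult 3 f)) (coord_mult 1 g)"
    unfolding c
  proof (rule L2_inner_cong)
    fix z assume "z \<in> space M"
    then have "cnj (cnj (z$2)) = cnj (cnj (z$3) * z$1)" using shilov_tetrablockD(3)[of z] space_M by simp
    then show "u z * coord_mult 2 f z * cnj (g z) = u z * coord_mult 3 f z * cnj (coord_mult 1 g z)"
      by (simp add: coord_mult_def)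
  qed
  show "L2_inner M (T f) g = L2_inner M (T (coord_mult 3 f)) (coord_mult 3 g)"
    unfolding c
  proof (rule L2_inner_cong)
    fix z assume "z \<in> space M"
    then have "cnj (z$3) * z$3 = 1" using shilov_tetrablockD(1)[of z] space_M by simp
    then have "u z * f z * cnj (g z) = u z * f z * (cnj (z$3) * z$3) * cnj (g z)" by simp
    then show "u z * f z * cnj (g z) = u z * coord_mult 3 f z * cnj (coord_mult 3 g z)"
      by (simp add: coord_mult_def mult_ac)
  qed
qed

text \<open>Multiplication by \<open>z\<^sub>3\<^sup>n\<close>, which clears the denominator of a fraction.\<close>

abbreviation lift :: "nat \<Rightarrow> (complex^3 \<Rightarrow> complex) \<Rightarrow> complex^3 \<Rightarrow> complex" where
  "lift n p \<equiv> (\<lambda>z. (z$3)^n * p z)"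

text \<open>The space of fractions \<open>f / z\<^sub>3\<^sup>n\<close> with \<open>f\<close> in \<open>H\<close>, and the form of \<open>T\<close> extended to it.  Under the
  third relation the sequence in the definition of \<open>\<beta>\<close> is eventually constant.\<close>

definition D where "D = {p \<in> L2 M. \<exists>n. lift n p \<in> H}"

definition \<beta> where "\<beta> p q = lim (\<lambda>n. L2_inner M (T (lift n p)) (lift n q))"

lemma lift_Suc: "lift (Suc n) p = coord_mult 3 (lift n p)"
  by (simp add: coord_mult_def mult.assoc)

lemma lift_mono: 
  assumes "lift n p \<in> H" "n \<le> m" shows "lift m p \<in> H"
  using assms(2)
proof (induction m rule: dec_induct)
  case (step m)
  then show ?case unfolding lift_Suc by (intro coord)
qed (rule assms(1))

lemma D_L2: "p \<in> D \<Longrightarrow> p \<in> L2 M" by (simp add: D_def)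

lemma D_lift2:
  assumes "p \<in> D" "q \<in> D" obtains n where "lift n p \<in> H" "lift n q \<in> H"
proof -
  obtain n m where "lift n p \<in> H" "lift m q \<in> H" using assms by (auto simp: D_def)
  then show ?thesis using that[of "max n m"] lift_mono by (meson max.cobounded1 max.cobounded2)
qed

lemma D_lift3:
  assumes "p \<in> D" "q \<in> D" "r \<in> D" obtains n where "lift n p \<in> H" "lift n q \<in> H" "lift n r \<in> H"
proof -
  obtain n where "lift n p \<in> H" "lift n q \<in> H" using D_lift2[OF assms(1,2)] .
  moreover obtain m where "lift m r \<in> H" using assms(3) by (auto simp: D_def)
  ultimately show ?thesis using that[of "max n m"] lift_mono by (meson max.cobounded1 max.cobounded2)
qed

lemma H_sub_D: "f \<in> H \<Longrightarrow> f \<in> D"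
  using HL by (auto simp: D_def intro!: exI[of _ 0])

lemma D_cong:
  assumes "p \<in> D" "q \<in> L2 M" "\<And>z. z \<in> shilov_tetrablock \<Longrightarrow> p z = q z"
  shows "q \<in> D"
proof -
  obtain n where n: "lift n p \<in> H" using assms by (auto simp: D_def)
  have "lift n q \<in> H"
    by (rule H_cong[OF n]) (auto simp: assms(3) intro!: L2_measurable L2_coord_power assms(2))
  then show ?thesis using assms(2) by (auto simp: D_def)
qed

lemma norm_lift: "L2_norm M (lift n p) = L2_norm M p"
  unfolding L2_norm_def
  by (intro arg_cong[where f=sqrt] Bochner_Integration.integral_cong refl)
     (simp add: norm_mult norm_power space_M shilov_tetrablockD(4))

lemma D_lin: assumes "p \<in> D" "q \<in> D" shows "(\<lambda>z. a * p z + b * q z) \<in> D"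
proof -
  obtain n where n: "lift n p \<in> H" "lift n q \<in> H" using D_lift2[OF assms] .
  have "lift n (\<lambda>z. a * p z + b * q z) = (\<lambda>z. a * lift n p z + b * lift n q z)"
    by (simp add: algebra_simps)
  then show ?thesis using Hlin[OF n, of a b] L2_lin[OF D_L2[OF assms(1)] D_L2[OF assms(2)], of a b]
    unfolding D_def by (auto intro!: exI[of _ n])
qed

lemma D_subspace: "L2_subspace M D"
  unfolding L2_subspace_def using D_L2 H_sub_D[OF one] D_lin by blast

lemma D_coord: assumes "p \<in> D" shows "(\<lambda>z. z$i * p z) \<in> D"
proof -
  obtain n where n: "lift n p \<in> H" using assms by (auto simp: D_def)
  have "lift n (\<lambda>z. z$i * p z) = coord_mult i (lift n p)" by (simp add: coord_mult_def mult_ac)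
  then show ?thesis using coord[OF n, of i] L2_coord[OF D_L2[OF assms], of i]
    unfolding D_def by (auto intro!: exI[of _ n])
qed

text \<open>On the boundary \<open>cnj z\<^sub>3 = 1 / z\<^sub>3\<close>: one more power of \<open>z\<^sub>3\<close> clears the denominator.\<close>

lemma D_cnj_coord3: assumes "p \<in> D" shows "(\<lambda>z. cnj (z$3) * p z) \<in> D"
proof -
  obtain n where n: "lift n p \<in> H" using assms by (auto simp: D_def)
  have L: "(\<lambda>z. cnj (z$3) * p z) \<in> L2 M" by (rule L2_coord_cnj[OF D_L2[OF assms]])
  have "lift (Suc n) (\<lambda>z. cnj (z$3) * p z) \<in> H"
  proof (rule H_cong[OF n])
    fix z assume "z \<in> shilov_tetrablock"
    then have 1: "cnj (z$3) * z$3 = 1" by (rule shilov_tetrablockD(1))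
    have "lift (Suc n) (\<lambda>z. cnj (z$3) * p z) z = (cnj (z$3) * z$3) * lift n p z" by (simp add: mult_ac)
    then show "lift n p z = lift (Suc n) (\<lambda>z. cnj (z$3) * p z) z" using 1 by simp
  qed (intro L2_measurable L2_coord_power L)
  then show ?thesis using L unfolding D_def by blast
qed

text \<open>The other two conjugates reduce to \<open>cnj z\<^sub>3\<close>, because \<open>cnj z\<^sub>1 = cnj z\<^sub>3 z\<^sub>2\<close> and
  \<open>cnj z\<^sub>2 = cnj z\<^sub>3 z\<^sub>1\<close>.\<close>

lemma D_cnj_coord: assumes "p \<in> D" shows "(\<lambda>z. cnj (z$i) * p z) \<in> D"
proof -
  have "i = 1 \<or> i = 2 \<or> i = 3" using exhaust_3 by blast
  then show ?thesis
  proof (elim disjE)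
    assume i: "i = 1"
    show ?thesis
      by (rule D_cong[OF D_cnj_coord3[OF D_coord[OF assms, of 2]] L2_coord_cnj[OF D_L2[OF assms]]])
         (simp add: i shilov_tetrablockD(2))
  next
    assume i: "i = 2"
    show ?thesis
      by (rule D_cong[OF D_cnj_coord3[OF D_coord[OF assms, of 1]] L2_coord_cnj[OF D_L2[OF assms]]])
         (simp add: i shilov_tetrablockD(3))
  qed (use D_cnj_coord3[OF assms] in simp)
qed

end

locale boundary_operator_relations = boundary_operator +
  assumes rel: relations
begin

lemma \<beta>_eq:
  assumes "lift n p \<in> H" "lift n q \<in> H"
  shows "\<beta> p q = L2_inner M (T (lift n p)) (lift n q)"
proof -
  have "L2_inner M (T (lift m p)) (lift m q) = L2_inner M (T (lift n p)) (lift n q)" if "m \<ge> n" for m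
    using that
  proof (induction m rule: dec_induct)
    case (step m)
    have "lift m p \<in> H" "lift m q \<in> H" using lift_mono assms step by blast+
    then have "L2_inner M (T (lift m p)) (lift m q) = L2_inner M (T (lift (Suc m) p)) (lift (Suc m) q)"
      unfolding lift_Suc using rel by (simp add: relations_def)
    then show ?case using step by simp
  qed simp
  then have "(\<lambda>m. L2_inner M (T (lift m p)) (lift m q)) \<longlonglongrightarrow> L2_inner M (T (lift n p)) (lift n q)"
    by (intro tendsto_eventually eventually_sequentiallyI[of n])
  then show ?thesis unfolding \<beta>_def by (rule limI)
qed

lemma \<beta>_H: "f \<in> H \<Longrightarrow> g \<in> H \<Longrightarrow> \<beta> f g = L2_inner M (T f) g"
  using \<beta>_eq[of 0 f g] by simp

lemma \<beta>_lin_left: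
  assumes "p \<in> D" "q \<in> D" "r \<in> D"
  shows "\<beta> (\<lambda>z. a * p z + b * q z) r = a * \<beta> p r + b * \<beta> q r"
proof -
  obtain n where n: "lift n p \<in> H" "lift n q \<in> H" "lift n r \<in> H" using D_lift3[OF assms] .
  have e: "lift n (\<lambda>z. a * p z + b * q z) = (\<lambda>z. a * lift n p z + b * lift n q z)"
    by (simp add: algebra_simps)
  have "lift n (\<lambda>z. a * p z + b * q z) \<in> H" unfolding e by (rule Hlin[OF n(1,2)])
  from \<beta>_eq[OF this n(3)] show ?thesis
    unfolding e inner_T_lin[OF n(1,2) HL[OF n(3)]] \<beta>_eq[OF n(1,3)] \<beta>_eq[OF n(2,3)] .
qed

lemma \<beta>_lin_right:
  assumes "p \<in> D" "q \<in> D" "r \<in> D"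
  shows "\<beta> r (\<lambda>z. a * p z + b * q z) = cnj a * \<beta> r p + cnj b * \<beta> r q"
proof -
  obtain n where n: "lift n p \<in> H" "lift n q \<in> H" "lift n r \<in> H" using D_lift3[OF assms] .
  have e: "lift n (\<lambda>z. a * p z + b * q z) = (\<lambda>z. a * lift n p z + b * lift n q z)"
    by (simp add: algebra_simps)
  have "lift n (\<lambda>z. a * p z + b * q z) \<in> H" unfolding e by (rule Hlin[OF n(1,2)])
  from \<beta>_eq[OF n(3) this] show ?thesis
    unfolding e L2_inner_lin_right[OF HL[OF n(1)] HL[OF n(2)] T_L2[OF n(3)]] \<beta>_eq[OF n(3,1)] \<beta>_eq[OF n(3,2)] .
qed

lemma \<beta>_cong:
  assumes "p \<in> D" "q \<in> D" "p' \<in> D" "q' \<in> D"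
    and "\<And>z. z \<in> shilov_tetrablock \<Longrightarrow> p z = p' z" "\<And>z. z \<in> shilov_tetrablock \<Longrightarrow> q z = q' z"
  shows "\<beta> p q = \<beta> p' q'"
proof -
  obtain n where n: "lift n p \<in> H" "lift n q \<in> H" "lift n p' \<in> H" using D_lift3[OF assms(1-3)] .
  have n': "lift n q' \<in> H"
    by (rule H_cong[OF n(2)]) (auto intro!: L2_measurable[OF L2_coord_power[OF D_L2[OF assms(4)]]] simp: assms(6))
  have "L2_inner M (T (lift n p)) (lift n q) = L2_inner M (T (lift n p)) (lift n q')"
    by (rule L2_inner_cong) (simp add: assms(6) space_M)
  also have "\<dots> = L2_inner M (T (lift n p')) (lift n q')"
    by (rule inner_T_cong[OF n(1,3) HL[OF n']]) (simp add: assms(5))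
  finally show ?thesis using \<beta>_eq n n' by simp
qed

text \<open>\<open>|z\<^sub>3| = 1\<close> on the boundary, so clearing denominators does not change norms.\<close>

lemma \<beta>_bound: 
  assumes K: "\<And>f. f \<in> H \<Longrightarrow> L2_norm M (T f) \<le> K * L2_norm M f" and "p \<in> D" "q \<in> D"
  shows "cmod (\<beta> p q) \<le> K * L2_norm M p * L2_norm M q"
proof -
  obtain n where n: "lift n p \<in> H" "lift n q \<in> H" using D_lift2[OF assms(2,3)] .
  have "cmod (\<beta> p q) \<le> L2_norm M (T (lift n p)) * L2_norm M (lift n q)"
    unfolding \<beta>_eq[OF n] by (rule L2_Cauchy_Schwarz[OF T_L2[OF n(1)] HL[OF n(2)]])
  also have "\<dots> \<le> (K * L2_norm M (lift n p)) * L2_norm M (lift n q)"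
    by (intro mult_right_mono K n) simp
  finally show ?thesis by (simp add: norm_lift)
qed

text \<open>The multipliers of the space of fractions that move across \<open>\<beta>\<close> to their conjugates.\<close>

definition \<beta>_mult where
  "\<beta>_mult a \<longleftrightarrow> (\<forall>p\<in>D. (\<lambda>z. a z * p z) \<in> D) \<and> (\<forall>p\<in>D. (\<lambda>z. cnj (a z) * p z) \<in> D) \<and>
     (\<forall>p\<in>D. \<forall>q\<in>D. \<beta> (\<lambda>z. a z * p z) q = \<beta> p (\<lambda>z. cnj (a z) * q z))"

lemma \<beta>_multD:
  assumes "\<beta>_mult a" "p \<in> D"
  shows "(\<lambda>z. a z * p z) \<in> D" "(\<lambda>z. cnj (a z) * p z) \<in> D"
    "q \<in> D \<Longrightarrow> \<beta> (\<lambda>z. a z * p z) q = \<beta> p (\<lambda>z. cnj (a z) * q z)"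
  using assms by (simp_all add: \<beta>_mult_def)

text \<open>The three operator relations, transported to fractions.\<close>

lemma \<beta>_shift:
  assumes pq: "p \<in> D" "q \<in> D"
  shows "\<beta> (\<lambda>z. z$3 * p z) (\<lambda>z. z$3 * q z) = \<beta> p q"
    and "\<beta> (\<lambda>z. z$1 * p z) q = \<beta> (\<lambda>z. z$3 * p z) (\<lambda>z. z$2 * q z)"
    and "\<beta> (\<lambda>z. z$2 * p z) q = \<beta> (\<lambda>z. z$3 * p z) (\<lambda>z. z$1 * q z)"
proof -
  obtain n where n: "lift n p \<in> H" "lift n q \<in> H" using D_lift2[OF pq] .
  have e: "lift n (\<lambda>z. z$i * p z) = coord_mult i (lift n p)" for i p by (simp add: coord_mult_def mult_ac)
  have i: "lift n (\<lambda>z. z$i * p z) \<in> H" "lift n (\<lambda>z. z$i * q z) \<in> H" for i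
    unfolding e using coord n by blast+
  show "\<beta> (\<lambda>z. z$3 * p z) (\<lambda>z. z$3 * q z) = \<beta> p q"
    unfolding \<beta>_eq[OF i] \<beta>_eq[OF n] e using rel n unfolding relations_def by simp
  show "\<beta> (\<lambda>z. z$1 * p z) q = \<beta> (\<lambda>z. z$3 * p z) (\<lambda>z. z$2 * q z)"
    unfolding \<beta>_eq[OF i] \<beta>_eq[OF i(1) n(2)] e using rel n unfolding relations_def by simp
  show "\<beta> (\<lambda>z. z$2 * p z) q = \<beta> (\<lambda>z. z$3 * p z) (\<lambda>z. z$1 * q z)"
    unfolding \<beta>_eq[OF i] \<beta>_eq[OF i(1) n(2)] e using rel n unfolding relations_def by simp
qed

lemma shift3:
  assumes pq: "p \<in> D" "q \<in> D"
  shows "\<beta> (\<lambda>z. z$3 * p z) q = \<beta> p (\<lambda>z. cnj (z$3) * q z)"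
    and "\<beta> (\<lambda>z. cnj (z$3) * p z) q = \<beta> p (\<lambda>z. z$3 * q z)"
proof -
  have r: "z$3 * (cnj (z$3) * w) = w" if "z \<in> shilov_tetrablock" for z :: "complex^3" and w
    using shilov_tetrablockD(1)[OF that] by (metis mult.assoc mult.commute mult_1)
  have "\<beta> (\<lambda>z. z$3 * p z) q = \<beta> (\<lambda>z. z$3 * p z) (\<lambda>z. z$3 * (cnj (z$3) * q z))"
    by (intro \<beta>_cong D_coord D_cnj_coord pq) (auto simp: r)
  also have "\<dots> = \<beta> p (\<lambda>z. cnj (z$3) * q z)" by (intro \<beta>_shift D_cnj_coord pq)
  finally show "\<beta> (\<lambda>z. z$3 * p z) q = \<beta> p (\<lambda>z. cnj (z$3) * q z)" .
  have "\<beta> (\<lambda>z. cnj (z$3) * p z) q = \<beta> (\<lambda>z. z$3 * (cnj (z$3) * p z)) (\<lambda>z. z$3 * q z)"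
    by (intro \<beta>_shift[symmetric] D_cnj_coord pq)
  also have "\<dots> = \<beta> p (\<lambda>z. z$3 * q z)"
    by (intro \<beta>_cong D_coord D_cnj_coord pq) (auto simp: r)
  finally show "\<beta> (\<lambda>z. cnj (z$3) * p z) q = \<beta> p (\<lambda>z. z$3 * q z)" .
qed

text \<open>For \<open>i = 1\<close>: \<open>\<beta>(z\<^sub>1 p, q) = \<beta>(z\<^sub>3 p, z\<^sub>2 q) = \<beta>(p, cnj z\<^sub>3 z\<^sub>2 q)\<close>, and \<open>cnj z\<^sub>3 z\<^sub>2 = cnj z\<^sub>1\<close>.  The
  statement for \<open>cnj z\<^sub>1 = cnj z\<^sub>3 z\<^sub>2\<close> follows by moving its two factors one at a time.\<close>

lemma shift12:
  assumes pq: "p \<in> D" "q \<in> D" and ij: "(i = 1 \<and> j = 2) \<or> (i = 2 \<and> j = (1::3))"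
  shows "\<beta> (\<lambda>z. z$i * p z) q = \<beta> p (\<lambda>z. cnj (z$i) * q z)"
    and "\<beta> (\<lambda>z. cnj (z$i) * p z) q = \<beta> p (\<lambda>z. z$i * q z)"
proof -
  have c: "cnj (z$i) = cnj (z$3) * z$j" "cnj (z$j) = cnj (z$3) * z$i" if "z \<in> shilov_tetrablock" for z
    using shilov_tetrablockD(2,3)[OF that] ij by auto
  have s: "\<beta> (\<lambda>z. z$i * p z) q = \<beta> p (\<lambda>z. cnj (z$i) * q z)"
    if pq: "p \<in> D" "q \<in> D" and c: "\<And>z. z \<in> shilov_tetrablock \<Longrightarrow> cnj (z$i) = cnj (z$3) * z$j"
      and sh: "\<beta> (\<lambda>z. z$i * p z) q = \<beta> (\<lambda>z. z$3 * p z) (\<lambda>z. z$j * q z)" for p q i j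
  proof -
    have "\<beta> (\<lambda>z. z$i * p z) q = \<beta> p (\<lambda>z. cnj (z$3) * (z$j * q z))"
      unfolding sh by (intro shift3 D_coord pq)
    also have "\<dots> = \<beta> p (\<lambda>z. cnj (z$i) * q z)"
      by (intro \<beta>_cong D_cnj_coord D_coord pq) (auto simp: c)
    finally show ?thesis .
  qed
  show "\<beta> (\<lambda>z. z$i * p z) q = \<beta> p (\<lambda>z. cnj (z$i) * q z)"
    using ij c by (intro s[OF pq, of i j]) (auto simp: \<beta>_shift[OF pq])
  have sj: "\<beta> (\<lambda>z. z$j * p z) q = \<beta> p (\<lambda>z. cnj (z$j) * q z)" if "q \<in> D" for q
    using ij c by (intro s[OF pq(1) that, of j i]) (auto simp: \<beta>_shift[OF pq(1) that])
  have "\<beta> (\<lambda>z. cnj (z$i) * p z) q = \<beta> (\<lambda>z. cnj (z$3) * (z$j * p z)) q"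
    by (intro \<beta>_cong D_cnj_coord D_coord pq) (auto simp: c)
  also have "\<dots> = \<beta> (\<lambda>z. z$j * p z) (\<lambda>z. z$3 * q z)" by (intro shift3 D_coord pq)
  also have "\<dots> = \<beta> p (\<lambda>z. cnj (z$j) * (z$3 * q z))" by (intro sj D_coord pq)
  also have "\<dots> = \<beta> p (\<lambda>z. z$i * q z)"
  proof (intro \<beta>_cong D_cnj_coord D_coord pq)
    fix z assume z: "z \<in> shilov_tetrablock"
    have "cnj (z$j) * (z$3 * q z) = (cnj (z$3) * z$3) * (z$i * q z)" unfolding c(2)[OF z] by (simp only: mult_ac)
    then show "cnj (z$j) * (z$3 * q z) = z$i * q z" using shilov_tetrablockD(1)[OF z] by simp
  qed simp
  finally show "\<beta> (\<lambda>z. cnj (z$i) * p z) q = \<beta> p (\<lambda>z. z$i * q z)" .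
qed

lemma \<beta>_mult_coord: "\<beta>_mult (\<lambda>z. z$i)" "\<beta>_mult (\<lambda>z. cnj (z$i))"
proof -
  have "i = 1 \<or> i = 2 \<or> i = 3" using exhaust_3 by blast
  then have *: "\<beta> (\<lambda>z. z$i * p z) q = \<beta> p (\<lambda>z. cnj (z$i) * q z)"
    "\<beta> (\<lambda>z. cnj (z$i) * p z) q = \<beta> p (\<lambda>z. z$i * q z)" if "p \<in> D" "q \<in> D" for p q
    using shift12[OF that, of i] shift3[OF that] by auto
  show "\<beta>_mult (\<lambda>z. z$i)" "\<beta>_mult (\<lambda>z. cnj (z$i))"
    unfolding \<beta>_mult_def using * D_coord D_cnj_coord by auto
qed

lemma \<beta>_mult_const: "\<beta>_mult (\<lambda>z. c)"
proof -
  have D1: "(\<lambda>z. c * p z) \<in> D" if "p \<in> D" for p c using D_lin[OF that that, of c 0] by simp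
  have "\<beta> (\<lambda>z. c * p z) q = \<beta> p (\<lambda>z. cnj c * q z)" if "p \<in> D" "q \<in> D" for p q
    using \<beta>_lin_left[OF that(1) that(1,2), of c 0] \<beta>_lin_right[OF that(2) that(2,1), of "cnj c" 0] by simp
  then show ?thesis unfolding \<beta>_mult_def using D1 by auto
qed

lemma \<beta>_mult_add:
  assumes "\<beta>_mult a" "\<beta>_mult b" shows "\<beta>_mult (\<lambda>z. a z + b z)"
proof -
  note ab = assms[unfolded \<beta>_mult_def]
  have A: "(\<lambda>z. a z * p z) \<in> D" "(\<lambda>z. b z * p z) \<in> D" "(\<lambda>z. cnj (a z) * p z) \<in> D" "(\<lambda>z. cnj (b z) * p z) \<in> D"
    if "p \<in> D" for p using ab that by auto
  have e: "(\<lambda>z. (a z + b z) * p z) = (\<lambda>z. 1 * (a z * p z) + 1 * (b z * p z))" 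
    "(\<lambda>z. cnj (a z + b z) * p z) = (\<lambda>z. 1 * (cnj (a z) * p z) + 1 * (cnj (b z) * p z))" for p
    by (auto simp: algebra_simps)
  show ?thesis unfolding \<beta>_mult_def e
  proof (intro conjI ballI)
    fix p assume p: "p \<in> D"
    show "(\<lambda>z. 1 * (a z * p z) + 1 * (b z * p z)) \<in> D" by (intro D_lin A p)
    show "(\<lambda>z. 1 * (cnj (a z) * p z) + 1 * (cnj (b z) * p z)) \<in> D" by (intro D_lin A p)
    fix q assume q: "q \<in> D"
    show "\<beta> (\<lambda>z. 1 * (a z * p z) + 1 * (b z * p z)) q = \<beta> p (\<lambda>z. 1 * (cnj (a z) * q z) + 1 * (cnj (b z) * q z))"
      unfolding \<beta>_lin_left[OF A(1)[OF p] A(2)[OF p] q] \<beta>_lin_right[OF A(3)[OF q] A(4)[OF q] p]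
      using ab p q by simp
  qed
qed

lemma \<beta>_mult_mult:
  assumes "\<beta>_mult a" "\<beta>_mult b" shows "\<beta>_mult (\<lambda>z. a z * b z)"
proof -
  note ab = assms[unfolded \<beta>_mult_def]
  have A: "(\<lambda>z. a z * p z) \<in> D" "(\<lambda>z. b z * p z) \<in> D" "(\<lambda>z. cnj (a z) * p z) \<in> D" "(\<lambda>z. cnj (b z) * p z) \<in> D"
    if "p \<in> D" for p using ab that by auto
  have e: "(\<lambda>z. a z * b z * p z) = (\<lambda>z. a z * (b z * p z))" 
    "(\<lambda>z. cnj (a z * b z) * p z) = (\<lambda>z. cnj (b z) * (cnj (a z) * p z))" for p
    by (auto simp: algebra_simps)
  show ?thesis unfolding \<beta>_mult_def e
  proof (intro conjI ballI)
    fix p assume p: "p \<in> D"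
    show "(\<lambda>z. a z * (b z * p z)) \<in> D" by (intro A p)
    show "(\<lambda>z. cnj (b z) * (cnj (a z) * p z)) \<in> D" by (intro A p)
    fix q assume q: "q \<in> D"
    have "\<beta> (\<lambda>z. a z * (b z * p z)) q = \<beta> (\<lambda>z. b z * p z) (\<lambda>z. cnj (a z) * q z)"
      by (rule \<beta>_multD(3)[OF assms(1) A(2)[OF p] q])
    also have "\<dots> = \<beta> p (\<lambda>z. cnj (b z) * (cnj (a z) * q z))"
      by (rule \<beta>_multD(3)[OF assms(2) p A(3)[OF q]])
    finally show "\<beta> (\<lambda>z. a z * (b z * p z)) q = \<beta> p (\<lambda>z. cnj (b z) * (cnj (a z) * q z))" .
  qed
qed

text \<open>The multipliers form an algebra, and they contain the real and imaginary parts of the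
  coordinates, hence all real-linear functions.\<close>

lemma \<beta>_mult_real_poly:
  assumes "real_polynomial_function p" shows "\<beta>_mult (\<lambda>z. of_real (p z))"
  using assms
proof (induction rule: real_polynomial_function.induct)
  case (linear f)
  have r: "\<beta>_mult (\<lambda>z. of_real (Re (z$i)))" for i
  proof -
    have "(\<lambda>z::complex^3. complex_of_real (Re (z$i))) = (\<lambda>z. (1/2) * (z$i + cnj (z$i)))"
      by (auto simp: complex_eq_iff)
    then show ?thesis by (simp only:) (intro \<beta>_mult_mult \<beta>_mult_const \<beta>_mult_add \<beta>_mult_coord)
  qed
  have m: "\<beta>_mult (\<lambda>z. of_real (Im (z$i)))" for i
  proof -
    have "(\<lambda>z::complex^3. complex_of_real (Im (z$i))) = (\<lambda>z. (-\<i>/2) * z$i + (\<i>/2) * cnj (z$i))"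
      by (auto simp: complex_eq_iff)
    then show ?thesis by (simp only:) (intro \<beta>_mult_mult \<beta>_mult_const \<beta>_mult_add \<beta>_mult_coord)
  qed
  have z: "z = (\<Sum>i\<in>UNIV. Re (z$i) *\<^sub>R axis i 1 + Im (z$i) *\<^sub>R axis i \<i>)" for z :: "complex^3"
  proof (rule vec_eq_iff[THEN iffD2], rule allI)
    fix j
    have "(\<Sum>i\<in>UNIV. Re (z$i) *\<^sub>R axis i 1 + Im (z$i) *\<^sub>R axis i \<i>) $ j = (\<Sum>i\<in>UNIV. if i = j then z$j else 0)"
      unfolding sum_component by (rule sum.cong) (auto simp: axis_def complex_eq_iff)
    then show "z $ j = (\<Sum>i\<in>UNIV. Re (z$i) *\<^sub>R axis i 1 + Im (z$i) *\<^sub>R axis i \<i>) $ j" by simp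
  qed
  interpret f: bounded_linear f by (rule linear)
  have fz: "f z = (\<Sum>i\<in>UNIV. Re (z$i) * f (axis i 1) + Im (z$i) * f (axis i \<i>))" for z
    by (subst (1) z) (simp add: f.sum f.add f.scaleR)
  have "(\<lambda>z. complex_of_real (f z)) = (\<lambda>z. 
     ((of_real (Re (z$1)) * of_real (f (axis 1 1)) + of_real (Im (z$1)) * of_real (f (axis 1 \<i>))) +
     (of_real (Re (z$2)) * of_real (f (axis 2 1)) + of_real (Im (z$2)) * of_real (f (axis 2 \<i>)))) +
     (of_real (Re (z$3)) * of_real (f (axis 3 1)) + of_real (Im (z$3)) * of_real (f (axis 3 \<i>))))"
    by (rule ext, subst fz) (simp only: sum_3 of_real_add of_real_mult)
  then show ?case by (simp only:) (intro \<beta>_mult_add \<beta>_mult_mult \<beta>_mult_const r m)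
qed (auto simp: \<beta>_mult_const intro: \<beta>_mult_add \<beta>_mult_mult)

lemma \<beta>_mult_poly: "a \<in> complex_polys \<Longrightarrow> \<beta>_mult a"
  unfolding complex_polys_def
  by (auto intro!: \<beta>_mult_add \<beta>_mult_mult \<beta>_mult_real_poly \<beta>_mult_const)

lemma poly_D: assumes "a \<in> complex_polys" shows "a \<in> D"
proof -
  have "(\<lambda>z. a z * (\<lambda>_. 1) z) \<in> D" by (rule \<beta>_multD(1)[OF \<beta>_mult_poly[OF assms] H_sub_D[OF one]])
  then show ?thesis by simp
qed

end

context boundary_operator_relations
begin

lemma poly_L2: "a \<in> complex_polys \<Longrightarrow> a \<in> L2 M"
  using poly_D D_L2 by blast

lemma poly_bounded: 
  assumes "a \<in> complex_polys" obtains B where "AE z in M. cmod (a z) \<le> B"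
proof -
  obtain B where "\<And>x. x \<in> shilov_tetrablock \<Longrightarrow> cmod (a x) \<le> B"
    using compact_imp_bounded[OF compact_continuous_image[OF complex_polys_continuous[OF assms] compact_shilov_tetrablock]]
    unfolding bounded_iff by blast
  then show ?thesis using that by (metis AE_I2 space_M)
qed

lemma dense: 
  assumes "f \<in> L2 M"
  obtains v where "\<And>n::nat. v n \<in> complex_polys" "(\<lambda>n. L2_norm M (\<lambda>x. v n x - f x)) \<longlonglongrightarrow> 0"
  using polys_dense[OF compact_shilov_tetrablock fin sets_M] assms unfolding L2_dense_def by blast

text \<open>\<open>\<beta>(p, a) = \<beta>(cnj a p, 1)\<close> for polynomials \<open>a\<close>, and \<open>\<beta>(_, 1)\<close> has a Riesz representative.\<close>

lemma symbol_exists: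
  obtains u where "u \<in> L2 M" 
    "\<And>p a. p \<in> D \<Longrightarrow> a \<in> complex_polys \<Longrightarrow> \<beta> p a = L2_inner M p (\<lambda>z. cnj (u z) * a z)"
proof -
  obtain K where K: "K \<ge> 0" "\<And>f. f \<in> H \<Longrightarrow> L2_norm M (T f) \<le> K * L2_norm M f" using T_bound by blast
  have D1: "(\<lambda>_. 1) \<in> D" by (rule H_sub_D[OF one])
  obtain u0 where u0: "u0 \<in> L2 M" "\<And>p. p \<in> D \<Longrightarrow> \<beta> p (\<lambda>_. 1) = L2_inner M p u0"
  proof (rule L2_Riesz[OF fin D_subspace, of "\<lambda>p. \<beta> p (\<lambda>_. 1)" "K * L2_norm M (\<lambda>_. 1)"])
    show "cmod (\<beta> f (\<lambda>_. 1)) \<le> K * L2_norm M (\<lambda>_. 1) * L2_norm M f" if "f \<in> D" for f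
      using \<beta>_bound[OF K(2) that D1] by (simp add: mult_ac)
  qed (auto intro: \<beta>_lin_left D1 that)
  define u where "u = (\<lambda>z. cnj (u0 z))"
  have u: "u \<in> L2 M" using u0(1) L2_measurable[OF u0(1)] by (simp add: u_def L2_def)
  have "\<beta> p a = L2_inner M p (\<lambda>z. cnj (u z) * a z)" if p: "p \<in> D" and a: "a \<in> complex_polys" for p a
  proof -
    note m = \<beta>_multD[OF \<beta>_mult_poly[OF complex_polys_cnj[OF a]]]
    have "\<beta> p a = \<beta> (\<lambda>z. cnj (a z) * p z) (\<lambda>_. 1)" using m(3)[OF p D1] by simp
    also have "\<dots> = L2_inner M (\<lambda>z. cnj (a z) * p z) u0" by (rule u0(2)[OF m(1)[OF p]])
    also have "\<dots> = L2_inner M p (\<lambda>z. cnj (u z) * a z)" by (rule L2_inner_cong) (simp add: u_def mult_ac)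
    finally show ?thesis .
  qed
  then show ?thesis using that u by blast
qed

text \<open>By density in the first argument \<open>\<parallel>cnj u b\<parallel> \<le> K \<parallel>b\<parallel>\<close> for polynomials \<open>b\<close>.  Approximating the
  indicator of \<open>{K < |u| \<le> N}\<close> by polynomials \<open>b\<close> shows that this set is null.\<close>

lemma L2_mult_norm_bound:
  assumes u: "u \<in> L2 M" and K: "K \<ge> 0"
    and b: "\<And>a b. a \<in> complex_polys \<Longrightarrow> b \<in> complex_polys \<Longrightarrow>
      cmod (L2_inner M a (\<lambda>z. cnj (u z) * b z)) \<le> K * L2_norm M a * L2_norm M b"
  shows "AE z in M. cmod (u z) \<le> K"
proof -
  note [measurable] = L2_measurable[OF u]
  have ub: "(\<lambda>z. cnj (u z) * b z) \<in> L2 M" if bp: "b \<in> complex_polys" for b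
  proof -
    obtain B where "AE z in M. cmod (b z) \<le> B" using poly_bounded[OF bp] .
    from L2_bounded_mult[OF u L2_measurable[OF poly_L2[OF bp]] this]
    have "(\<lambda>z. b z * u z) \<in> L2 M" .
    moreover have "(\<lambda>z. cnj (u z) * b z) \<in> borel_measurable M" 
      using L2_measurable[OF poly_L2[OF bp]] by measurable
    ultimately show ?thesis by (simp add: L2_def norm_mult mult.commute)
  qed
  have bound: "L2_norm M (\<lambda>z. cnj (u z) * b z) \<le> K * L2_norm M b" if bp: "b \<in> complex_polys" for b
  proof -
    let ?f = "\<lambda>z. cnj (u z) * b z"
    obtain v where v: "\<And>n::nat. v n \<in> complex_polys" "(\<lambda>n. L2_norm M (\<lambda>x. v n x - ?f x)) \<longlonglongrightarrow> 0"
      using dense[OF ub[OF bp]] by blast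
    have "cmod (L2_inner M ?f ?f) \<le> K * L2_norm M ?f * L2_norm M b"
    proof (rule tendsto_le[OF trivial_limit_sequentially])
      show "(\<lambda>n. K * L2_norm M (v n) * L2_norm M b) \<longlonglongrightarrow> K * L2_norm M ?f * L2_norm M b"
        by (intro tendsto_intros L2_norm_tendsto v(2) ub bp poly_L2 v(1))
      show "(\<lambda>n. cmod (L2_inner M (v n) ?f)) \<longlonglongrightarrow> cmod (L2_inner M ?f ?f)"
        by (intro tendsto_norm L2_inner_tendsto(1) v(2) ub bp poly_L2 v(1))
    qed (simp add: b[OF v(1) bp])
    then have *: "L2_norm M ?f * L2_norm M ?f \<le> (K * L2_norm M b) * L2_norm M ?f"
      by (simp add: L2_inner_self norm_power norm_mult power2_eq_square mult_ac)
    show ?thesis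
    proof (cases "L2_norm M ?f = 0")
      case False
      then have "L2_norm M ?f > 0" using L2_norm_nonneg[of M ?f] by linarith
      then show ?thesis using * mult_le_cancel_right_pos by blast
    qed (use K in simp)
  qed
  have ae: "AE z in M. \<not> (K < cmod (u z) \<and> cmod (u z) \<le> real N)" for N :: nat
  proof -
    define B where "B = {z \<in> space M. K < cmod (u z) \<and> cmod (u z) \<le> real N}"
    have B[measurable]: "B \<in> sets M" unfolding B_def by measurable
    \<comment> \<open>Truncation of \<open>cnj u\<close>: multiplication by a bounded function is continuous on \<open>L\<^sup>2\<close>, so the
    inequality passes to the limit.\<close>
    define w where "w = (\<lambda>z. if cmod (u z) \<le> real N then cnj (u z) else 0)"
    have wm[measurable]: "w \<in> borel_measurable M" unfolding w_def by measurable
    have wN: "AE z in M. cmod (w z) \<le> real N" by (rule AE_I2) (simp add: w_def)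
    have wL: "(\<lambda>z. w z * f z) \<in> L2 M" if "f \<in> L2 M" for f by (rule L2_bounded_mult[OF that wm wN])
    note w_small = L2_norm_bounded_mult[OF _ wm wN of_nat_0_le_iff]
    define i where "i = (\<lambda>z. indicator B z :: complex)"
    have i: "i \<in> L2 M" unfolding i_def
      by (rule L2_bounded[OF fin, of _ 1]) (auto intro!: AE_I2 simp: indicator_def)
    obtain v where v: "\<And>n::nat. v n \<in> complex_polys" "(\<lambda>n. L2_norm M (\<lambda>x. v n x - i x)) \<longlonglongrightarrow> 0"
      using dense[OF i] by blast
    have "L2_norm M (\<lambda>z. w z * i z) \<le> K * L2_norm M i"
    proof (rule tendsto_le[OF trivial_limit_sequentially])
      show "(\<lambda>n. K * L2_norm M (v n)) \<longlonglongrightarrow> K * L2_norm M i"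
        by (intro tendsto_intros L2_norm_tendsto v(2) i poly_L2 v(1))
      show "(\<lambda>n. L2_norm M (\<lambda>z. w z * v n z)) \<longlonglongrightarrow> L2_norm M (\<lambda>z. w z * i z)"
      proof (rule L2_norm_tendsto[OF wL[OF poly_L2[OF v(1)]] wL[OF i]])
        show "(\<lambda>n. L2_norm M (\<lambda>x. w x * v n x - w x * i x)) \<longlonglongrightarrow> 0"
        proof (rule tendsto_0_le[OF v(2), of _ "real N"], rule always_eventually, rule allI)
          fix n
          show "norm (L2_norm M (\<lambda>x. w x * v n x - w x * i x)) \<le> norm (L2_norm M (\<lambda>x. v n x - i x)) * real N"
            using w_small[OF L2_diff[OF poly_L2[OF v(1)] i]] by (simp add: right_diff_distrib mult.commute)
        qed
      qed
      have "L2_norm M (\<lambda>z. w z * v n z) \<le> L2_norm M (\<lambda>z. cnj (u z) * v n z)" for n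
        unfolding L2_norm_def
        by (intro real_sqrt_le_mono integral_mono L2_integrable wL ub poly_L2 v(1))
           (auto simp: norm_mult power_mult_distrib w_def)
      then show "\<forall>\<^sub>F n in sequentially. L2_norm M (\<lambda>z. w z * v n z) \<le> K * L2_norm M (v n)"
        using bound[OF v(1)] order_trans by (intro always_eventually) blast
    qed
    then have "(L2_norm M (\<lambda>z. w z * i z))^2 \<le> (K * L2_norm M i)^2" by (rule power_mono) simp
    then have le: "(\<integral>z. (cmod (w z * i z))^2 \<partial>M) - (\<integral>z. K^2 * (cmod (i z))^2 \<partial>M) \<le> 0"
      by (simp add: L2_norm_sq power_mult_distrib)
    have int1: "integrable M (\<lambda>z. (cmod (w z * i z))^2)" and int2: "integrable M (\<lambda>z. K^2 * (cmod (i z))^2)"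
      using L2_integrable[OF wL[OF i]] L2_integrable[OF i] by simp_all
    let ?d = "\<lambda>z. (cmod (w z * i z))^2 - K^2 * (cmod (i z))^2"
    have pos: "?d z \<ge> 0" "z \<in> B \<Longrightarrow> ?d z > 0" for z
    proof -
      show "z \<in> B \<Longrightarrow> ?d z > 0"
        using power_strict_mono[of K "cmod (u z)" 2] K by (simp add: w_def i_def B_def norm_mult)
      then show "?d z \<ge> 0" by (cases "z \<in> B") (auto simp: i_def)
    qed
    have "(\<integral>z. ?d z \<partial>M) \<le> 0" using le int1 int2 by simp
    moreover have "(\<integral>z. ?d z \<partial>M) \<ge> 0" using pos by simp
    ultimately have "(\<integral>z. ?d z \<partial>M) = 0" by simp
    moreover have "integrable M ?d" by (intro Bochner_Integration.integrable_diff int1 int2)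
    ultimately have "AE z in M. ?d z = 0" using pos by (subst (asm) integral_nonneg_eq_0_iff_AE) auto
    then have "AE z in M. z \<notin> B" by eventually_elim (use pos in force)
    then show ?thesis using AE_space by eventually_elim (auto simp: B_def)
  qed
  have "AE z in M. \<forall>N::nat. \<not> (K < cmod (u z) \<and> cmod (u z) \<le> real N)"
    unfolding AE_all_countable using ae by blast
  then show ?thesis
    by eventually_elim (use real_arch_simple in \<open>meson not_le\<close>)
qed

text \<open>Both \<open>\<beta>(f, g)\<close> and \<open>\<langle>u f, g\<rangle>\<close> are continuous in \<open>g\<close>, now that \<open>u\<close> is bounded, and they agree
  for polynomials \<open>g\<close>.\<close>

lemma relations_imp_toeplitz:
  obtains u where "u \<in> Linf M" "\<And>f g. f \<in> H \<Longrightarrow> g \<in> H \<Longrightarrow> L2_inner M (T f) g = L2_inner M (\<lambda>z. u z * f z) g"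
proof -
  obtain K where K: "K \<ge> 0" "\<And>f. f \<in> H \<Longrightarrow> L2_norm M (T f) \<le> K * L2_norm M f" using T_bound by blast
  obtain u where u: "u \<in> L2 M" 
    "\<And>p a. p \<in> D \<Longrightarrow> a \<in> complex_polys \<Longrightarrow> \<beta> p a = L2_inner M p (\<lambda>z. cnj (u z) * a z)"
    using symbol_exists by blast
  note [measurable] = L2_measurable[OF u(1)]
  have uK: "AE z in M. cmod (u z) \<le> K"
  proof (rule L2_mult_norm_bound[OF u(1) K(1)])
    fix a b :: "complex^3 \<Rightarrow> complex" assume ab: "a \<in> complex_polys" "b \<in> complex_polys"
    show "cmod (L2_inner M a (\<lambda>z. cnj (u z) * b z)) \<le> K * L2_norm M a * L2_norm M b"
      using \<beta>_bound[OF K(2) poly_D[OF ab(1)] poly_D[OF ab(2)]] u(2)[OF poly_D[OF ab(1)] ab(2)] by simp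
  qed
  have Linf: "u \<in> Linf M" using uK by (auto simp: Linf_def)
  have ug: "(\<lambda>z. cnj (u z) * g z) \<in> L2 M" if "g \<in> L2 M" for g
    by (rule L2_bounded_mult[OF that]) (use uK in auto)
  have "L2_inner M (T f) g = L2_inner M (\<lambda>z. u z * f z) g" if fg: "f \<in> H" "g \<in> H" for f g
  proof -
    note fD = H_sub_D[OF fg(1)] and gD = H_sub_D[OF fg(2)]
    obtain v where v: "\<And>n::nat. v n \<in> complex_polys" "(\<lambda>n. L2_norm M (\<lambda>x. v n x - g x)) \<longlonglongrightarrow> 0"
      using dense[OF HL[OF fg(2)]] by blast
    have "(\<lambda>n. \<beta> f (v n)) \<longlonglongrightarrow> \<beta> f g"
    proof (rule LIM_zero_cancel, rule tendsto_0_le[OF v(2), of _ "K * L2_norm M f"], rule always_eventually, rule allI)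
      fix n
      have "(\<lambda>x. v n x - g x) \<in> D" using L2_subspaceD(3)[OF D_subspace poly_D[OF v(1)] gD] .
      moreover have "\<beta> f (v n) - \<beta> f g = \<beta> f (\<lambda>x. v n x - g x)"
        using \<beta>_lin_right[OF poly_D[OF v(1)] gD fD, of 1 n "-1"] by simp
      ultimately show "norm (\<beta> f (v n) - \<beta> f g) \<le> norm (L2_norm M (\<lambda>x. v n x - g x)) * (K * L2_norm M f)"
        using \<beta>_bound[OF K(2) fD, of "\<lambda>x. v n x - g x"] by (simp add: mult_ac)
    qed
    moreover have "(\<lambda>n. \<beta> f (v n)) \<longlonglongrightarrow> L2_inner M f (\<lambda>z. cnj (u z) * g z)"
      unfolding u(2)[OF fD v(1)]
    proof (rule L2_inner_tendsto(2)[OF ug[OF poly_L2[OF v(1)]] ug[OF HL[OF fg(2)]] HL[OF fg(1)]])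
      show "(\<lambda>n. L2_norm M (\<lambda>x. cnj (u x) * v n x - cnj (u x) * g x)) \<longlonglongrightarrow> 0"
      proof (rule tendsto_0_le[OF v(2), of _ K], rule always_eventually, rule allI)
        fix n
        have d: "(\<lambda>x. v n x - g x) \<in> L2 M" by (intro L2_diff poly_L2 v(1) HL fg(2))
        have "L2_norm M (\<lambda>x. cnj (u x) * (v n x - g x)) \<le> K * L2_norm M (\<lambda>x. v n x - g x)"
          by (rule L2_norm_bounded_mult[OF d _ _ K(1)]) (use uK in auto)
        then show "norm (L2_norm M (\<lambda>x. cnj (u x) * v n x - cnj (u x) * g x)) \<le> norm (L2_norm M (\<lambda>x. v n x - g x)) * K"
          by (simp add: right_diff_distrib mult.commute)
      qed
    qed
    ultimately have "\<beta> f g = L2_inner M f (\<lambda>z. cnj (u z) * g z)" by (rule LIMSEQ_unique)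
    also have "\<dots> = L2_inner M (\<lambda>z. u z * f z) g" by (rule L2_inner_cong) (simp add: mult_ac)
    finally show ?thesis by (simp add: \<beta>_H[OF fg])
  qed
  then show ?thesis using that Linf by blast
qed

end

lemma (in boundary_operator) brown_halmos:
  "(\<exists>u\<in>Linf M. operator_eq_on M H T (toeplitz M H u)) \<longleftrightarrow>
     operator_eq_on M H (T \<circ> coord_mult 1) (adjoint_on M H (coord_mult 2) \<circ> T \<circ> coord_mult 3) \<and>
     operator_eq_on M H (T \<circ> coord_mult 2) (adjoint_on M H (coord_mult 1) \<circ> T \<circ> coord_mult 3) \<and>
     operator_eq_on M H (adjoint_on M H (coord_mult 3) \<circ> T \<circ> coord_mult 3) T" (is "?L \<longleftrightarrow> ?R")
proof -
  have R: "?R \<longleftrightarrow> relations"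
    unfolding relations_iff_inner relations_def by blast
  have "?L \<longleftrightarrow> relations"
  proof
    assume ?L
    then show relations using toeplitz_iff_inner toeplitz_imp_relations by blast
  next
    assume relations
    then interpret boundary_operator_relations M H T by unfold_locales
    show ?L using relations_imp_toeplitz toeplitz_iff_inner by metis
  qed
  with R show ?thesis by blast
qed

section \<open>The Cartan domain of type II, its Shilov boundary and its linear automorphisms\<close>

lemma bounded_linear_axis: "bounded_linear (axis i :: complex \<Rightarrow> complex^'n)"
  unfolding linear_conv_bounded_linear[symmetric]
  by (rule linearI) (auto simp: vec_eq_iff axis_def)

lemma vec_sum_axis: "(\<Sum>i\<in>UNIV. axis i (v $ i)) = (v :: complex^'n)"
proof (rule vec_eq_iff[THEN iffD2], rule allI)
  fix j
  have "(\<Sum>i\<in>UNIV. axis i (v $ i)) $ j = (\<Sum>i\<in>UNIV. if i = j then v $ j else 0)"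
    unfolding sum_component by (rule sum.cong) (auto simp: axis_def)
  then show "(\<Sum>i\<in>UNIV. axis i (v $ i)) $ j = v $ j" by simp
qed

lemma has_derivative_vec_components:
  fixes f :: "'a::real_normed_vector \<Rightarrow> complex^'n"
  assumes "\<And>i. ((\<lambda>x. f x $ i) has_derivative (\<lambda>h. f' h $ i)) F"
  shows "(f has_derivative f') F"
proof -
  have "((\<lambda>x. \<Sum>i\<in>UNIV. axis i (f x $ i)) has_derivative (\<lambda>h. \<Sum>i\<in>UNIV. axis i (f' h $ i))) F"
    by (intro has_derivative_sum bounded_linear.has_derivative[OF bounded_linear_axis] assms)
  then show ?thesis by (simp only: vec_sum_axis)
qed

lemma continuous_on_vec_components:
  fixes f :: "'a::topological_space \<Rightarrow> complex^'n"
  assumes "\<And>i. continuous_on S (\<lambda>x. f x $ i)"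
  shows "continuous_on S f"
  using continuous_on_vec_lambda[of S "\<lambda>i x. f x $ i"] assms by simp

lemma scaleR_complex_nth: "(r *\<^sub>R z) $ i = of_real r * (z :: complex^'n) $ i"
  unfolding vector_scaleR_component by (rule scaleR_conv_of_real)

lemma tetra_map_nth [simp]:
  "tetra_map z $ 1 = z$1" "tetra_map z $ 2 = z$2" "tetra_map z $ 3 = z$1 * z$2 - (z$3)^2"
  by (simp_all add: tetra_map_def)

lemma tetra_map_has_derivative:
  "(tetra_map has_derivative (\<lambda>h. vector [h$1, h$2, h$1 * z$2 + z$1 * h$2 - 2 * z$3 * h$3])) (at z)"
proof (rule has_derivative_vec_components)
  fix i :: 3
  have nth: "((\<lambda>z. z $ j) has_derivative (\<lambda>h. h $ j)) (at z)" for j :: 3 and z :: "complex^3"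
    by (rule bounded_linear_imp_has_derivative[OF bounded_linear_vec_nth])
  have "i = 1 \<or> i = 2 \<or> i = 3" using exhaust_3 by blast
  then show "((\<lambda>z. tetra_map z $ i) has_derivative
      (\<lambda>h. vector [h$1, h$2, h$1 * z$2 + z$1 * h$2 - 2 * z$3 * h$3] $ i)) (at z)"
  proof (elim disjE)
    assume "i = 3"
    then show ?thesis
      by (auto intro!: derivative_eq_intros nth simp: power2_eq_square algebra_simps)
  qed (use nth in auto)
qed

lemma continuous_on_tetra_map: "continuous_on S tetra_map"
  using has_derivative_continuous[OF tetra_map_has_derivative] continuous_at_imp_continuous_on by blast

lemma tetra_jac_eq: "tetra_jac z = - 2 * z$3"
proof -
  have "frechet_derivative tetra_map (at z) = (\<lambda>h. vector [h$1, h$2, h$1 * z$2 + z$1 * h$2 - 2 * z$3 * h$3])"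
    using frechet_derivative_at[OF tetra_map_has_derivative] by simp
  then show ?thesis
    by (simp add: tetra_jac_def det_3 matrix_def axis_def)
qed

text \<open>The symmetric matrix of \<open>z\<close> has operator norm at most \<open>|q|\<close>, in coordinates.  An explicit bound
  \<open>q\<close> is easier to transport along the automorphisms than the norm itself.\<close>

definition contr :: "real \<Rightarrow> complex^3 \<Rightarrow> bool" where
  "contr q z \<longleftrightarrow> (\<forall>x y. (cmod (z$1 * x + z$3 * y))^2 + (cmod (z$3 * x + z$2 * y))^2
     \<le> q^2 * ((cmod x)^2 + (cmod y)^2))"

lemma contrD: "contr q z \<Longrightarrow> (cmod (z$1 * x + z$3 * y))^2 + (cmod (z$3 * x + z$2 * y))^2
     \<le> q^2 * ((cmod x)^2 + (cmod y)^2)"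
  by (simp add: contr_def)

lemma contr_scaleR: "contr q z \<Longrightarrow> contr (r * q) (r *\<^sub>R z)"
  unfolding contr_def
proof (intro allI)
  fix x y assume *: "\<forall>x y. (cmod (z$1 * x + z$3 * y))^2 + (cmod (z$3 * x + z$2 * y))^2 \<le> q^2 * ((cmod x)^2 + (cmod y)^2)"
  have e: "(r *\<^sub>R z)$i * x + (r *\<^sub>R z)$j * y = of_real r * (z$i * x + z$j * y)" for i j
    unfolding scaleR_complex_nth by (simp add: algebra_simps)
  have "r^2 * ((cmod (z$1 * x + z$3 * y))^2 + (cmod (z$3 * x + z$2 * y))^2) \<le> r^2 * (q^2 * ((cmod x)^2 + (cmod y)^2))"
    using * by (intro mult_left_mono) auto
  then show "(cmod ((r *\<^sub>R z)$1 * x + (r *\<^sub>R z)$3 * y))^2 + (cmod ((r *\<^sub>R z)$3 * x + (r *\<^sub>R z)$2 * y))^2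
     \<le> (r * q)^2 * ((cmod x)^2 + (cmod y)^2)"
    unfolding e norm_mult power_mult_distrib norm_of_real power2_abs by (simp add: distrib_left mult.assoc)
qed

lemma norm_complex2: "(norm (v :: complex^2))^2 = (cmod (v$1))^2 + (cmod (v$2))^2"
  by (simp add: norm_vec_def L2_set_def sum_2)

lemma sym_mat_mult: "(sym_mat z *v v)$1 = z$1 * v$1 + z$3 * v$2" "(sym_mat z *v v)$2 = z$3 * v$1 + z$2 * v$2"
  by (simp_all add: sym_mat_def matrix_vector_mult_def sum_2)

lemma contr_iff_norm:
  assumes "q \<ge> 0"
  shows "contr q z \<longleftrightarrow> (\<forall>v. norm (sym_mat z *v v) \<le> q * norm v)"
proof -
  have "norm (sym_mat z *v v) \<le> q * norm v \<longleftrightarrow>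
      (cmod (z$1 * v$1 + z$3 * v$2))^2 + (cmod (z$3 * v$1 + z$2 * v$2))^2 \<le> q^2 * ((cmod (v$1))^2 + (cmod (v$2))^2)" for v
    using abs_le_square_iff[of "norm (sym_mat z *v v)" "q * norm v"] assms
    by (simp add: power_mult_distrib norm_complex2 sym_mat_mult)
  note * = this
  show ?thesis
  proof
    assume c: "\<forall>v. norm (sym_mat z *v v) \<le> q * norm v"
    show "contr q z" unfolding contr_def
    proof (intro allI)
      fix x y
      show "(cmod (z$1 * x + z$3 * y))^2 + (cmod (z$3 * x + z$2 * y))^2 \<le> q^2 * ((cmod x)^2 + (cmod y)^2)"
        using c[unfolded *, rule_format, of "vector [x, y]"] by simp
    qed
  qed (auto simp: * intro: contrD)
qed

lemma cartan_II_iff: "z \<in> cartan_II \<longleftrightarrow> (\<exists>q. 0 \<le> q \<and> q < 1 \<and> contr q z)"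
proof
  assume z: "z \<in> cartan_II"
  let ?q = "onorm ((*v) (sym_mat z))"
  have bl: "bounded_linear ((*v) (sym_mat z))" by simp
  have "contr ?q z" unfolding contr_iff_norm[OF onorm_pos_le[OF bl]] using onorm[OF bl] by blast
  then show "\<exists>q. 0 \<le> q \<and> q < 1 \<and> contr q z" using z onorm_pos_le[OF bl] by (auto simp: cartan_II_def)
next
  assume "\<exists>q. 0 \<le> q \<and> q < 1 \<and> contr q z"
  then obtain q where q: "0 \<le> q" "q < 1" "\<And>v. norm (sym_mat z *v v) \<le> q * norm v"
    using contr_iff_norm by blast
  then show "z \<in> cartan_II" using onorm_le[of "(*v) (sym_mat z)" q] by (auto simp: cartan_II_def)
qed

text \<open>A change of \<open>z\<close> by \<open>w\<close> changes the operator norm by at most \<open>4 \<parallel>w\<parallel>\<close>; this gives openness of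
  the Cartan domain.\<close>

lemma contr_add_small:
  assumes "contr q z" "0 \<le> q"
  shows "contr (q + 4 * norm (z' - z)) z'"
proof -
  let ?w = "z' - z"
  have small: "norm (sym_mat ?w *v v) \<le> 4 * norm ?w * norm v" for v
  proof -
    have "cmod (?w$i * v$1 + ?w$j * v$2) \<le> 2 * norm ?w * norm v" for i j
    proof -
      have "cmod (?w$i * v$1 + ?w$j * v$2) \<le> cmod (?w$i) * cmod (v$1) + cmod (?w$j) * cmod (v$2)"
        by (rule order_trans[OF norm_triangle_ineq]) (simp add: norm_mult)
      also have "\<dots> \<le> norm ?w * norm v + norm ?w * norm v"
        by (intro add_mono mult_mono Finite_Cartesian_Product.norm_nth_le) auto
      also have "\<dots> = 2 * norm ?w * norm v" by simp
      finally show ?thesis .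
    qed
    note this[of 1 3] this[of 3 2]
    moreover have "norm (sym_mat ?w *v v) \<le> cmod ((sym_mat ?w *v v)$1) + cmod ((sym_mat ?w *v v)$2)"
      using L2_set_le_sum[of UNIV "\<lambda>i. norm ((sym_mat ?w *v v)$i)"] by (simp add: norm_vec_def sum_2)
    ultimately show ?thesis unfolding sym_mat_mult by simp
  qed
  have add: "sym_mat z' *v v = sym_mat z *v v + sym_mat ?w *v v" for v
    by (simp add: vec_eq_iff forall_2 sym_mat_mult algebra_simps)
  have q: "q + 4 * norm ?w \<ge> 0" using assms(2) by simp
  show ?thesis unfolding contr_iff_norm[OF q]
  proof
    fix v
    have "norm (sym_mat z' *v v) \<le> norm (sym_mat z *v v) + norm (sym_mat ?w *v v)"
      unfolding add by (rule norm_triangle_ineq)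
    also have "\<dots> \<le> q * norm v + 4 * norm ?w * norm v"
      using small assms contr_iff_norm by (intro add_mono) auto
    finally show "norm (sym_mat z' *v v) \<le> (q + 4 * norm ?w) * norm v" by (simp add: algebra_simps)
  qed
qed

lemma open_cartan_II: "open cartan_II"
proof (rule openI)
  fix z assume "z \<in> cartan_II"
  then obtain q where q: "0 \<le> q" "q < 1" "contr q z" using cartan_II_iff by blast
  have "ball z ((1 - q) / 4) \<subseteq> cartan_II"
  proof
    fix z' assume "z' \<in> ball z ((1 - q) / 4)"
    then have "q + 4 * norm (z' - z) < 1" by (simp add: dist_norm norm_minus_commute)
    then show "z' \<in> cartan_II" using contr_add_small[OF q(3,1), of z'] q(1) cartan_II_iff
      by (meson add_nonneg_nonneg mult_nonneg_nonneg norm_ge_zero zero_le_numeral)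
  qed
  then show "\<exists>e>0. ball z e \<subseteq> cartan_II" using q by (intro exI[of _ "(1 - q) / 4"]) auto
qed

lemma shilov_cartan_II_iff:
  "z \<in> shilov_cartan_II \<longleftrightarrow> cnj (z$1) * z$1 + cnj (z$3) * z$3 = 1 \<and>
     cnj (z$2) * z$2 + cnj (z$3) * z$3 = 1 \<and> cnj (z$1) * z$3 + cnj (z$3) * z$2 = 0"
proof -
  have U: "unitary_mat (sym_mat z) \<longleftrightarrow>
     ((cnj (z$1) * z$1 + cnj (z$3) * z$3 = 1 \<and> cnj (z$1) * z$3 + cnj (z$3) * z$2 = 0) \<and>
      (cnj (z$3) * z$1 + cnj (z$2) * z$3 = 0 \<and> cnj (z$3) * z$3 + cnj (z$2) * z$2 = 1)) \<and>
     ((z$1 * cnj (z$1) + z$3 * cnj (z$3) = 1 \<and> z$1 * cnj (z$3) + z$3 * cnj (z$2) = 0) \<and>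
      (z$3 * cnj (z$1) + z$2 * cnj (z$3) = 0 \<and> z$3 * cnj (z$3) + z$2 * cnj (z$2) = 1))"
    by (simp add: unitary_mat_def vec_eq_iff forall_2 matrix_matrix_mult_def sum_2 sym_mat_def map_matrix_def
      transpose_def mat_def)
  have c: "cnj (z$3) * z$1 + cnj (z$2) * z$3 = cnj (cnj (z$1) * z$3 + cnj (z$3) * z$2)"
    "z$1 * cnj (z$3) + z$3 * cnj (z$2) = cnj (cnj (z$1) * z$3 + cnj (z$3) * z$2)"
    "z$3 * cnj (z$1) + z$2 * cnj (z$3) = cnj (z$1) * z$3 + cnj (z$3) * z$2"
    "z$1 * cnj (z$1) + z$3 * cnj (z$3) = cnj (z$1) * z$1 + cnj (z$3) * z$3"
    "z$3 * cnj (z$3) + z$2 * cnj (z$2) = cnj (z$2) * z$2 + cnj (z$3) * z$3"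
    "cnj (z$3) * z$3 + cnj (z$2) * z$2 = cnj (z$2) * z$2 + cnj (z$3) * z$3"
    by (simp_all add: mult.commute add.commute)
  show ?thesis
    unfolding shilov_cartan_II_def mem_Collect_eq U c complex_cnj_zero_iff by blast
qed

lemma shilov_cartan_II_norms:
  assumes "z \<in> shilov_cartan_II"
  shows "(cmod (z$1))^2 + (cmod (z$3))^2 = 1" "(cmod (z$2))^2 + (cmod (z$3))^2 = 1"
    "cmod (z$i) \<le> 1"
proof -
  have *: "complex_of_real ((cmod w)^2) = cnj w * w" for w by (simp add: complex_norm_square mult.commute del: of_real_power)
  have "complex_of_real ((cmod (z$1))^2 + (cmod (z$3))^2) = of_real 1" 
     "complex_of_real ((cmod (z$2))^2 + (cmod (z$3))^2) = of_real 1"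
    using assms unfolding shilov_cartan_II_iff of_real_add * by simp_all
  then show 1: "(cmod (z$1))^2 + (cmod (z$3))^2 = 1" "(cmod (z$2))^2 + (cmod (z$3))^2 = 1"
    unfolding of_real_eq_iff by simp_all
  then have "(cmod (z$i))^2 \<le> 1" using exhaust_3[of i] zero_le_power2[of "cmod (z$1)"] zero_le_power2[of "cmod (z$2)"]
      zero_le_power2[of "cmod (z$3)"] by (smt (verit))
  then show "cmod (z$i) \<le> 1" using power2_le_imp_le[of "cmod (z$i)" 1] by simp
qed

text \<open>A unitary matrix preserves norms.\<close>

lemma contr_shilov:
  assumes "z \<in> shilov_cartan_II" shows "contr 1 z"
  unfolding contr_def
proof (intro allI)
  fix x y
  have *: "complex_of_real ((cmod w)^2) = cnj w * w" for w by (simp add: complex_norm_square mult.commute del: of_real_power)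
  note z = assms[unfolded shilov_cartan_II_iff]
  have z4: "z$1 * cnj (z$3) + z$3 * cnj (z$2) = 0"
    using arg_cong[OF conjunct2[OF conjunct2[OF z]], of cnj] by (simp add: mult.commute add.commute)
  have "cnj (z$1 * x + z$3 * y) * (z$1 * x + z$3 * y) + cnj (z$3 * x + z$2 * y) * (z$3 * x + z$2 * y)
     = cnj x * x * (cnj (z$1) * z$1 + cnj (z$3) * z$3) + cnj y * y * (cnj (z$2) * z$2 + cnj (z$3) * z$3)
       + cnj x * y * (cnj (z$1) * z$3 + cnj (z$3) * z$2) + x * cnj y * (z$1 * cnj (z$3) + z$3 * cnj (z$2))"
    by (simp add: algebra_simps)
  also have "\<dots> = cnj x * x + cnj y * y" using z z4 by simp
  finally have "complex_of_real ((cmod (z$1 * x + z$3 * y))^2 + (cmod (z$3 * x + z$2 * y))^2) = of_real ((cmod x)^2 + (cmod y)^2)"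
    unfolding of_real_add * .
  then show "(cmod (z$1 * x + z$3 * y))^2 + (cmod (z$3 * x + z$2 * y))^2 \<le> 1^2 * ((cmod x)^2 + (cmod y)^2)"
    unfolding of_real_eq_iff by simp
qed

lemma compact_shilov_cartan_II: "compact shilov_cartan_II"
proof -
  have eq: "shilov_cartan_II = {z. cnj (z$1) * z$1 + cnj (z$3) * z$3 = 1 \<and>
     cnj (z$2) * z$2 + cnj (z$3) * z$3 = 1 \<and> cnj (z$1) * z$3 + cnj (z$3) * z$2 = 0}"
    using shilov_cartan_II_iff by blast
  have "closed shilov_cartan_II"
    unfolding eq by (intro closed_Collect_conj closed_Collect_eq continuous_intros)
  moreover have "norm z \<le> (\<Sum>i\<in>(UNIV::3 set). 1)" if "z \<in> shilov_cartan_II" for z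
    using that unfolding norm_vec_def
    by (intro order_trans[OF L2_set_le_sum] sum_mono shilov_cartan_II_norms(3)) auto
  then have "bounded shilov_cartan_II" by (auto simp: bounded_iff)
  ultimately show ?thesis by (simp add: compact_eq_bounded_closed)
qed

text \<open>\<open>diag_act a b\<close> is \<open>Z \<mapsto> A Z A\<close> with \<open>A = diag(a,b)\<close>, and \<open>had_act\<close> is \<open>Z \<mapsto> U Z U\<close> with the
  Hadamard matrix \<open>U = [[1, 1], [1, -1]] / \<surd>2\<close>.\<close>

definition diag_act :: "complex \<Rightarrow> complex \<Rightarrow> complex^3 \<Rightarrow> complex^3" where
  "diag_act a b z = vector [a^2 * z$1, b^2 * z$2, a * b * z$3]"

definition had_act :: "complex^3 \<Rightarrow> complex^3" where
  "had_act z = vector [(z$1 + z$2) / 2 + z$3, (z$1 + z$2) / 2 - z$3, (z$1 - z$2) / 2]"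

lemma diag_act_nth [simp]:
  "diag_act a b z $ 1 = a^2 * z$1" "diag_act a b z $ 2 = b^2 * z$2" "diag_act a b z $ 3 = a * b * z$3"
  by (simp_all add: diag_act_def)

lemma had_act_nth [simp]:
  "had_act z $ 1 = (z$1 + z$2) / 2 + z$3" "had_act z $ 2 = (z$1 + z$2) / 2 - z$3" "had_act z $ 3 = (z$1 - z$2) / 2"
  by (simp_all add: had_act_def)

lemma had_act_involution: "had_act (had_act z) = z"
  by (simp add: vec_eq_iff forall_3 field_simps)

lemma diag_act_diag_act: "diag_act a b (diag_act c d z) = diag_act (a * c) (b * d) z"
  by (simp add: vec_eq_iff forall_3 power_mult_distrib)

lemma diag_act_1: "diag_act 1 1 z = z"
  by (simp add: vec_eq_iff forall_3)

lemma diag_act_scale: "diag_act (of_real r * a) (of_real r * b) z = r^2 *\<^sub>R diag_act a b z"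
  unfolding vec_eq_iff forall_3 scaleR_complex_nth by (simp add: power2_eq_square)

lemma diag_act_scaleR: "diag_act a b (r *\<^sub>R z) = r *\<^sub>R diag_act a b z"
  unfolding vec_eq_iff forall_3 diag_act_nth scaleR_complex_nth by simp

lemma had_act_scaleR: "had_act (r *\<^sub>R z) = r *\<^sub>R had_act z"
  unfolding vec_eq_iff forall_3 had_act_nth scaleR_complex_nth by (simp add: field_simps)

text \<open>Here \<open>a\<close> and \<open>b\<close> range over the closed disc: the orbit map extends holomorphically from the
  torus to the bidisc without leaving the closed Cartan domain.\<close>

lemma contr_diag_act:
  assumes "contr q z" "cmod a \<le> 1" "cmod b \<le> 1"
  shows "contr q (diag_act a b z)"
  unfolding contr_def
proof (intro allI)
  fix x y
  have le: "(cmod (c * w))^2 \<le> (cmod w)^2" if "cmod c \<le> 1" for c w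
    using that by (intro power_mono) (auto simp: norm_mult mult_left_le_one_le)
  have "(cmod (diag_act a b z$1 * x + diag_act a b z$3 * y))^2 + (cmod (diag_act a b z$3 * x + diag_act a b z$2 * y))^2
     = (cmod (a * (z$1 * (a * x) + z$3 * (b * y))))^2 + (cmod (b * (z$3 * (a * x) + z$2 * (b * y))))^2"
    by (simp add: algebra_simps power2_eq_square)
  also have "\<dots> \<le> (cmod (z$1 * (a * x) + z$3 * (b * y)))^2 + (cmod (z$3 * (a * x) + z$2 * (b * y)))^2"
    by (intro add_mono le assms)
  also have "\<dots> \<le> q^2 * ((cmod (a * x))^2 + (cmod (b * y))^2)" by (rule contrD[OF assms(1)])
  also have "\<dots> \<le> q^2 * ((cmod x)^2 + (cmod y)^2)" by (intro mult_left_mono add_mono le assms) auto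
  finally show "(cmod (diag_act a b z$1 * x + diag_act a b z$3 * y))^2 + (cmod (diag_act a b z$3 * x + diag_act a b z$2 * y))^2
    \<le> q^2 * ((cmod x)^2 + (cmod y)^2)" .
qed

lemma contr_had_act:
  assumes "contr q z" shows "contr q (had_act z)"
  unfolding contr_def
proof (intro allI)
  fix x y
  have par: "(cmod (u + v))^2 + (cmod (u - v))^2 = 2 * ((cmod u)^2 + (cmod v)^2)" for u v :: complex
    unfolding cmod_power2 by (simp add: power2_eq_square algebra_simps)
  let ?P = "z$1 * (x + y) + z$3 * (x - y)" and ?Q = "z$3 * (x + y) + z$2 * (x - y)"
  have "had_act z$1 * x + had_act z$3 * y = (?P + ?Q) / 2" "had_act z$3 * x + had_act z$2 * y = (?P - ?Q) / 2"
    by (simp_all add: field_simps)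
  then have "(cmod (had_act z$1 * x + had_act z$3 * y))^2 + (cmod (had_act z$3 * x + had_act z$2 * y))^2
    = ((cmod (?P + ?Q))^2 + (cmod (?P - ?Q))^2) / 4"
    by (simp only: norm_divide power_divide) simp
  also have "\<dots> = ((cmod ?P)^2 + (cmod ?Q)^2) / 2" by (subst par) simp
  also have "\<dots> \<le> q^2 * ((cmod (x + y))^2 + (cmod (x - y))^2) / 2" using contrD[OF assms, of "x + y" "x - y"] by simp
  also have "\<dots> = q^2 * ((cmod x)^2 + (cmod y)^2)" by (subst par) simp
  finally show "(cmod (had_act z$1 * x + had_act z$3 * y))^2 + (cmod (had_act z$3 * x + had_act z$2 * y))^2
    \<le> q^2 * ((cmod x)^2 + (cmod y)^2)" .
qed

lemma unimodular_cnj: "cmod a = 1 \<Longrightarrow> a * cnj a = 1"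
  by (simp add: complex_norm_square[symmetric])

lemma shilov_diag_act:
  assumes z: "z \<in> shilov_cartan_II" and a: "cmod a = 1" and b: "cmod b = 1"
  shows "diag_act a b z \<in> shilov_cartan_II"
proof -
  have a': "a * cnj a = 1" and b': "b * cnj b = 1" using a b unimodular_cnj by auto
  have "cnj (a^2 * z$1) * (a^2 * z$1) + cnj (a * b * z$3) * (a * b * z$3) =
     (a * cnj a) * (a * cnj a) * (cnj (z$1) * z$1) + (a * cnj a) * (b * cnj b) * (cnj (z$3) * z$3)"
    "cnj (b^2 * z$2) * (b^2 * z$2) + cnj (a * b * z$3) * (a * b * z$3) =
     (b * cnj b) * (b * cnj b) * (cnj (z$2) * z$2) + (a * cnj a) * (b * cnj b) * (cnj (z$3) * z$3)"
    "cnj (a^2 * z$1) * (a * b * z$3) + cnj (a * b * z$3) * (b^2 * z$2) =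
      (a * cnj a) * (cnj a * b) * (cnj (z$1) * z$3) + (b * cnj b) * (cnj a * b) * (cnj (z$3) * z$2)"
    by (simp_all add: power2_eq_square mult_ac)
  then show ?thesis using z unfolding shilov_cartan_II_iff diag_act_nth a' b'
    by (simp flip: distrib_left)
qed

lemma shilov_had_act:
  assumes z: "z \<in> shilov_cartan_II" shows "had_act z \<in> shilov_cartan_II"
proof -
  let ?a = "z$1" let ?b = "z$2" let ?c = "z$3"
  let ?A = "cnj ?a" let ?B = "cnj ?b" let ?C = "cnj ?c"
  have h: "?A * ?a + ?C * ?c = 1" "?B * ?b + ?C * ?c = 1" "?A * ?c + ?C * ?b = 0"
    using z unfolding shilov_cartan_II_iff by auto
  have h4: "?a * ?C + ?c * ?B = 0"
    using arg_cong[OF h(3), of cnj] by (simp add: mult.commute add.commute)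
  have "((?A + ?B) / 2 + ?C) * ((?a + ?b) / 2 + ?c) + ((?A - ?B) / 2) * ((?a - ?b) / 2)
    = ((?A * ?a + ?C * ?c) + (?B * ?b + ?C * ?c) + (?A * ?c + ?C * ?b) + (?a * ?C + ?c * ?B)) / 2"
    by (simp add: field_simps)
  moreover have "((?A + ?B) / 2 - ?C) * ((?a + ?b) / 2 - ?c) + ((?A - ?B) / 2) * ((?a - ?b) / 2)
    = ((?A * ?a + ?C * ?c) + (?B * ?b + ?C * ?c) - (?A * ?c + ?C * ?b) - (?a * ?C + ?c * ?B)) / 2"
    by (simp add: field_simps)
  moreover have "((?A + ?B) / 2 + ?C) * ((?a - ?b) / 2) + ((?A - ?B) / 2) * ((?a + ?b) / 2 - ?c)
    = ((?A * ?a + ?C * ?c) - (?B * ?b + ?C * ?c) - (?A * ?c + ?C * ?b) + (?a * ?C + ?c * ?B)) / 2"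
    by (simp add: field_simps)
  ultimately show ?thesis unfolding shilov_cartan_II_iff had_act_nth using h h4 by simp
qed

text \<open>Complex-linear maps are holomorphic, and openness of the domain lets the inverse be
  differentiated although it is specified on the domain only.\<close>

lemma linear_automorphismsI:
  assumes lin: "Vector_Spaces.linear (*s) (*s) k" "Vector_Spaces.linear (*s) (*s) k'"
    and into: "\<And>z. z \<in> cartan_II \<Longrightarrow> k z \<in> cartan_II" "\<And>z. z \<in> cartan_II \<Longrightarrow> k' z \<in> cartan_II"
    and inv: "\<And>z. k (k' z) = z" "\<And>z. k' (k z) = z"
  shows "k \<in> linear_automorphisms"
proof -
  have hol: "holomorphic_map_on l cartan_II" if l: "Vector_Spaces.linear (*s) (*s) l" for l :: "complex^3 \<Rightarrow> complex^3"
    unfolding holomorphic_map_on_def holomorphic_fun_on_def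
  proof (intro allI ballI exI conjI)
    fix i z c v
    interpret l: Vector_Spaces.linear "(*s)" "(*s)" l by (rule l)
    have "linear l"
    proof (rule linearI)
      have s: "r *\<^sub>R v = of_real r *s v" for r and v :: "complex^3"
        unfolding vec_eq_iff scaleR_complex_nth by simp
      show "l (r *\<^sub>R b) = r *\<^sub>R l b" for r b
        unfolding s by (rule l.scale)
    qed (rule l.add)
    then have "bounded_linear (\<lambda>z. l z $ i)"
      using bounded_linear_compose[OF bounded_linear_vec_nth] linear_conv_bounded_linear by blast
    then show "((\<lambda>z. l z $ i) has_derivative (\<lambda>z. l z $ i)) (at z)" by (rule bounded_linear_imp_has_derivative)
    show "l (c *s v) $ i = c * l v $ i" unfolding l.scale by simp
  qed
  have bij: "bij_betw k cartan_II cartan_II"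
    by (rule bij_betw_byWitness[of _ k']) (use into inv in auto)
  have invk: "inv_into cartan_II k z = k' z" if "z \<in> cartan_II" for z
    using inv_into_f_f[OF bij_betw_imp_inj_on[OF bij] into(2)[OF that]] inv by simp
  have "holomorphic_map_on (inv_into cartan_II k) cartan_II"
    unfolding holomorphic_map_on_def holomorphic_fun_on_def
  proof (intro allI ballI)
    fix i z assume z: "z \<in> cartan_II"
    obtain D where D: "((\<lambda>z. k' z $ i) has_derivative D) (at z)" "\<forall>c v. D (c *s v) = c * D v"
      using hol[OF lin(2)] z unfolding holomorphic_map_on_def holomorphic_fun_on_def by blast
    have "((\<lambda>z. inv_into cartan_II k z $ i) has_derivative D) (at z)"
      by (rule has_derivative_transform_within_open[OF D(1) open_cartan_II z]) (simp add: invk)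
    then show "\<exists>D. ((\<lambda>z. inv_into cartan_II k z $ i) has_derivative D) (at z) \<and> (\<forall>c v. D (c *s v) = c * D v)"
      using D(2) by blast
  qed
  then show ?thesis using lin hol bij by (simp add: linear_automorphisms_def biholomorphic_automorphism_def)
qed

lemma linear_diag_act: "Vector_Spaces.linear (*s) (*s) (diag_act a b)"
  by unfold_locales (simp_all add: vec_eq_iff forall_3 algebra_simps)

lemma linear_had_act: "Vector_Spaces.linear (*s) (*s) had_act"
  by unfold_locales (simp_all add: vec_eq_iff forall_3 field_simps)

lemma cartan_diag_act: "z \<in> cartan_II \<Longrightarrow> cmod a = 1 \<Longrightarrow> cmod b = 1 \<Longrightarrow> diag_act a b z \<in> cartan_II"
  unfolding cartan_II_iff using contr_diag_act by (metis order_refl)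

lemma cartan_had_act: "z \<in> cartan_II \<Longrightarrow> had_act z \<in> cartan_II"
  unfolding cartan_II_iff using contr_had_act by blast

lemma had_act_automorphism: "had_act \<in> linear_automorphisms"
  by (rule linear_automorphismsI[of _ had_act])
     (simp_all add: linear_had_act cartan_had_act had_act_involution)

lemma diag_act_automorphism:
  assumes "cmod a = 1" "cmod b = 1" shows "diag_act a b \<in> linear_automorphisms"
proof (rule linear_automorphismsI[of _ "diag_act (cnj a) (cnj b)"])
  have "a * cnj a = 1" "b * cnj b = 1" "cnj a * a = 1" "cnj b * b = 1" 
    using assms unimodular_cnj by (auto simp: mult.commute)
  then show "diag_act a b (diag_act (cnj a) (cnj b) z) = z" "diag_act (cnj a) (cnj b) (diag_act a b z) = z" for z
    by (simp_all add: diag_act_diag_act diag_act_1)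
qed (use assms in \<open>auto intro: linear_diag_act cartan_diag_act\<close>)

lemma unimodularI: assumes "w * cnj w = 1" shows "cmod w = 1"
proof -
  have "complex_of_real ((cmod w)^2) = of_real 1" using assms by (simp add: complex_norm_square del: of_real_power)
  then have "(cmod w)^2 = 1^2" unfolding of_real_eq_iff by simp
  then show ?thesis using power2_eq_iff_nonneg[of "cmod w" 1] by simp
qed

lemma unimodular_square_root:
  assumes "cmod w = 1" obtains a where "cmod a = 1" "a^2 = w"
proof
  show "(csqrt w)^2 = w" by simp
  show "cmod (csqrt w) = 1" using assms by (simp add: norm_csqrt)
qed

text \<open>A diagonal unitary makes both diagonal entries equal to \<open>c \<ge> 0\<close>.  Orthogonality of the columns
  then makes the off-diagonal entry imaginary, and the Hadamard matrix diagonalizes the result.\<close>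

lemma shilov_normal_form:
  assumes z: "z \<in> shilov_cartan_II"
  obtains a b w where "cmod a = 1" "cmod b = 1" "cmod w = 1"
    "had_act (diag_act a b z) = vector [w, cnj w, 0]"
proof -
  note result = that
  note norms = shilov_cartan_II_norms(1,2)[OF z]
  define c where "c = cmod (z$1)"
  have c2: "cmod (z$2) = c" using norms unfolding c_def by (metis add_right_cancel norm_ge_zero power2_eq_iff_nonneg)
  have main: ?thesis if ab: "cmod a = 1" "cmod b = 1" "a^2 * z$1 = of_real c" "b^2 * z$2 = of_real c"
     and re: "Re (a * b * z$3) = 0" for a b
  proof -
    define t where "t = a * b * z$3"
    define w where "w = complex_of_real c + t"
    have ct: "cnj t = - t" using re unfolding t_def[symmetric] by (simp add: complex_eq_iff)
    have cw: "cnj w = of_real c - t" by (simp add: w_def ct)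
    have u: "diag_act a b z \<in> shilov_cartan_II" by (rule shilov_diag_act[OF z ab(1,2)])
    have "w * cnj w = cnj (of_real c) * of_real c + cnj t * t" unfolding cw by (simp add: w_def ct algebra_simps)
    also have "\<dots> = 1" using u unfolding shilov_cartan_II_iff diag_act_nth ab(3) t_def by blast
    finally have "cmod w = 1" by (rule unimodularI)
    moreover have "had_act (diag_act a b z) = vector [w, cnj w, 0]"
      unfolding vec_eq_iff forall_3 had_act_nth diag_act_nth ab(3,4) t_def[symmetric] by (simp add: cw) (simp add: w_def)
    ultimately show ?thesis using result[OF ab(1,2)] by blast
  qed
  show ?thesis
  proof (cases "c = 0")
    case True
    then have 0: "z$1 = 0" "z$2 = 0" using c2 c_def by auto
    then have "(cmod (z$3))^2 = 1^2" using norms by simp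
    then have "cmod (z$3) = 1" using power2_eq_iff_nonneg[of "cmod (z$3)" 1] by simp
    then have "cmod (\<i> * cnj (z$3)) = 1" "\<i> * cnj (z$3) * z$3 = \<i>"
      using unimodular_cnj[of "z$3"] by (simp_all add: norm_mult mult.commute)
    \<comment> \<open>With zero diagonal any phases are allowed; this choice makes the off-diagonal entry
    imaginary.\<close>
    then show ?thesis using main[of "\<i> * cnj (z$3)" 1] 0 True by simp
  next
    case False
    then have cpos: "c > 0" by (simp add: c_def)
    obtain a where a: "cmod a = 1" "a^2 = cnj (z$1) / of_real c"
      using unimodular_square_root[of "cnj (z$1) / of_real c"] cpos by (auto simp: norm_divide c_def)
    obtain b where b: "cmod b = 1" "b^2 = cnj (z$2) / of_real c"
      using unimodular_square_root[of "cnj (z$2) / of_real c"] cpos c2 by (auto simp: norm_divide)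
    have ns: "cnj w * w = of_real ((cmod w)^2)" for w by (simp add: complex_norm_square mult.commute del: of_real_power)
    have A: "a^2 * z$1 = of_real c" "b^2 * z$2 = of_real c"
      using cpos unfolding a(2) b(2) by (simp_all add: ns c2 c_def[symmetric] power2_eq_square)
    have "diag_act a b z \<in> shilov_cartan_II" by (rule shilov_diag_act[OF z a(1) b(1)])
    then have "of_real c * (a * b * z$3) + cnj (a * b * z$3) * of_real c = 0"
      unfolding shilov_cartan_II_iff diag_act_nth A by (metis complex_cnj_complex_of_real)
    moreover have "Re t = 0" if "of_real c * t + cnj t * of_real c = 0" for t
      using arg_cong[OF that, of Re] cpos by simp
    ultimately have "Re (a * b * z$3) = 0" by blast
    then show ?thesis using main[OF a(1) b(1) A] by blast
  qed
qed

text \<open>Two diagonal unitary matrices of determinant one differ by a diagonal action, so the normal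
  forms of \<open>z\<close> and \<open>z'\<close> can be joined.\<close>

lemma shilov_transitive:
  assumes z: "z \<in> shilov_cartan_II" and z': "z' \<in> shilov_cartan_II"
  obtains a b c d e f where "cmod a = 1" "cmod b = 1" "cmod c = 1" "cmod d = 1" "cmod e = 1" "cmod f = 1"
    "z' = diag_act a b (had_act (diag_act c d (had_act (diag_act e f z))))"
proof -
  obtain e f w where 1: "cmod e = 1" "cmod f = 1" "cmod w = 1"
    "had_act (diag_act e f z) = vector [w, cnj w, 0]" using shilov_normal_form[OF z] .
  obtain a b w' where 2: "cmod a = 1" "cmod b = 1" "cmod w' = 1"
    "had_act (diag_act a b z') = vector [w', cnj w', 0]" using shilov_normal_form[OF z'] .
  obtain c where c: "cmod c = 1" "c^2 = w' * cnj w" 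
    using unimodular_square_root[of "w' * cnj w"] 1(3) 2(3) by (auto simp: norm_mult)
  have w: "w * cnj w = 1" "cnj w * w = 1" using unimodular_cnj[OF 1(3)] by (auto simp: mult.commute)
  have "cnj c ^ 2 = cnj w' * w" using arg_cong[OF c(2), of cnj] by simp
  then have "diag_act c (cnj c) (vector [w, cnj w, 0]) = (vector [w', cnj w', 0] :: complex^3)"
    using w by (simp add: vec_eq_iff forall_3 c(2) mult.assoc)
  then have "had_act (diag_act c (cnj c) (had_act (diag_act e f z))) = diag_act a b z'"
    unfolding 1(4) using arg_cong[OF 2(4), of had_act] by (simp add: had_act_involution)
  then have "diag_act (cnj a) (cnj b) (had_act (diag_act c (cnj c) (had_act (diag_act e f z)))) = z'"
    using unimodular_cnj[OF 2(1)] unimodular_cnj[OF 2(2)] 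
    by (simp add: diag_act_diag_act diag_act_1 mult.commute)
  then show ?thesis using that[of "cnj a" "cnj b" c "cnj c" e f] 1 2 c by simp
qed

section \<open>The tetrablock and its analytic discs\<close>

text \<open>The dilation of the tetrablock that \<open>tetra_map\<close> intertwines with scalar multiplication by \<open>r\<close>.\<close>

definition dil :: "real \<Rightarrow> complex^3 \<Rightarrow> complex^3" where
  "dil r w = vector [of_real r * w$1, of_real r * w$2, of_real (r^2) * w$3]"

lemma dil_nth [simp]:
  "dil r w $ 1 = of_real r * w$1" "dil r w $ 2 = of_real r * w$2" "dil r w $ 3 = of_real (r^2) * w$3"
  by (simp_all add: dil_def)

lemma tetra_map_scaleR: "tetra_map (r *\<^sub>R z) = dil r (tetra_map z)"
  unfolding vec_eq_iff forall_3 tetra_map_nth dil_nth scaleR_complex_nth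
  by (simp add: power2_eq_square algebra_simps)

lemma dil_dil: "dil r (dil s w) = dil (r * s) w"
  by (simp add: vec_eq_iff forall_3 power_mult_distrib)

lemma dil_1: "dil 1 w = w"
  by (simp add: vec_eq_iff forall_3)

lemma tetrablockD:
  "w \<in> tetrablock \<Longrightarrow> cmod u \<le> 1 \<Longrightarrow> cmod v \<le> 1 \<Longrightarrow> 1 - w$1 * u - w$2 * v + w$3 * u * v \<noteq> 0"
  by (simp add: tetrablock_def)

lemma tetrablockI:
  "(\<And>u v. cmod u \<le> 1 \<Longrightarrow> cmod v \<le> 1 \<Longrightarrow> 1 - w$1 * u - w$2 * v + w$3 * u * v \<noteq> 0) \<Longrightarrow> w \<in> tetrablock"
  by (simp add: tetrablock_def)

lemma dil_tetrablock:
  assumes "w \<in> tetrablock" "\<bar>r\<bar> \<le> 1" shows "dil r w \<in> tetrablock"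
proof (rule tetrablockI)
  fix u v :: complex assume uv: "cmod u \<le> 1" "cmod v \<le> 1"
  have "cmod (of_real r * u) \<le> 1" "cmod (of_real r * v) \<le> 1"
    using uv assms(2) by (auto simp: norm_mult intro: mult_le_one)
  from tetrablockD[OF assms(1) this]
  show "1 - dil r w$1 * u - dil r w$2 * v + dil r w$3 * u * v \<noteq> 0"
    by (simp add: power2_eq_square algebra_simps)
qed

lemma cmod_diff_sq: "(cmod (x - y))^2 = (cmod x)^2 + (cmod y)^2 - 2 * Re (x * cnj y)"
  unfolding cmod_power2 by (simp add: power2_eq_square algebra_simps)

text \<open>For \<open>|u| = 1\<close> the zero \<open>v = (1 - p u) / (q - s u)\<close> of the polynomial lies outside the closed
  disc.  Squaring \<open>|q - s u| < |1 - p u|\<close> leaves a linear inequality in \<open>u\<close>, and the \<open>u\<close> chosen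
  below is the worst case.\<close>

lemma nonvanishing_half_bound:
  fixes p q s :: complex
  assumes nz: "\<And>u v. cmod u \<le> 1 \<Longrightarrow> cmod v \<le> 1 \<Longrightarrow> 1 - p * u - q * v + s * u * v \<noteq> 0"
  shows "2 * cmod (p - cnj q * s) < 1 + (cmod p)^2 - (cmod q)^2 - (cmod s)^2"
proof -
  define k where "k = p - cnj q * s"
  define u where "u = (if k = 0 then 1 else cnj k / of_real (cmod k))"
  have u: "cmod u = 1" by (simp add: u_def norm_divide)
  have ku: "k * u = of_real (cmod k)"
  proof (cases "k = 0")
    case False
    have "k * cnj k = of_real (cmod k) * of_real (cmod k)" by (simp add: complex_norm_square[symmetric] power2_eq_square[symmetric] del: of_real_power) (simp add: complex_norm_square)
    then show ?thesis using False by (simp add: u_def)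
  qed (simp add: u_def)
  have "1 - p * u \<noteq> 0" using nz[of u 0] u by simp
  have "cmod (q - s * u) < cmod (1 - p * u)"
  proof (rule ccontr)
    assume "\<not> cmod (q - s * u) < cmod (1 - p * u)"
    then have le: "cmod (1 - p * u) \<le> cmod (q - s * u)" by simp
    with \<open>1 - p * u \<noteq> 0\<close> have B: "q - s * u \<noteq> 0" by auto
    define v where "v = (1 - p * u) / (q - s * u)"
    have "cmod v \<le> 1" using le B by (simp add: v_def norm_divide)
    moreover have "v * (q - s * u) = 1 - p * u" using B by (simp add: v_def)
    then have "1 - p * u - q * v + s * u * v = 0" by (simp add: algebra_simps)
    ultimately show False using nz[of u v] u by simp
  qed
  then have "(cmod (q - s * u))^2 < (cmod (1 - p * u))^2" by (intro power_strict_mono) auto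
  moreover have "cmod (s * u) = cmod s" "cmod (p * u) = cmod p" using u by (simp_all add: norm_mult)
  moreover have "Re (1 * cnj (p * u)) = Re (p * u)" "Re (q * cnj (s * u)) = Re (cnj q * s * u)"
    by (simp_all add: algebra_simps)
  ultimately have "(cmod q)^2 + (cmod s)^2 - 2 * Re (cnj q * s * u) < 1^2 + (cmod p)^2 - 2 * Re (p * u)"
    unfolding cmod_diff_sq norm_one by metis
  moreover have "cmod k = Re (p * u) - Re (cnj q * s * u)"
    using arg_cong[OF ku, of Re] by (simp add: k_def left_diff_distrib)
  ultimately show ?thesis unfolding k_def[symmetric] power_one by linarith
qed

lemma tetrablock_bound:
  assumes w: "w \<in> tetrablock"
  shows "cmod (w$3) < 1" "cmod (w$1 - cnj (w$2) * w$3) + cmod (w$2 - cnj (w$1) * w$3) < 1 - (cmod (w$3))^2"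
proof -
  have 1: "2 * cmod (w$1 - cnj (w$2) * w$3) < 1 + (cmod (w$1))^2 - (cmod (w$2))^2 - (cmod (w$3))^2"
    by (rule nonvanishing_half_bound) (rule tetrablockD[OF w])
  have 2: "2 * cmod (w$2 - cnj (w$1) * w$3) < 1 + (cmod (w$2))^2 - (cmod (w$1))^2 - (cmod (w$3))^2"
  proof (rule nonvanishing_half_bound)
    show "1 - w$2 * u - w$1 * v + w$3 * u * v \<noteq> 0" if "cmod u \<le> 1" "cmod v \<le> 1" for u v
      using tetrablockD[OF w that(2,1)] by (simp add: algebra_simps)
  qed
  show 3: "cmod (w$1 - cnj (w$2) * w$3) + cmod (w$2 - cnj (w$1) * w$3) < 1 - (cmod (w$3))^2"
    using 1 2 by linarith
  have "(cmod (w$3))^2 < 1" 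
    using 3 norm_ge_zero[of "w$1 - cnj (w$2) * w$3"] norm_ge_zero[of "w$2 - cnj (w$1) * w$3"] by linarith
  then show "cmod (w$3) < 1" using power2_less_imp_less[of "cmod (w$3)" 1] by simp
qed

text \<open>For \<open>|a| + |b| < 1\<close> these analytic discs lie in the tetrablock, have their boundary in the Shilov
  boundary, and pass through every point of the tetrablock.\<close>

definition disc :: "complex \<Rightarrow> complex \<Rightarrow> complex \<Rightarrow> complex^3" where
  "disc a b s = vector [a + cnj b * s, b + cnj a * s, s]"

lemma disc_nth [simp]: "disc a b s $ 1 = a + cnj b * s" "disc a b s $ 2 = b + cnj a * s" "disc a b s $ 3 = s"
  by (simp_all add: disc_def)

lemma disc_denominator:
  assumes ab: "cmod a + cmod b < 1" and "cmod u \<le> 1" "cmod v \<le> 1"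
  shows "1 - a * u - b * v \<noteq> 0"
proof
  assume "1 - a * u - b * v = 0"
  then have "1 = a * u + b * v" by (simp add: algebra_simps)
  then have "1 \<le> cmod (a * u) + cmod (b * v)" using norm_triangle_ineq[of "a * u" "b * v"] by (metis norm_one)
  also have "\<dots> \<le> cmod a + cmod b" using assms by (auto simp: norm_mult intro!: add_mono mult_left_le)
  finally show False using ab by simp
qed

text \<open>By the maximum principle it is enough to consider \<open>|u| = 1\<close>.  With \<open>c = 1 - a u\<close> the claim becomes
  \<open>|v cnj c - cnj b| \<le> |c - b v|\<close>, which follows from \<open>|b| \<le> |c|\<close> and \<open>|v| \<le> 1\<close>.\<close>

lemma disc_ratio:
  assumes ab: "cmod a + cmod b < 1" and u: "cmod u \<le> 1" and v: "cmod v \<le> 1"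
  shows "cmod (u * v - cnj b * u - cnj a * v) \<le> cmod (1 - a * u - b * v)"
proof -
  define g where "g = (\<lambda>u. (u * v - cnj b * u - cnj a * v) / (1 - a * u - b * v))"
  have nz: "1 - a * u - b * v \<noteq> 0" if "cmod u \<le> 1" for u
    by (rule disc_denominator[OF ab that v])
  have hol: "g holomorphic_on cball 0 1"
    unfolding g_def by (intro holomorphic_intros) (use nz in \<open>auto simp: mem_cball\<close>)
  have "cmod (g u) \<le> 1"
  proof (rule maximum_modulus_frontier[of g "cball 0 1"])
    show "g holomorphic_on interior (cball 0 1)" 
      by (rule holomorphic_on_subset[OF hol]) (rule interior_subset)
    show "continuous_on (closure (cball 0 1)) g" using holomorphic_on_imp_continuous_on[OF hol] by simp
    show "cmod (g z) \<le> 1" if "z \<in> frontier (cball 0 1)" for z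
    proof -
      have z: "cmod z = 1" using that by simp
      define c where "c = 1 - a * z"
      have zz: "z * cnj z = 1" by (rule unimodular_cnj[OF z])
      have "z * v - cnj b * z - cnj a * v = z * (v * cnj c - cnj b) - cnj a * v * (1 - z * cnj z)"
        by (simp add: c_def algebra_simps)
      then have e: "cmod (z * v - cnj b * z - cnj a * v) = cmod (v * cnj c - cnj b)" 
        using z unfolding zz by (simp add: norm_mult)
      have "cmod b \<le> cmod c"
      proof -
        have "1 - cmod a \<le> cmod c" using norm_triangle_ineq2[of 1 "a * z"] z by (simp add: c_def norm_mult)
        then show ?thesis using ab by linarith
      qed
      then have bc: "(cmod b)^2 \<le> (cmod c)^2" by (intro power_mono) auto
      have v2: "(cmod v)^2 \<le> 1" using power_mono[OF v, of 2] by simp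
      have "(cmod (v * cnj c - cnj b))^2 = (cmod v)^2 * (cmod c)^2 + (cmod b)^2 - 2 * Re (v * cnj c * b)"
        unfolding cmod_diff_sq by (simp only: norm_mult power_mult_distrib complex_mod_cnj complex_cnj_cnj)
      moreover have "(cmod (c - b * v))^2 = (cmod c)^2 + (cmod b)^2 * (cmod v)^2 - 2 * Re (c * cnj (b * v))"
        unfolding cmod_diff_sq by (simp only: norm_mult power_mult_distrib)
      moreover have "Re (c * cnj (b * v)) = Re (v * cnj c * b)" by (simp add: algebra_simps)
      moreover have "0 \<le> (1 - (cmod v)^2) * ((cmod c)^2 - (cmod b)^2)" using bc v2 by simp
      then have "0 \<le> (cmod c)^2 - (cmod b)^2 - (cmod v)^2 * (cmod c)^2 + (cmod b)^2 * (cmod v)^2" by (simp add: algebra_simps)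
      ultimately have "(cmod (v * cnj c - cnj b))^2 \<le> (cmod (c - b * v))^2" by linarith
      then have "cmod (v * cnj c - cnj b) \<le> cmod (c - b * v)" by (rule power2_le_imp_le) simp
      moreover have "c - b * v = 1 - a * z - b * v" by (simp add: c_def)
      ultimately have "cmod (z * v - cnj b * z - cnj a * v) \<le> cmod (1 - a * z - b * v)" unfolding e by simp
      then show ?thesis using nz[of z] z by (simp add: g_def norm_divide)
    qed
  qed (use u in auto)
  then show ?thesis using nz[OF u] by (simp add: g_def norm_divide)
qed

text \<open>The defining polynomial at \<open>disc a b s\<close> is \<open>(1 - a u - b v) + s (u v - cnj b u - cnj a v)\<close>, whose
  second bracket is dominated by the first.\<close>

lemma disc_in_tetrablock:
  assumes ab: "cmod a + cmod b < 1" and s: "cmod s < 1"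
  shows "disc a b s \<in> tetrablock"
proof (rule tetrablockI)
  fix u v :: complex assume uv: "cmod u \<le> 1" "cmod v \<le> 1"
  show "1 - disc a b s$1 * u - disc a b s$2 * v + disc a b s$3 * u * v \<noteq> 0"
  proof
    assume "1 - disc a b s$1 * u - disc a b s$2 * v + disc a b s$3 * u * v = 0"
    then have "1 - a * u - b * v = - s * (u * v - cnj b * u - cnj a * v)"
      by (simp add: algebra_simps)
    then have "cmod (1 - a * u - b * v) = cmod s * cmod (u * v - cnj b * u - cnj a * v)"
      by (metis norm_minus_cancel norm_mult)
    also have "\<dots> \<le> cmod s * cmod (1 - a * u - b * v)" by (intro mult_left_mono disc_ratio ab uv) simp
    finally have "(1 - cmod s) * cmod (1 - a * u - b * v) \<le> 0" by (simp add: algebra_simps)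
    moreover have "0 < (1 - cmod s) * cmod (1 - a * u - b * v)"
      using s disc_denominator[OF ab uv] by simp
    ultimately show False by simp
  qed
qed

lemma disc_parameters:
  assumes s: "cmod (w$3) < 1"
  defines "a \<equiv> (w$1 - cnj (w$2) * w$3) / of_real (1 - (cmod (w$3))^2)"
    and "b \<equiv> (w$2 - cnj (w$1) * w$3) / of_real (1 - (cmod (w$3))^2)"
  shows "w = disc a b (w$3)"
    and "cmod a + cmod b = (cmod (w$1 - cnj (w$2) * w$3) + cmod (w$2 - cnj (w$1) * w$3)) / (1 - (cmod (w$3))^2)"
proof -
  have lt: "(cmod (w$3))^2 < 1" using s by (simp add: power_less_one_iff)
  define m where "m = 1 - w$3 * cnj (w$3)"
  have m: "complex_of_real (1 - (cmod (w$3))^2) = m" by (simp add: m_def complex_norm_square[symmetric])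
  have m0: "m \<noteq> 0" using lt unfolding m[symmetric] of_real_eq_0_iff by simp
  have cm: "cnj m = m" unfolding m[symmetric] by simp
  have "a + cnj b * w$3 = w$1" "b + cnj a * w$3 = w$2"
    unfolding a_def b_def m using m0 by (simp_all add: cm divide_simps) (simp_all add: m_def algebra_simps)
  then show "w = disc a b (w$3)" by (simp add: vec_eq_iff forall_3)
  show "cmod a + cmod b = (cmod (w$1 - cnj (w$2) * w$3) + cmod (w$2 - cnj (w$1) * w$3)) / (1 - (cmod (w$3))^2)"
    unfolding a_def b_def norm_divide norm_of_real using lt by (simp add: add_divide_distrib)
qed

text \<open>The two summands on the left of the inequality are \<open>|a|\<close> and \<open>|b|\<close>, up to the factor \<open>1 - |w\<^sub>3|\<^sup>2\<close>, for the disc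
  through \<open>w\<close>.\<close>

lemma tetrablock_eq:
  "tetrablock = {w. cmod (w$3) < 1 \<and> cmod (w$1 - cnj (w$2) * w$3) + cmod (w$2 - cnj (w$1) * w$3) < 1 - (cmod (w$3))^2}"
proof (intro equalityI subsetI CollectI conjI)
  fix w :: "complex^3"
  assume "w \<in> {w. cmod (w$3) < 1 \<and> cmod (w$1 - cnj (w$2) * w$3) + cmod (w$2 - cnj (w$1) * w$3) < 1 - (cmod (w$3))^2}"
  then have w: "cmod (w$3) < 1" "cmod (w$1 - cnj (w$2) * w$3) + cmod (w$2 - cnj (w$1) * w$3) < 1 - (cmod (w$3))^2" by auto
  have "(cmod (w$3))^2 < 1" using w(1) by (simp add: power_less_one_iff)
  then have "(cmod (w$1 - cnj (w$2) * w$3) + cmod (w$2 - cnj (w$1) * w$3)) / (1 - (cmod (w$3))^2) < 1"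
    using w(2) by (simp add: divide_simps)
  then show "w \<in> tetrablock"
    using disc_in_tetrablock[OF _ w(1)] disc_parameters[OF w(1)] by metis
qed (auto dest: tetrablock_bound)

lemma open_tetrablock: "open tetrablock"
  unfolding tetrablock_eq by (intro open_Collect_conj open_Collect_less continuous_intros)

text \<open>The defining polynomial at \<open>tetra_map z\<close> is \<open>det (1 - Z diag(u,v))\<close>.  The vector \<open>(x, y)\<close> in the
  proof lies in the kernel if it vanishes, and a strict contraction \<open>Z\<close> cannot map \<open>(u x, v y)\<close> to
  \<open>(x, y) \<noteq> 0\<close>.\<close>

lemma tetra_map_contr:
  assumes c: "contr q z" and q: "0 \<le> q" "q < 1"
  shows "tetra_map z \<in> tetrablock"
proof (rule tetrablockI)
  fix u v :: complex assume uv: "cmod u \<le> 1" "cmod v \<le> 1"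
  have q2: "q^2 < 1" using q by (simp add: power_less_one_iff)
  show "1 - tetra_map z$1 * u - tetra_map z$2 * v + tetra_map z$3 * u * v \<noteq> 0"
  proof
    assume "1 - tetra_map z$1 * u - tetra_map z$2 * v + tetra_map z$3 * u * v = 0"
    then have det: "z$3 * u * z$3 * v = (1 - z$2 * v) * (1 - z$1 * u)"
      by (simp add: power2_eq_square algebra_simps)
    define x where "x = z$3 * v" define y where "y = 1 - z$1 * u"
    have fix1: "z$1 * (u * x) + z$3 * (v * y) = x" by (simp add: x_def y_def algebra_simps)
    have fix2: "z$3 * (u * x) + z$2 * (v * y) = y" using det by (simp add: x_def y_def algebra_simps)
    have "(cmod x)^2 + (cmod y)^2 \<le> q^2 * ((cmod (u * x))^2 + (cmod (v * y))^2)"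
      using contrD[OF c, of "u * x" "v * y"] unfolding fix1 fix2 .
    also have "\<dots> \<le> q^2 * ((cmod x)^2 + (cmod y)^2)"
      using uv by (intro mult_left_mono add_mono power_mono) (auto simp: norm_mult mult_left_le_one_le)
    finally have "(1 - q^2) * ((cmod x)^2 + (cmod y)^2) \<le> 0" by (simp add: algebra_simps)
    then have "(cmod x)^2 + (cmod y)^2 \<le> 0" using q2 by (simp add: mult_le_0_iff)
    then have "y = 0" by (metis add_nonneg_eq_0_iff norm_eq_zero order_antisym power2_eq_iff_nonneg sum_power2_le_zero_iff zero_le_power2 zero_power2)
    then have z1u: "z$1 * u = 1" by (simp add: y_def)
    have "(cmod (z$1))^2 + (cmod (z$3))^2 \<le> q^2" using contrD[OF c, of 1 0] by simp
    then have "(cmod (z$1))^2 \<le> q^2" using zero_le_power2[of "cmod (z$3)"] by linarith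
    then have "cmod (z$1) \<le> q" using q power2_le_imp_le by blast
    then have "cmod (z$1 * u) < 1" using uv q by (simp add: norm_mult) (metis mult_left_le norm_ge_zero order.trans order_le_less_trans)
    then show False unfolding z1u by simp
  qed
qed

text \<open>The absolute value of the determinant of a unitary matrix is one.\<close>

lemma tetra_map_shilov:
  assumes z: "z \<in> shilov_cartan_II" shows "tetra_map z \<in> shilov_tetrablock"
proof -
  let ?a = "z$1" let ?b = "z$2" let ?c = "z$3" let ?d = "?a * ?b - ?c^2"
  have h: "cnj ?a * ?a + cnj ?c * ?c = 1" "cnj ?b * ?b + cnj ?c * ?c = 1" "cnj ?a * ?c + cnj ?c * ?b = 0"
    using z unfolding shilov_cartan_II_iff by auto
  have h4: "?a * cnj ?c + ?c * cnj ?b = 0"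
    using arg_cong[OF h(3), of cnj] by (simp add: mult.commute add.commute)
  have "?d * cnj ?d = (cnj ?a * ?a + cnj ?c * ?c) * (cnj ?b * ?b + cnj ?c * ?c) - (cnj ?a * ?c + cnj ?c * ?b) * (?a * cnj ?c + ?c * cnj ?b)"
    by (simp add: algebra_simps power2_eq_square)
  also have "\<dots> = 1" unfolding h by simp
  finally have d: "cmod ?d = 1" by (rule unimodularI)
  have "cnj ?b * ?d = ?a * (cnj ?b * ?b + cnj ?c * ?c) - ?c * (?a * cnj ?c + ?c * cnj ?b)"
    by (simp add: algebra_simps power2_eq_square)
  then have "cnj ?b * ?d = ?a" unfolding h h4 by simp
  then show ?thesis using d shilov_cartan_II_norms(3)[OF z, of 2] by (simp add: shilov_tetrablock_def)
qed

text \<open>Solve \<open>z\<^sub>3\<^sup>2 = z\<^sub>1 z\<^sub>2 - s\<close>.\<close>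

lemma shilov_lift:
  assumes s: "cmod s = 1" and x: "cmod x \<le> 1"
  obtains z where "z \<in> shilov_cartan_II" "tetra_map z = vector [cnj x * s, x, s]" "(cmod (z$3))^2 = 1 - (cmod x)^2"
proof
  define t where "t = 1 - (cmod x)^2"
  have t0: "t \<ge> 0" using power_mono[OF x, of 2] by (simp add: t_def)
  define c where "c = csqrt (- s * of_real t)"
  let ?z = "vector [cnj x * s, x, c] :: complex^3"
  have c2: "c^2 = - s * of_real t" by (simp add: c_def)
  have "(cmod c)^2 = cmod (c^2)" by (simp add: norm_power)
  also have "\<dots> = t" unfolding c2 using s t0 by (simp add: norm_mult)
  finally have nc: "(cmod c)^2 = t" .
  then show "(cmod (?z$3))^2 = 1 - (cmod x)^2" by (simp add: t_def)
  have ns: "cnj w * w = of_real ((cmod w)^2)" for w by (simp add: complex_norm_square mult.commute del: of_real_power)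
  have xx: "cnj x * x = 1 - of_real t" by (simp add: ns t_def)
  have ss: "s * cnj s = 1" by (rule unimodular_cnj[OF s])
  show "tetra_map ?z = vector [cnj x * s, x, s]"
  proof -
    have "cnj x * s * x - c^2 = s * (cnj x * x) - c^2" by (simp only: mult_ac)
    also have "\<dots> = s" unfolding xx c2 by (simp add: algebra_simps)
    finally show ?thesis by (simp add: vec_eq_iff forall_3)
  qed
  have cc: "cnj c * c = of_real t" unfolding ns nc ..
  have "(cnj s * c + cnj c) * c = cnj s * c^2 + cnj c * c" by (simp add: power2_eq_square algebra_simps)
  also have "\<dots> = - (s * cnj s) * of_real t + of_real t" unfolding c2 ns nc by (simp add: mult_ac)
  also have "\<dots> = 0" unfolding ss by simp
  finally have "cnj s * c + cnj c = 0" by (cases "c = 0") auto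
  then have "x * (cnj s * c + cnj c) = 0" by simp
  then have 3: "cnj (cnj x * s) * c + cnj c * x = 0" by (simp add: algebra_simps)
  have 1: "cnj (cnj x * s) * (cnj x * s) + cnj c * c = 1"
  proof -
    have "cnj (cnj x * s) * (cnj x * s) + cnj c * c = (cnj x * x) * (s * cnj s) + cnj c * c" by (simp add: mult_ac)
    also have "\<dots> = 1" unfolding ss xx cc by simp
    finally show ?thesis .
  qed
  have 2: "cnj x * x + cnj c * c = 1" unfolding xx cc by simp
  show "?z \<in> shilov_cartan_II" unfolding shilov_cartan_II_iff using 1 2 3 by simp
qed

lemma disc_boundary:
  assumes ab: "cmod a + cmod b \<le> \<rho>" "\<rho> < 1" and s: "cmod s = 1"
  obtains z where "z \<in> shilov_cartan_II" "tetra_map z = disc a b s" "1 - \<rho>^2 \<le> (cmod (z$3))^2"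
proof -
  define x where "x = b + cnj a * s"
  have x: "cmod x \<le> \<rho>" using norm_triangle_ineq[of b "cnj a * s"] ab s by (simp add: x_def norm_mult)
  then obtain z where z: "z \<in> shilov_cartan_II" "tetra_map z = vector [cnj x * s, x, s]" "(cmod (z$3))^2 = 1 - (cmod x)^2"
    using shilov_lift[OF s, of x] ab by auto
  have "cnj x * s = cnj b * s + a * (s * cnj s)" by (simp add: x_def algebra_simps)
  then have "cnj x * s = a + cnj b * s" unfolding unimodular_cnj[OF s] by simp
  then have "vector [cnj x * s, x, s] = disc a b s" by (simp add: vec_eq_iff forall_3 x_def)
  moreover have "(cmod x)^2 \<le> \<rho>^2" using x by (intro power_mono) auto
  ultimately show ?thesis using that z by simp
qed

text \<open>Inside the disc this is the previous inclusion.  On its boundary the point is \<open>tetra_map\<close> of a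
  unitary matrix, and \<open>r < 1\<close> makes the dilated matrix a strict contraction.\<close>

lemma dil_disc_in_tetrablock:
  assumes ab: "cmod a + cmod b < 1" and s: "cmod s \<le> 1" and r: "0 \<le> r" "r < 1"
  shows "dil r (disc a b s) \<in> tetrablock"
proof (cases "cmod s = 1")
  case True
  obtain z where z: "z \<in> shilov_cartan_II" "tetra_map z = disc a b s"
    using disc_boundary[OF order_refl ab True] by blast
  have "contr (r * 1) (r *\<^sub>R z)" by (rule contr_scaleR[OF contr_shilov[OF z(1)]])
  then have "tetra_map (r *\<^sub>R z) \<in> tetrablock" using r by (intro tetra_map_contr[of r]) auto
  then show ?thesis unfolding tetra_map_scaleR z(2) .
next
  case False
  then show ?thesis using dil_tetrablock[OF disc_in_tetrablock[OF ab]] s r by simp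
qed

lemma holomorphic_fun_on_curve:
  fixes g :: "complex \<Rightarrow> complex^'n"
  assumes f: "holomorphic_fun_on f U" and g: "\<And>i. (\<lambda>s. g s $ i) field_differentiable (at s)" and U: "g s \<in> U"
  shows "(\<lambda>s. f (g s)) field_differentiable (at s)"
proof -
  obtain g' where g': "\<And>i. ((\<lambda>s. g s $ i) has_field_derivative g' i) (at s)"
    using g unfolding field_differentiable_def by metis
  define v where "v = (\<chi> i. g' i)"
  have gd: "(g has_derivative (\<lambda>h. h *s v)) (at s)"
  proof (rule has_derivative_vec_components)
    fix i show "((\<lambda>s. g s $ i) has_derivative (\<lambda>h. (h *s v) $ i)) (at s)"
    proof -
      have "(\<lambda>h. (h *s v) $ i) = (*) (g' i)" by (auto simp: v_def fun_eq_iff mult.commute)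
      then show ?thesis using g'[of i, unfolded has_field_derivative_def] by simp
    qed
  qed
  obtain D where D: "(f has_derivative D) (at (g s))" "\<forall>c v. D (c *s v) = c * D v"
    using f U unfolding holomorphic_fun_on_def by blast
  have "((\<lambda>s. f (g s)) has_derivative (\<lambda>h. D (h *s v))) (at s)"
    using has_derivative_compose[OF gd D(1)] .
  then have "((\<lambda>s. f (g s)) has_field_derivative D v) (at s)"
    unfolding has_field_derivative_def
  proof (rule has_derivative_eq_rhs)
    show "(\<lambda>h. D (h *s v)) = (*) (D v)" using D(2) by (auto simp: fun_eq_iff mult.commute)
  qed
  then show ?thesis using field_differentiable_def by blast
qed

lemma holomorphic_fun_on_continuous: "holomorphic_fun_on f U \<Longrightarrow> continuous_on U f"
  unfolding holomorphic_fun_on_def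
  by (meson continuous_at_imp_continuous_on has_derivative_continuous)

section \<open>Poisson integrals and the sub-mean value property\<close>

definition poisson :: "complex \<Rightarrow> complex \<Rightarrow> real" where
  "poisson a u = (1 - (cmod a)^2) / (cmod (u - a))^2"

text \<open>Normalized arc length on the unit circle, transported to the plane so that Borel functions of a complex
  variable can be integrated over it.\<close>

definition circ :: "complex measure" where
  "circ = distr (restrict_space lborel {0..1}) borel (\<lambda>t. cis (2 * pi * t))"

lemma circ_param_measurable [measurable]:
  "(\<lambda>t. cis (2 * pi * t)) \<in> borel_measurable (restrict_space lborel {0..1})"
proof -
  have "(\<lambda>t. cis (2 * pi * t)) \<in> borel_measurable borel"
    by (rule borel_measurable_continuous_onI) (intro continuous_intros)
  then show ?thesis by (intro measurable_restrict_space1) simp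
qed

lemma sets_circ [measurable_cong, simp]: "sets circ = sets borel"
  by (simp add: circ_def)

lemma space_circ [simp]: "space circ = UNIV"
  by (simp add: circ_def)

lemma nn_integral_circ:
  assumes "f \<in> borel_measurable borel"
  shows "(\<integral>\<^sup>+s. f s \<partial>circ) = (\<integral>\<^sup>+t. f (cis (2 * pi * t)) * indicator {0..1} t \<partial>lborel)"
  unfolding circ_def using assms
  by (subst nn_integral_distr) (auto simp: nn_integral_restrict_space)

lemma nn_integral_circ_has_integral:
  assumes "f \<in> borel_measurable borel" "\<And>s. cmod s = 1 \<Longrightarrow> f s = ennreal (h s)" "\<And>s. cmod s = 1 \<Longrightarrow> 0 \<le> h s"
    and "((\<lambda>t. h (cis (2 * pi * t))) has_integral I) {0..1}"
  shows "(\<integral>\<^sup>+s. f s \<partial>circ) = ennreal I"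
  unfolding nn_integral_circ[OF assms(1)] using nn_integral_has_integral_lebesgue'[OF _ assms(4)] assms(2,3)
  by simp

lemma prob_space_circ: "prob_space circ"
proof
  have "(\<integral>\<^sup>+s. 1 \<partial>circ) = ennreal 1"
    by (rule nn_integral_circ_has_integral[where h="\<lambda>_. 1"]) (auto intro: has_integral_const_real[of 1 0 1, simplified])
  then show "emeasure circ (space circ) = 1" by simp
qed

lemma AE_circ: "AE s in circ. cmod s = 1"
  unfolding circ_def by (subst AE_distr_iff) auto

lemma poisson_nonneg: "cmod a < 1 \<Longrightarrow> 0 \<le> poisson a u"
  by (simp add: poisson_def power_le_one)

lemma poisson_le:
  assumes "cmod a \<le> \<rho>" "\<rho> < 1" "cmod u = 1"
  shows "poisson a u \<le> 1 / (1 - \<rho>)^2"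
proof -
  have "1 - \<rho> \<le> cmod (u - a)" using norm_triangle_ineq2[of u a] assms by simp
  then have "(1 - \<rho>)^2 \<le> (cmod (u - a))^2" using assms(2) by (intro power_mono) auto
  then show ?thesis unfolding poisson_def using assms(2)
    by (intro frac_le) auto
qed

lemma borel_measurable_poisson [measurable]: "poisson a \<in> borel_measurable borel"
  unfolding poisson_def by measurable

text \<open>Cauchy's formula at \<open>a\<close> for \<open>g s (1 - |a|\<^sup>2) / (1 - cnj a s)\<close>: on the unit circle the Cauchy kernel
  times this factor is the Poisson kernel, and at \<open>a\<close> the factor is one.\<close>

lemma poisson_integral:
  assumes cont: "continuous_on (cball 0 1) g" and hol: "g holomorphic_on ball 0 1" and a: "cmod a < 1"
  shows "((\<lambda>t. of_real (poisson a (cis (2 * pi * t))) * g (cis (2 * pi * t))) has_integral g a) {0..1}"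
proof -
  define f where "f = (\<lambda>s. g s * ((1 - a * cnj a) / (1 - cnj a * s)))"
  have nz: "1 - cnj a * s \<noteq> 0" if "cmod s \<le> 1" for s
  proof
    assume "1 - cnj a * s = 0"
    then have "cmod (cnj a * s) = 1" by simp
    then show False using a that by (simp add: norm_mult) (metis less_le_not_le mult_left_le norm_ge_zero)
  qed
  have cf: "continuous_on (cball 0 1) f" unfolding f_def by (intro continuous_intros cont) (use nz in auto)
  have hf: "f holomorphic_on ball 0 1" unfolding f_def by (intro holomorphic_intros hol) (use nz in auto)
  have fa: "f a = g a" using nz[of a] a by (simp add: f_def mult.commute)
  have "((\<lambda>u. f u / (u - a)) has_contour_integral (2 * of_real pi * \<i> * f a)) (circlepath 0 1)"
    by (rule Cauchy_integral_circlepath[OF cf hf]) (use a in simp)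
  then have 1: "((\<lambda>x. f (circlepath 0 1 x) / (circlepath 0 1 x - a) *
      vector_derivative (circlepath 0 1) (at x within {0..1})) has_integral (2 * of_real pi * \<i> * g a)) {0..1}"
    unfolding has_contour_integral_def fa .
  have "((\<lambda>x. (1 / (2 * of_real pi * \<i>)) * (f (circlepath 0 1 x) / (circlepath 0 1 x - a) *
      vector_derivative (circlepath 0 1) (at x within {0..1}))) has_integral
      (1 / (2 * of_real pi * \<i>)) * (2 * of_real pi * \<i> * g a)) {0..1}"
    by (rule has_integral_mult_right[OF 1])
  then have "((\<lambda>x. (1 / (2 * of_real pi * \<i>)) * (f (circlepath 0 1 x) / (circlepath 0 1 x - a) *
      vector_derivative (circlepath 0 1) (at x within {0..1}))) has_integral g a) {0..1}" by simp
  then show ?thesis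
  proof (rule has_integral_eq[rotated])
    fix t :: real assume t: "t \<in> {0..1}"
    define u where "u = cis (2 * pi * t)"
    have cp: "circlepath 0 1 t = u" unfolding u_def cis_conv_exp circlepath by (simp add: mult_ac)
    have vd: "vector_derivative (circlepath 0 1) (at t within {0..1}) = 2 * of_real pi * \<i> * u"
      using vector_derivative_circlepath01[of t 0 1] t unfolding u_def cis_conv_exp by (simp add: mult_ac)
    have uu: "u * cnj u = 1" by (rule unimodular_cnj) (simp add: u_def)
    have ua: "u \<noteq> a" using a by (auto simp: u_def)
    have "1 - cnj a * u = u * cnj (u - a)" using uu by (simp add: algebra_simps)
    then have "f u * u / (u - a) = g u * ((1 - a * cnj a) * u / (u * cnj (u - a) * (u - a)))"
      by (simp add: f_def)
    also have "(1 - a * cnj a) * u / (u * cnj (u - a) * (u - a)) = (1 - a * cnj a) / ((u - a) * cnj (u - a))"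
    proof -
      have "u \<noteq> 0" using uu by auto
      have "(1 - a * cnj a) * u / (u * cnj (u - a) * (u - a)) = (u * (1 - a * cnj a)) / (u * ((u - a) * cnj (u - a)))"
        by (simp only: mult_ac)
      then show ?thesis unfolding mult_divide_mult_cancel_left[OF \<open>u \<noteq> 0\<close>] .
    qed
    also have "\<dots> = of_real (poisson a u)"
      unfolding poisson_def by (simp add: complex_norm_square[symmetric] del: complex_cnj_diff)
    finally show "(1 / (2 * of_real pi * \<i>)) * (f (circlepath 0 1 t) / (circlepath 0 1 t - a) *
      vector_derivative (circlepath 0 1) (at t within {0..1})) = of_real (poisson a (cis (2 * pi * t))) * g (cis (2 * pi * t))"
      unfolding cp vd u_def[symmetric] by (simp add: mult_ac)
  qed
qed

lemma poisson_total:
  assumes "cmod a < 1" shows "(\<integral>\<^sup>+s. ennreal (poisson a s) \<partial>circ) = 1"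
proof -
  have "((\<lambda>t. of_real (poisson a (cis (2 * pi * t))) * (1::complex)) has_integral 1) {0..1}"
    using poisson_integral[of "\<lambda>_. 1" a] assms by simp
  from has_integral_linear[OF this bounded_linear_Re]
  have "((\<lambda>t. poisson a (cis (2 * pi * t))) has_integral 1) {0..1}" by (simp add: o_def)
  from nn_integral_circ_has_integral[OF _ _ _ this, of "\<lambda>s. ennreal (poisson a s)"] show ?thesis
    using poisson_nonneg[OF assms] by simp
qed

text \<open>Jensen's inequality for the probability density \<open>poisson a\<close>, in the form
  \<open>\<integral> P (|g| - m)\<^sup>2 \<ge> 0\<close> with \<open>m = |g a| \<le> \<integral> P |g|\<close>.\<close>

lemma poisson_submean:
  assumes cont: "continuous_on (cball 0 1) g" and hol: "g holomorphic_on ball 0 1" and a: "cmod a < 1"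
    and h: "h \<in> borel_measurable borel" "\<And>s. cmod s = 1 \<Longrightarrow> h s = ennreal ((cmod (g s))^2)"
  shows "ennreal ((cmod (g a))^2) \<le> (\<integral>\<^sup>+s. ennreal (poisson a s) * h s \<partial>circ)"
proof -
  let ?e = "\<lambda>t. cis (2 * pi * t)"
  let ?p = "\<lambda>t. poisson a (?e t)" and ?G = "\<lambda>t. cmod (g (?e t))"
  define m where "m = cmod (g a)"
  have ce: "continuous_on {0..1} ?e" by (intro continuous_intros)
  have cg: "continuous_on {0..1} (\<lambda>t. g (?e t))"
    by (rule continuous_on_compose2[OF cont ce]) auto
  have ne: "?e t \<noteq> a" for t using a by (metis norm_cis less_irrefl)
  have cp: "continuous_on {0..1} ?p" unfolding poisson_def
    by (intro continuous_intros) (use ne in auto)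
  have p0: "?p t \<ge> 0" for t by (rule poisson_nonneg[OF a])
  have i1: "(\<lambda>t. ?p t * ?G t) integrable_on {0..1}" and i2: "(\<lambda>t. ?p t * (?G t)^2) integrable_on {0..1}"
    and i0: "?p integrable_on {0..1}"
    by (intro integrable_continuous_real continuous_intros cp cg)+
  have I0: "integral {0..1} ?p = 1"
  proof -
    have "((\<lambda>t. of_real (?p t) * (1::complex)) has_integral 1) {0..1}"
      using poisson_integral[of "\<lambda>_. 1" a] a by simp
    from has_integral_linear[OF this bounded_linear_Re] show ?thesis by (simp add: o_def integral_unique)
  qed
  have "m = norm (integral {0..1} (\<lambda>t. of_real (?p t) * g (?e t)))"
    using integral_unique[OF poisson_integral[OF cont hol a]] by (simp add: m_def)
  also have "\<dots> \<le> integral {0..1} (\<lambda>t. ?p t * ?G t)"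
  proof (rule Henstock_Kurzweil_Integration.integral_norm_bound_integral[OF _ i1])
    show "(\<lambda>t. of_real (?p t) * g (?e t)) integrable_on {0..1}"
      using poisson_integral[OF cont hol a] by blast
  qed (use p0 in \<open>simp add: norm_mult\<close>)
  finally have le: "m \<le> integral {0..1} (\<lambda>t. ?p t * ?G t)" .
  have "0 \<le> integral {0..1} (\<lambda>t. ?p t * (?G t - m)^2)"
    by (intro Henstock_Kurzweil_Integration.integral_nonneg integrable_continuous_real continuous_intros cp cg) (use p0 in auto)
  also have "(\<lambda>t. ?p t * (?G t - m)^2) = (\<lambda>t. ?p t * (?G t)^2 - 2 * m * (?p t * ?G t) + m^2 * ?p t)"
    by (auto simp: power2_diff algebra_simps)
  also have "integral {0..1} \<dots> = integral {0..1} (\<lambda>t. ?p t * (?G t)^2) - 2 * m * integral {0..1} (\<lambda>t. ?p t * ?G t) + m^2"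
  proof (rule integral_unique)
    show "((\<lambda>t. ?p t * (?G t)^2 - 2 * m * (?p t * ?G t) + m^2 * ?p t) has_integral
        integral {0..1} (\<lambda>t. ?p t * (?G t)^2) - 2 * m * integral {0..1} (\<lambda>t. ?p t * ?G t) + m^2) {0..1}"
      using has_integral_add[OF has_integral_diff[OF integrable_integral[OF i2] has_integral_mult_right[OF integrable_integral[OF i1], of "2 * m"]]
        has_integral_mult_right[OF integrable_integral[OF i0], of "m^2"]] I0 by simp
  qed
  finally have "2 * m * integral {0..1} (\<lambda>t. ?p t * ?G t) \<le> integral {0..1} (\<lambda>t. ?p t * (?G t)^2) + m^2" by simp
  moreover have "2 * m * m \<le> 2 * m * integral {0..1} (\<lambda>t. ?p t * ?G t)"
    using le by (intro mult_left_mono) (simp_all add: m_def)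
  ultimately have fin: "m^2 \<le> integral {0..1} (\<lambda>t. ?p t * (?G t)^2)" by (simp add: power2_eq_square)
  have "(\<integral>\<^sup>+s. ennreal (poisson a s) * h s \<partial>circ) = ennreal (integral {0..1} (\<lambda>t. ?p t * (?G t)^2))"
    by (rule nn_integral_circ_has_integral[where h="\<lambda>s. poisson a s * (cmod (g s))^2"])
       (use i2 h poisson_nonneg[OF a] in \<open>auto simp: ennreal_mult integrable_integral\<close>)
  then show ?thesis using fin by (simp add: m_def ennreal_leI)
qed

text \<open>Entire curves that map the closed unit disc into the closed Cartan domain.  The orbits under
  which averages are taken are of this kind, and the class is stable under the actions.\<close>

definition entire_disc :: "(complex \<Rightarrow> complex^3) \<Rightarrow> bool" where
  "entire_disc \<gamma> \<longleftrightarrow> (\<forall>i s. (\<lambda>s. \<gamma> s $ i) field_differentiable (at s)) \<and> (\<forall>s. cmod s \<le> 1 \<longrightarrow> contr 1 (\<gamma> s))"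

lemma entire_discD: "entire_disc \<gamma> \<Longrightarrow> (\<lambda>s. \<gamma> s $ i) field_differentiable (at s)"
  "entire_disc \<gamma> \<Longrightarrow> cmod s \<le> 1 \<Longrightarrow> contr 1 (\<gamma> s)"
  by (auto simp: entire_disc_def)

lemma entire_disc_diag_act:
  assumes "entire_disc \<gamma>" "cmod a \<le> 1" "cmod b \<le> 1" shows "entire_disc (\<lambda>s. diag_act a b (\<gamma> s))"
  unfolding entire_disc_def
proof (intro conjI allI impI)
  fix i s
  show "(\<lambda>s. diag_act a b (\<gamma> s) $ i) field_differentiable (at s)"
    using exhaust_3[of i] by (auto intro!: derivative_intros entire_discD(1)[OF assms(1)])
qed (intro contr_diag_act entire_discD(2) assms)

lemma entire_disc_had_act:
  assumes "entire_disc \<gamma>" shows "entire_disc (\<lambda>s. had_act (\<gamma> s))"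
  unfolding entire_disc_def
proof (intro conjI allI impI)
  fix i s
  show "(\<lambda>s. had_act (\<gamma> s) $ i) field_differentiable (at s)"
    using exhaust_3[of i] by (auto intro!: derivative_intros entire_discD(1)[OF assms(1)])
qed (intro contr_had_act entire_discD(2) assms)

text \<open>The third disc is an orbit of scalars; \<open>s z = diag_act (\<surd>s) (\<surd>s) z\<close> keeps it in the closed
  Cartan domain.\<close>

lemma entire_disc_orbits:
  assumes "contr 1 z" "cmod c \<le> 1"
  shows "entire_disc (\<lambda>s. diag_act s c z)" "entire_disc (\<lambda>s. diag_act c s z)" "entire_disc (\<lambda>s. s *s z)"
proof -
  show "entire_disc (\<lambda>s. diag_act s c z)"
    unfolding entire_disc_def
  proof (intro conjI allI impI)
    fix i s show "(\<lambda>s. diag_act s c z $ i) field_differentiable (at s)"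
      using exhaust_3[of i] by (auto intro!: derivative_intros)
  qed (intro contr_diag_act assms)
  show "entire_disc (\<lambda>s. diag_act c s z)"
    unfolding entire_disc_def
  proof (intro conjI allI impI)
    fix i s show "(\<lambda>s. diag_act c s z $ i) field_differentiable (at s)"
      using exhaust_3[of i] by (auto intro!: derivative_intros)
  qed (intro contr_diag_act assms)
  show "entire_disc (\<lambda>s. s *s z)"
    unfolding entire_disc_def
  proof (intro conjI allI impI)
    fix i s show "(\<lambda>s. (s *s z) $ i) field_differentiable (at s)"
      by (auto intro!: derivative_intros)
  next
    fix s :: complex assume s: "cmod s \<le> 1"
    have "s *s z = diag_act (csqrt s) (csqrt s) z"
      by (simp add: vec_eq_iff forall_3) (metis power2_csqrt power2_eq_square)
    moreover have "cmod (csqrt s) \<le> 1" using s by (simp add: norm_csqrt real_sqrt_le_1_iff)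
    ultimately show "contr 1 (s *s z)" using contr_diag_act[OF assms(1)] by simp
  qed
qed

text \<open>A weak sub-mean value property with the constant that bounds the Poisson kernel for
  \<open>|a| \<le> \<rho>\<close>.  Functions \<open>|F|\<^sup>2\<close> with \<open>F\<close> holomorphic have it, and so do their averages over
  automorphisms, which are no longer of that form.\<close>

definition submean :: "real \<Rightarrow> (complex^3 \<Rightarrow> ennreal) \<Rightarrow> bool" where
  "submean \<rho> h \<longleftrightarrow> h \<in> borel_measurable borel \<and>
    (\<forall>\<gamma> a. entire_disc \<gamma> \<longrightarrow> cmod a \<le> \<rho> \<longrightarrow> h (\<gamma> a) \<le> ennreal (1 / (1 - \<rho>)^2) * (\<integral>\<^sup>+s. h (\<gamma> s) \<partial>circ))"

lemma submeanD:
  "submean \<rho> h \<Longrightarrow> h \<in> borel_measurable borel"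
  "submean \<rho> h \<Longrightarrow> entire_disc \<gamma> \<Longrightarrow> cmod a \<le> \<rho> \<Longrightarrow> h (\<gamma> a) \<le> ennreal (1 / (1 - \<rho>)^2) * (\<integral>\<^sup>+s. h (\<gamma> s) \<partial>circ)"
  by (auto simp: submean_def)

lemma entire_disc_continuous: 
  assumes "entire_disc \<gamma>" shows "continuous_on UNIV \<gamma>"
  by (rule continuous_on_vec_components)
     (use entire_discD(1)[OF assms] in \<open>auto intro!: continuous_at_imp_continuous_on field_differentiable_imp_continuous_at\<close>)

lemma entire_disc_measurable: "entire_disc \<gamma> \<Longrightarrow> \<gamma> \<in> borel_measurable borel"
  by (rule borel_measurable_continuous_onI[OF entire_disc_continuous])

lemma continuous_on_had_act: "continuous_on S had_act"
proof (rule continuous_on_vec_components)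
  fix i :: 3
  have "i = 1 \<or> i = 2 \<or> i = 3" using exhaust_3 by blast
  then show "continuous_on S (\<lambda>z. had_act z $ i)"
    by (elim disjE; simp; intro continuous_intros; simp?)
qed

lemma continuous_on_diag_act: "continuous_on S (\<lambda>p. diag_act (fst (fst p)) (snd (fst p)) (snd p))"
proof (rule continuous_on_vec_components)
  fix i :: 3
  have "i = 1 \<or> i = 2 \<or> i = 3" using exhaust_3 by blast
  then show "continuous_on S (\<lambda>p. diag_act (fst (fst p)) (snd (fst p)) (snd p) $ i)"
    by (elim disjE; simp; intro continuous_intros; simp?)
qed

lemma had_act_measurable [measurable]: "had_act \<in> borel_measurable borel"
  by (rule borel_measurable_continuous_onI[OF continuous_on_had_act])

lemma submean_had_act:
  assumes "submean \<rho> h" shows "submean \<rho> (\<lambda>z. h (had_act z))"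
  unfolding submean_def
proof (intro conjI allI impI)
  show "(\<lambda>z. h (had_act z)) \<in> borel_measurable borel" using submeanD(1)[OF assms] by measurable
qed (intro submeanD(2)[OF assms] entire_disc_had_act)

definition torus :: "(complex \<times> complex) measure" where "torus = circ \<Otimes>\<^sub>M circ"

lemma sets_torus [measurable_cong, simp]: "sets torus = sets borel"
  unfolding torus_def borel_prod[symmetric] by (intro sets_pair_measure_cong) simp_all

lemma prob_space_torus: "prob_space torus"
proof -
  interpret c: prob_space circ by (rule prob_space_circ)
  interpret pair_prob_space circ circ by unfold_locales
  show ?thesis unfolding torus_def by (rule P.prob_space_axioms)
qed

lemma space_torus [simp]: "space torus = UNIV"
  by (simp add: torus_def space_pair_measure)

lemma AE_torus: "AE p in torus. cmod (fst p) = 1 \<and> cmod (snd p) = 1"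
proof -
  interpret c: prob_space circ by (rule prob_space_circ)
  interpret pair_sigma_finite circ circ by unfold_locales
  have "closed {p :: complex \<times> complex. cmod (fst p) = 1 \<and> cmod (snd p) = 1}"
    by (intro closed_Collect_conj closed_Collect_eq continuous_intros)
  then have "{p \<in> space torus. cmod (fst p) = 1 \<and> cmod (snd p) = 1} \<in> sets torus"
    by (simp add: borel_closed)
  then show ?thesis unfolding torus_def
    by (rule AE_pair_measure) (use AE_circ in auto)
qed

definition torus_average :: "(complex^3 \<Rightarrow> ennreal) \<Rightarrow> complex^3 \<Rightarrow> ennreal" where
  "torus_average h z = (\<integral>\<^sup>+p. h (diag_act (fst p) (snd p) z) \<partial>torus)"

lemma diag_act_joint_measurable:
  assumes "h \<in> borel_measurable borel"
  shows "(\<lambda>p. h (diag_act (fst (fst p)) (snd (fst p)) (snd p))) \<in> borel_measurable (torus \<Otimes>\<^sub>M borel)"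
proof -
  have "(\<lambda>p. h (diag_act (fst (fst p)) (snd (fst p)) (snd p))) \<in> borel_measurable borel"
    by (rule measurable_compose[OF borel_measurable_continuous_onI[OF continuous_on_diag_act] assms])
  moreover have "sets (torus \<Otimes>\<^sub>M (borel :: (complex^3) measure)) = sets borel"
  proof -
    have "sets (torus \<Otimes>\<^sub>M (borel :: (complex^3) measure)) = sets ((borel :: (complex \<times> complex) measure) \<Otimes>\<^sub>M (borel :: (complex^3) measure))"
      by (intro sets_pair_measure_cong) simp_all
    also have "(borel :: (complex \<times> complex) measure) \<Otimes>\<^sub>M (borel :: (complex^3) measure) = borel" by (rule borel_prod)
    finally show ?thesis .
  qed
  ultimately show ?thesis using measurable_cong_sets by blast
qed

section \<open>Point evaluations and the invariant measure\<close>

text \<open>The invariance of \<open>\<Theta>\<close> is exploited through \<open>diag_act\<close> and \<open>had_act\<close>, which already generate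
  a transitive action on the boundary.\<close>

locale boundary_measure =
  fixes \<Theta> :: "(complex^3) measure"
  assumes inv: "invariant_boundary_measure \<Theta>"
begin

lemma prob: "prob_space \<Theta>" and sets_\<Theta>: "sets \<Theta> = sets (restrict_space borel shilov_cartan_II)"
  and distr_\<Theta>: "k \<in> linear_automorphisms \<Longrightarrow> distr \<Theta> \<Theta> k = \<Theta>"
  using inv by (auto simp: invariant_boundary_measure_def)

sublocale prob_space \<Theta> by (rule prob)

lemma finite_\<Theta>: "finite_measure \<Theta>" by unfold_locales

lemma space_\<Theta>: "space \<Theta> = shilov_cartan_II"
  by (rule space_compact_measure[OF compact_shilov_cartan_II finite_\<Theta> sets_\<Theta>])

lemma borel_imp_\<Theta>: "h \<in> borel_measurable borel \<Longrightarrow> h \<in> borel_measurable \<Theta>"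
  using measurable_restrict_space1[of h borel _ shilov_cartan_II] measurable_cong_sets[OF sets_\<Theta> refl] by blast

lemmas continuous_L2_\<Theta> = continuous_L2[OF compact_shilov_cartan_II finite_\<Theta> sets_\<Theta>]

lemma nn_integral_automorphism:
  assumes k: "k \<in> linear_automorphisms" "continuous_on UNIV k" "\<And>z. z \<in> shilov_cartan_II \<Longrightarrow> k z \<in> shilov_cartan_II"
    and h: "h \<in> borel_measurable \<Theta>"
  shows "(\<integral>\<^sup>+z. h (k z) \<partial>\<Theta>) = (\<integral>\<^sup>+z. h z \<partial>\<Theta>)"
proof -
  have "k \<in> measurable (restrict_space borel shilov_cartan_II) (restrict_space borel shilov_cartan_II)"
    using borel_measurable_continuous_onI[OF k(2)] k(3) by (intro measurable_restrict_space3) auto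
  then have km: "k \<in> measurable \<Theta> \<Theta>" using measurable_cong_sets[OF sets_\<Theta> sets_\<Theta>] by blast
  have "(\<integral>\<^sup>+z. h z \<partial>distr \<Theta> \<Theta> k) = (\<integral>\<^sup>+z. h (k z) \<partial>\<Theta>)"
    by (rule nn_integral_distr[OF km]) (use h in simp)
  then show ?thesis unfolding distr_\<Theta>[OF k(1)] by simp
qed

lemma continuous_diag_act: "continuous_on UNIV (diag_act a b)"
  using continuous_on_compose2[OF continuous_on_diag_act[of UNIV], of UNIV "\<lambda>z. ((a, b), z)"]
  by (simp add: continuous_on_Pair)

lemma nn_integral_diag_act:
  assumes "cmod a = 1" "cmod b = 1" "h \<in> borel_measurable \<Theta>"
  shows "(\<integral>\<^sup>+z. h (diag_act a b z) \<partial>\<Theta>) = (\<integral>\<^sup>+z. h z \<partial>\<Theta>)"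
  by (rule nn_integral_automorphism)
     (use assms in \<open>auto intro: diag_act_automorphism shilov_diag_act continuous_diag_act\<close>)

lemma nn_integral_had_act:
  assumes "h \<in> borel_measurable \<Theta>"
  shows "(\<integral>\<^sup>+z. h (had_act z) \<partial>\<Theta>) = (\<integral>\<^sup>+z. h z \<partial>\<Theta>)"
  by (rule nn_integral_automorphism)
     (use assms in \<open>auto intro: had_act_automorphism shilov_had_act continuous_on_had_act\<close>)

end

lemma torus_average_measurable:
  assumes "h \<in> borel_measurable borel" shows "torus_average h \<in> borel_measurable borel"
proof -
  interpret t: prob_space torus by (rule prob_space_torus)
  have "(\<lambda>(z, p). h (diag_act (fst p) (snd p) z)) \<in> borel_measurable (borel \<Otimes>\<^sub>M torus)"
    using measurable_pair_swap[OF diag_act_joint_measurable[OF assms]] by simp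
  from t.borel_measurable_nn_integral[OF this] show ?thesis
    unfolding torus_average_def[abs_def] .
qed

lemma diag_act_torus_measurable:
  assumes "h \<in> borel_measurable borel"
  shows "(\<lambda>p. h (diag_act (fst p) (snd p) z)) \<in> borel_measurable torus"
  using measurable_compose[OF _ diag_act_joint_measurable[OF assms], of "\<lambda>p. (p, z)" torus] by simp

text \<open>Fubini's theorem: the inequality holds for each element of the torus and is then integrated.\<close>

lemma submean_torus_average:
  assumes h: "submean \<rho> h" shows "submean \<rho> (torus_average h)"
  unfolding submean_def
proof (intro conjI allI impI)
  note hm = submeanD(1)[OF h]
  show "torus_average h \<in> borel_measurable borel" by (rule torus_average_measurable[OF hm])
  fix \<gamma> a assume \<gamma>: "entire_disc \<gamma>" and a: "cmod a \<le> \<rho>"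
  interpret t: prob_space torus by (rule prob_space_torus)
  interpret c: prob_space circ by (rule prob_space_circ)
  interpret pair_sigma_finite torus circ by unfold_locales
  let ?c = "ennreal (1 / (1 - \<rho>)^2)"
  let ?g = "\<lambda>p s. h (diag_act (fst p) (snd p) (\<gamma> s))"
  have \<gamma>m: "\<gamma> \<in> borel_measurable borel" by (rule entire_disc_measurable[OF \<gamma>])
  have "(\<lambda>q. (fst q, \<gamma> (snd q))) \<in> measurable (torus \<Otimes>\<^sub>M circ) (torus \<Otimes>\<^sub>M borel)"
    using \<gamma>m by (intro measurable_Pair measurable_fst measurable_compose[OF measurable_snd]) simp
  from measurable_compose[OF this diag_act_joint_measurable[OF hm]]
  have joint: "case_prod ?g \<in> borel_measurable (torus \<Otimes>\<^sub>M circ)" by (simp add: case_prod_beta')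
  have "torus_average h (\<gamma> a) \<le> (\<integral>\<^sup>+p. ?c * (\<integral>\<^sup>+s. ?g p s \<partial>circ) \<partial>torus)"
    unfolding torus_average_def
  proof (rule nn_integral_mono_AE, use AE_torus in eventually_elim)
    fix p :: "complex \<times> complex" assume p: "cmod (fst p) = 1 \<and> cmod (snd p) = 1"
    show "?g p a \<le> ?c * (\<integral>\<^sup>+s. ?g p s \<partial>circ)"
      by (rule submeanD(2)[OF h entire_disc_diag_act[OF \<gamma>] a]) (use p in auto)
  qed
  also have "\<dots> = ?c * (\<integral>\<^sup>+p. (\<integral>\<^sup>+s. ?g p s \<partial>circ) \<partial>torus)"
    by (rule nn_integral_cmult) (rule c.borel_measurable_nn_integral[OF joint])
  also have "(\<integral>\<^sup>+p. (\<integral>\<^sup>+s. ?g p s \<partial>circ) \<partial>torus) = (\<integral>\<^sup>+s. (\<integral>\<^sup>+p. ?g p s \<partial>torus) \<partial>circ)"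
    by (rule Fubini'[OF joint, symmetric])
  finally show "torus_average h (\<gamma> a) \<le> ?c * (\<integral>\<^sup>+s. torus_average h (\<gamma> s) \<partial>circ)"
    unfolding torus_average_def .
qed

text \<open>Both parameters are shrunk by \<open>\<rho>\<close>, one after the other, each at the price of one circle
  average.\<close>

lemma torus_average_bound:
  assumes h: "submean \<rho> h" and \<rho>: "0 \<le> \<rho>" "\<rho> < 1" and z: "contr 1 z" and ab: "cmod a = 1" "cmod b = 1"
  shows "h (\<rho>^2 *\<^sub>R diag_act a b z) \<le> ennreal ((1 / (1 - \<rho>)^2)^2) * torus_average h z"
proof -
  interpret c: prob_space circ by (rule prob_space_circ)
  let ?c = "ennreal (1 / (1 - \<rho>)^2)"
  have na: "cmod (of_real \<rho> * a) \<le> \<rho>" "cmod (of_real \<rho> * b) \<le> \<rho>" using ab \<rho> by (auto simp: norm_mult)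
  have m: "(\<lambda>p. h (diag_act (fst p) (snd p) z)) \<in> borel_measurable (circ \<Otimes>\<^sub>M circ)"
    using diag_act_torus_measurable[OF submeanD(1)[OF h]] unfolding torus_def .
  have "h (\<rho>^2 *\<^sub>R diag_act a b z) = h (diag_act (of_real \<rho> * a) (of_real \<rho> * b) z)"
    by (simp only: diag_act_scale)
  also have "\<dots> \<le> ?c * (\<integral>\<^sup>+s. h (diag_act s (of_real \<rho> * b) z) \<partial>circ)"
    by (rule submeanD(2)[OF h entire_disc_orbits(1)[OF z] na(1)]) (use na \<rho> in simp)
  also have "\<dots> \<le> ?c * (\<integral>\<^sup>+s. ?c * (\<integral>\<^sup>+t. h (diag_act s t z) \<partial>circ) \<partial>circ)"
  proof (intro mult_left_mono nn_integral_mono_AE, use AE_circ in eventually_elim)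
    fix s :: complex assume s: "cmod s = 1"
    show "h (diag_act s (of_real \<rho> * b) z) \<le> ?c * (\<integral>\<^sup>+t. h (diag_act s t z) \<partial>circ)"
      by (rule submeanD(2)[OF h entire_disc_orbits(2)[OF z] na(2)]) (use s in simp)
  qed simp
  also have "(\<integral>\<^sup>+s. ?c * (\<integral>\<^sup>+t. h (diag_act s t z) \<partial>circ) \<partial>circ) = ?c * (\<integral>\<^sup>+s. (\<integral>\<^sup>+t. h (diag_act s t z) \<partial>circ) \<partial>circ)"
    using c.borel_measurable_nn_integral_fst[OF m] by (intro nn_integral_cmult) simp
  also have "(\<integral>\<^sup>+s. (\<integral>\<^sup>+t. h (diag_act s t z) \<partial>circ) \<partial>circ) = torus_average h z"
    using c.nn_integral_fst[OF m] by (simp add: torus_average_def torus_def)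
  finally show ?thesis by (simp add: mult.assoc[symmetric] ennreal_mult'[symmetric] power2_eq_square)
qed

lemma contr_shrink:
  assumes "contr 1 z" "0 \<le> q" "q \<le> 1" shows "contr 1 (q *\<^sub>R z)"
proof -
  have "contr (q * 1) (q *\<^sub>R z)" by (rule contr_scaleR[OF assms(1)])
  moreover have "(q * 1)^2 \<le> (1::real)^2" using assms by (intro power_mono) auto
  ultimately show ?thesis unfolding contr_def by (meson add_nonneg_nonneg mult_right_mono order_trans zero_le_power2)
qed

context boundary_measure
begin

lemma nn_integral_torus_average:
  assumes h: "h \<in> borel_measurable borel"
  shows "(\<integral>\<^sup>+z. torus_average h z \<partial>\<Theta>) = (\<integral>\<^sup>+z. h z \<partial>\<Theta>)"
proof -
  interpret t: prob_space torus by (rule prob_space_torus)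
  interpret pair_sigma_finite torus \<Theta> by unfold_locales
  let ?g = "\<lambda>p z. h (diag_act (fst p) (snd p) z)"
  have id: "(\<lambda>z. z) \<in> borel_measurable \<Theta>" by (rule borel_imp_\<Theta>) simp
  have "(\<lambda>q. (fst q, snd q)) \<in> measurable (torus \<Otimes>\<^sub>M \<Theta>) (torus \<Otimes>\<^sub>M borel)"
    using id by (intro measurable_Pair measurable_fst measurable_compose[OF measurable_snd]) simp
  from measurable_compose[OF this diag_act_joint_measurable[OF h]]
  have joint: "case_prod ?g \<in> borel_measurable (torus \<Otimes>\<^sub>M \<Theta>)" by (simp add: case_prod_beta')
  have "(\<integral>\<^sup>+z. torus_average h z \<partial>\<Theta>) = (\<integral>\<^sup>+p. (\<integral>\<^sup>+z. ?g p z \<partial>\<Theta>) \<partial>torus)"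
    unfolding torus_average_def by (rule Fubini'[OF joint])
  also have "\<dots> = (\<integral>\<^sup>+p. (\<integral>\<^sup>+z. h z \<partial>\<Theta>) \<partial>torus)"
    by (rule nn_integral_cong_AE, use AE_torus in eventually_elim)
       (use nn_integral_diag_act borel_imp_\<Theta>[OF h] in blast)
  also have "\<dots> = (\<integral>\<^sup>+z. h z \<partial>\<Theta>)" using t.emeasure_space_1 by simp
  finally show ?thesis .
qed

text \<open>Apply the bound by torus averages three times along \<open>z' = D R D R D z\<close>, where \<open>z\<close> is any boundary point.
  The right-hand side is then a function of \<open>z\<close> with the same integral as \<open>h\<close>, so integrating over
  \<open>z\<close> gives the claim.\<close>

lemma submean_bound:
  assumes h: "submean \<rho> h" and \<rho>: "0 \<le> \<rho>" "\<rho> < 1" and z': "z' \<in> shilov_cartan_II"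
  shows "h (\<rho>^6 *\<^sub>R z') \<le> ennreal ((1 / (1 - \<rho>)^2)^6) * (\<integral>\<^sup>+z. h z \<partial>\<Theta>)"
proof -
  let ?C = "ennreal ((1 / (1 - \<rho>)^2)^2)"
  define h1 where "h1 = torus_average h"
  define h2 where "h2 = torus_average (\<lambda>z. h1 (had_act z))"
  define h3 where "h3 = torus_average (\<lambda>z. h2 (had_act z))"
  have s1: "submean \<rho> (\<lambda>z. h1 (had_act z))" and s2: "submean \<rho> (\<lambda>z. h2 (had_act z))"
    unfolding h2_def h1_def by (intro submean_had_act submean_torus_average h)+
  have m1: "h1 \<in> borel_measurable borel" and m2: "h2 \<in> borel_measurable borel" and m3: "h3 \<in> borel_measurable borel"
    unfolding h1_def h2_def h3_def
    using torus_average_measurable[OF submeanD(1)[OF h]] torus_average_measurable[OF submeanD(1)[OF s1]]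
      torus_average_measurable[OF submeanD(1)[OF s2]] by (simp_all add: h1_def h2_def)
  have int: "(\<integral>\<^sup>+z. h3 z \<partial>\<Theta>) = (\<integral>\<^sup>+z. h z \<partial>\<Theta>)"
  proof -
    have "(\<integral>\<^sup>+z. h3 z \<partial>\<Theta>) = (\<integral>\<^sup>+z. h2 (had_act z) \<partial>\<Theta>)"
      unfolding h3_def by (rule nn_integral_torus_average[OF submeanD(1)[OF s2]])
    also have "\<dots> = (\<integral>\<^sup>+z. h2 z \<partial>\<Theta>)" by (rule nn_integral_had_act[OF borel_imp_\<Theta>[OF m2]])
    also have "\<dots> = (\<integral>\<^sup>+z. h1 (had_act z) \<partial>\<Theta>)"
      unfolding h2_def by (rule nn_integral_torus_average[OF submeanD(1)[OF s1]])
    also have "\<dots> = (\<integral>\<^sup>+z. h1 z \<partial>\<Theta>)" by (rule nn_integral_had_act[OF borel_imp_\<Theta>[OF m1]])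
    also have "\<dots> = (\<integral>\<^sup>+z. h z \<partial>\<Theta>)"
      unfolding h1_def by (rule nn_integral_torus_average[OF submeanD(1)[OF h]])
    finally show ?thesis .
  qed
  have r2: "0 \<le> \<rho>^2" "\<rho>^2 \<le> 1" using \<rho> by (auto simp: power_le_one)
  note cs = contr_shrink[OF _ r2]
  have pt: "h (\<rho>^6 *\<^sub>R z') \<le> ?C * (?C * (?C * h3 z))" if z: "z \<in> shilov_cartan_II" for z
  proof -
    obtain a b c d e f where u: "cmod a = 1" "cmod b = 1" "cmod c = 1" "cmod d = 1" "cmod e = 1" "cmod f = 1"
      and z'eq: "z' = diag_act a b (had_act (diag_act c d (had_act (diag_act e f z))))"
      using shilov_transitive[OF z z'] by blast
    let ?X = "had_act (\<rho>^2 *\<^sub>R diag_act e f z)"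
    let ?Y = "had_act (\<rho>^2 *\<^sub>R diag_act c d ?X)"
    have cz: "contr 1 z" by (rule contr_shilov[OF z])
    have cX: "contr 1 ?X" by (intro contr_had_act cs contr_diag_act cz) (use u in auto)
    have cY: "contr 1 ?Y" by (intro contr_had_act cs contr_diag_act cX) (use u in auto)
    have "\<rho>^6 *\<^sub>R z' = \<rho>^2 *\<^sub>R diag_act a b ?Y"
      unfolding z'eq diag_act_scaleR had_act_scaleR scaleR_scaleR by (simp add: power_add[symmetric])
    also have "h (\<rho>^2 *\<^sub>R diag_act a b ?Y) \<le> ?C * h1 ?Y"
      unfolding h1_def by (rule torus_average_bound[OF h \<rho> cY u(1,2)])
    also have "h1 ?Y \<le> ?C * h2 ?X"
      unfolding h2_def by (rule torus_average_bound[OF s1 \<rho> cX u(3,4)])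
    also have "h2 ?X \<le> ?C * h3 z"
      unfolding h3_def by (rule torus_average_bound[OF s2 \<rho> cz u(5,6)])
    finally show ?thesis by (simp add: mult_left_mono)
  qed
  have "h (\<rho>^6 *\<^sub>R z') = (\<integral>\<^sup>+z. h (\<rho>^6 *\<^sub>R z') \<partial>\<Theta>)" using emeasure_space_1 by simp
  also have "\<dots> \<le> (\<integral>\<^sup>+z. ?C * (?C * (?C * h3 z)) \<partial>\<Theta>)"
    by (rule nn_integral_mono) (simp add: space_\<Theta> pt)
  also have "\<dots> = ?C * (?C * (?C * (\<integral>\<^sup>+z. h3 z \<partial>\<Theta>)))"
    using borel_imp_\<Theta>[OF m3] by (simp add: nn_integral_cmult)
  also have "\<dots> = ennreal ((1 / (1 - \<rho>)^2)^6) * (\<integral>\<^sup>+z. h z \<partial>\<Theta>)"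
    unfolding int by (simp add: mult.assoc[symmetric] ennreal_mult'[symmetric] power_add[symmetric])
  finally show ?thesis .
qed

end

text \<open>The \<open>r\<close>-dilate of \<open>J (f \<circ> \<phi>)\<close>.  The function \<open>pull_sq\<close> is its squared modulus, cut off outside the
  closed Cartan domain so that it is Borel measurable on the whole space.\<close>

definition pull :: "(complex^3 \<Rightarrow> complex) \<Rightarrow> real \<Rightarrow> complex^3 \<Rightarrow> complex" where
  "pull f r z = tetra_jac (r *\<^sub>R z) * f (tetra_map (r *\<^sub>R z))"

definition pull_sq :: "(complex^3 \<Rightarrow> complex) \<Rightarrow> real \<Rightarrow> complex^3 \<Rightarrow> ennreal" where
  "pull_sq f r z = (if contr 1 z then ennreal ((cmod (pull f r z))^2) else 0)"

lemma pull_scaleR: "pull f r (q *\<^sub>R z) = pull f (r * q) z"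
  by (simp add: pull_def)

lemma pull_eq: "pull f r z = - 2 * of_real r * z$3 * f (dil r (tetra_map z))"
  unfolding pull_def tetra_jac_eq scaleR_complex_nth tetra_map_scaleR by (simp add: mult_ac)

lemma tetra_map_scaled:
  assumes "contr 1 z" "0 \<le> r" "r < 1" shows "tetra_map (r *\<^sub>R z) \<in> tetrablock"
  using contr_scaleR[OF assms(1), of r] assms(2,3) by (intro tetra_map_contr[of r]) auto

lemma pull_disc:
  assumes f: "holomorphic_fun_on f tetrablock" and r: "0 \<le> r" "r < 1" and \<gamma>: "entire_disc \<gamma>" and s: "cmod s \<le> 1"
  shows "(\<lambda>s. pull f r (\<gamma> s)) field_differentiable (at s)"
proof -
  have "(\<lambda>s. f (tetra_map (r *\<^sub>R \<gamma> s))) field_differentiable (at s)"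
  proof (rule holomorphic_fun_on_curve[OF f])
    show "tetra_map (r *\<^sub>R \<gamma> s) \<in> tetrablock" by (rule tetra_map_scaled[OF entire_discD(2)[OF \<gamma> s] r])
    fix i :: 3
    have "i = 1 \<or> i = 2 \<or> i = 3" using exhaust_3 by blast
    then show "(\<lambda>s. tetra_map (r *\<^sub>R \<gamma> s) $ i) field_differentiable (at s)"
      by (elim disjE; simp only: tetra_map_nth scaleR_complex_nth; intro derivative_intros entire_discD(1)[OF \<gamma>])
  qed
  then show ?thesis unfolding pull_def tetra_jac_eq scaleR_complex_nth
    by (intro derivative_intros entire_discD(1)[OF \<gamma>])
qed

lemma continuous_pull:
  assumes f: "holomorphic_fun_on f tetrablock" and r: "0 \<le> r" "r < 1"
  shows "continuous_on {z. contr 1 z} (pull f r)"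
proof -
  have "continuous_on {z. contr 1 z} (\<lambda>z. f (tetra_map (r *\<^sub>R z)))"
  proof (rule continuous_on_compose2[OF holomorphic_fun_on_continuous[OF f]])
    show "continuous_on {z. contr 1 z} (\<lambda>z. tetra_map (r *\<^sub>R z))"
      by (intro continuous_on_compose2[OF continuous_on_tetra_map[of UNIV]] continuous_intros) auto
  qed (auto intro: tetra_map_scaled r)
  then show ?thesis unfolding pull_def tetra_jac_eq scaleR_complex_nth by (intro continuous_intros)
qed

lemma closed_contr: "closed {z. contr 1 z}"
  unfolding contr_def by (intro closed_Collect_all closed_Collect_le continuous_intros)

lemma pull_sq_measurable:
  assumes f: "holomorphic_fun_on f tetrablock" and r: "0 \<le> r" "r < 1"
  shows "pull_sq f r \<in> borel_measurable borel"
proof -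
  have "(\<lambda>z. if z \<in> {z. contr 1 z} then (cmod (pull f r z))^2 else 0) \<in> borel_measurable borel"
    by (intro borel_measurable_continuous_on_if borel_closed closed_contr continuous_intros continuous_pull f r)
  then have "(\<lambda>z. ennreal (if z \<in> {z. contr 1 z} then (cmod (pull f r z))^2 else 0)) \<in> borel_measurable borel"
    by measurable
  moreover have "pull_sq f r = (\<lambda>z. ennreal (if z \<in> {z. contr 1 z} then (cmod (pull f r z))^2 else 0))"
    by (auto simp: pull_sq_def fun_eq_iff)
  ultimately show ?thesis by simp
qed

lemma pull_poisson:
  assumes f: "holomorphic_fun_on f tetrablock" and r: "0 \<le> r" "r < 1" and \<gamma>: "entire_disc \<gamma>" and a: "cmod a < 1"
  shows "pull_sq f r (\<gamma> a) \<le> (\<integral>\<^sup>+s. ennreal (poisson a s) * pull_sq f r (\<gamma> s) \<partial>circ)"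
proof -
  have hol: "(\<lambda>s. pull f r (\<gamma> s)) holomorphic_on cball 0 1"
    unfolding holomorphic_on_def
  proof
    fix s :: complex assume "s \<in> cball 0 1"
    then have "(\<lambda>s. pull f r (\<gamma> s)) field_differentiable (at s)" by (intro pull_disc[OF f r \<gamma>]) simp
    then show "(\<lambda>s. pull f r (\<gamma> s)) field_differentiable (at s within cball 0 1)" by (rule field_differentiable_at_within)
  qed
  have "ennreal ((cmod (pull f r (\<gamma> a)))^2) \<le> (\<integral>\<^sup>+s. ennreal (poisson a s) * pull_sq f r (\<gamma> s) \<partial>circ)"
  proof (rule poisson_submean[OF _ _ a])
    show "continuous_on (cball 0 1) (\<lambda>s. pull f r (\<gamma> s))" by (rule holomorphic_on_imp_continuous_on[OF hol])
    show "(\<lambda>s. pull f r (\<gamma> s)) holomorphic_on ball 0 1" by (rule holomorphic_on_subset[OF hol]) auto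
    show "(\<lambda>s. pull_sq f r (\<gamma> s)) \<in> borel_measurable borel"
      by (rule measurable_compose[OF entire_disc_measurable[OF \<gamma>] pull_sq_measurable[OF f r]])
  qed (use entire_discD(2)[OF \<gamma>] in \<open>simp add: pull_sq_def\<close>)
  then show ?thesis using entire_discD(2)[OF \<gamma>, of a] a by (simp add: pull_sq_def)
qed

lemma submean_pull_sq:
  assumes f: "holomorphic_fun_on f tetrablock" and r: "0 \<le> r" "r < 1" and \<rho>: "\<rho> < 1"
  shows "submean \<rho> (pull_sq f r)"
  unfolding submean_def
proof (intro conjI allI impI)
  show "pull_sq f r \<in> borel_measurable borel" by (rule pull_sq_measurable[OF f r])
  fix \<gamma> a assume \<gamma>: "entire_disc \<gamma>" and a: "cmod a \<le> \<rho>"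
  have m: "(\<lambda>s. pull_sq f r (\<gamma> s)) \<in> borel_measurable circ"
    using measurable_compose[OF entire_disc_measurable[OF \<gamma>] pull_sq_measurable[OF f r]] by simp
  have "pull_sq f r (\<gamma> a) \<le> (\<integral>\<^sup>+s. ennreal (poisson a s) * pull_sq f r (\<gamma> s) \<partial>circ)"
    by (rule pull_poisson[OF f r \<gamma>]) (use a \<rho> in simp)
  also have "\<dots> \<le> (\<integral>\<^sup>+s. ennreal (1 / (1 - \<rho>)^2) * pull_sq f r (\<gamma> s) \<partial>circ)"
    by (rule nn_integral_mono_AE, use AE_circ in eventually_elim)
       (intro mult_right_mono ennreal_leI poisson_le a \<rho>; simp)
  also have "\<dots> = ennreal (1 / (1 - \<rho>)^2) * (\<integral>\<^sup>+s. pull_sq f r (\<gamma> s) \<partial>circ)"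
    by (rule nn_integral_cmult[OF m])
  finally show "pull_sq f r (\<gamma> a) \<le> ennreal (1 / (1 - \<rho>)^2) * (\<integral>\<^sup>+s. pull_sq f r (\<gamma> s) \<partial>circ)" .
qed

context boundary_measure
begin

lemma pull_L2:
  assumes f: "holomorphic_fun_on f tetrablock" and r: "0 \<le> r" "r < 1"
  shows "pull f r \<in> L2 \<Theta>"
  by (rule continuous_L2_\<Theta>) (rule continuous_on_subset[OF continuous_pull[OF f r]], auto intro: contr_shilov)

lemma nn_integral_pull_sq:
  assumes f: "holomorphic_fun_on f tetrablock" and r: "0 \<le> r" "r < 1"
  shows "(\<integral>\<^sup>+z. pull_sq f r z \<partial>\<Theta>) = ennreal ((L2_norm \<Theta> (pull f r))^2)"
  unfolding L2_nn_integral[OF pull_L2[OF assms], symmetric]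
  by (rule nn_integral_cong) (simp add: pull_sq_def space_\<Theta> contr_shilov)

text \<open>Poisson's formula on the discs \<open>s \<mapsto> s z\<close>, integrated over \<open>z\<close>: by circle invariance the inner
  integral does not depend on \<open>s\<close>, and the Poisson kernel has total mass one.\<close>

lemma nn_integral_pull_sq_scaled:
  assumes f: "holomorphic_fun_on f tetrablock" and r: "0 \<le> r" "r < 1" and q: "0 \<le> q" "q < 1"
  shows "(\<integral>\<^sup>+z. pull_sq f r (q *\<^sub>R z) \<partial>\<Theta>) \<le> (\<integral>\<^sup>+z. pull_sq f r z \<partial>\<Theta>)"
proof -
  interpret c: prob_space circ by (rule prob_space_circ)
  interpret pair_sigma_finite circ \<Theta> by unfold_locales
  note hm = pull_sq_measurable[OF f r]
  let ?P = "\<lambda>s. ennreal (poisson (of_real q) s)"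
  have id: "(\<lambda>z. z) \<in> borel_measurable \<Theta>" by (rule borel_imp_\<Theta>) simp
  have "continuous_on UNIV (\<lambda>p. fst p *s (snd p :: complex^3))"
    by (rule continuous_on_vec_components) (simp, intro continuous_intros)
  then have "(\<lambda>p. fst p *s (snd p :: complex^3)) \<in> borel_measurable borel"
    by (rule borel_measurable_continuous_onI)
  then have m1: "(\<lambda>p. fst p *s (snd p :: complex^3)) \<in> borel_measurable (borel \<Otimes>\<^sub>M borel)"
    by (simp add: borel_prod)
  have "(\<lambda>q. (fst q, snd q)) \<in> measurable (circ \<Otimes>\<^sub>M \<Theta>) (borel \<Otimes>\<^sub>M borel)"
    using id by (intro measurable_Pair measurable_compose[OF measurable_fst] measurable_compose[OF measurable_snd]) simp_all
  from measurable_compose[OF measurable_compose[OF this m1] hm]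
  have "(\<lambda>p. pull_sq f r (fst p *s snd p)) \<in> borel_measurable (circ \<Otimes>\<^sub>M \<Theta>)" by simp
  then have joint: "case_prod (\<lambda>s z. ?P s * pull_sq f r (s *s z)) \<in> borel_measurable (circ \<Otimes>\<^sub>M \<Theta>)"
    unfolding case_prod_beta' by (intro borel_measurable_times_ennreal measurable_compose[OF measurable_fst]) simp_all
  have "(\<integral>\<^sup>+z. pull_sq f r (q *\<^sub>R z) \<partial>\<Theta>) \<le> (\<integral>\<^sup>+z. (\<integral>\<^sup>+s. ?P s * pull_sq f r (s *s z) \<partial>circ) \<partial>\<Theta>)"
  proof (rule nn_integral_mono)
    fix z assume "z \<in> space \<Theta>"
    then have "entire_disc (\<lambda>s. s *s z)" using entire_disc_orbits(3)[of z 1] contr_shilov by (simp add: space_\<Theta>)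
    moreover have "q *\<^sub>R z = of_real q *s z" unfolding vec_eq_iff scaleR_complex_nth by simp
    ultimately show "pull_sq f r (q *\<^sub>R z) \<le> (\<integral>\<^sup>+s. ?P s * pull_sq f r (s *s z) \<partial>circ)"
      using pull_poisson[OF f r, of "\<lambda>s. s *s z" "of_real q"] q by simp
  qed
  also have "\<dots> = (\<integral>\<^sup>+s. (\<integral>\<^sup>+z. ?P s * pull_sq f r (s *s z) \<partial>\<Theta>) \<partial>circ)"
    by (rule Fubini'[OF joint])
  also have "\<dots> = (\<integral>\<^sup>+s. ?P s * (\<integral>\<^sup>+z. pull_sq f r z \<partial>\<Theta>) \<partial>circ)"
  proof (rule nn_integral_cong_AE, use AE_circ in eventually_elim)
    fix s :: complex assume s: "cmod s = 1"
    obtain a where a: "cmod a = 1" "a^2 = s" using unimodular_square_root[OF s] .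
    have e: "s *s z = diag_act a a z" for z by (simp add: vec_eq_iff forall_3 a(2)[symmetric] power2_eq_square)
    have "(\<integral>\<^sup>+z. ?P s * pull_sq f r (s *s z) \<partial>\<Theta>) = ?P s * (\<integral>\<^sup>+z. pull_sq f r (diag_act a a z) \<partial>\<Theta>)"
      unfolding e by (intro nn_integral_cmult borel_imp_\<Theta> measurable_compose[OF borel_measurable_continuous_onI[OF continuous_diag_act] hm])
    then show "(\<integral>\<^sup>+z. ?P s * pull_sq f r (s *s z) \<partial>\<Theta>) = ?P s * (\<integral>\<^sup>+z. pull_sq f r z \<partial>\<Theta>)"
      using nn_integral_diag_act[OF a(1,1) borel_imp_\<Theta>[OF hm]] by simp
  qed
  also have "\<dots> = (\<integral>\<^sup>+s. ?P s \<partial>circ) * (\<integral>\<^sup>+z. pull_sq f r z \<partial>\<Theta>)"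
    by (rule nn_integral_multc) simp
  also have "\<dots> = (\<integral>\<^sup>+z. pull_sq f r z \<partial>\<Theta>)" using poisson_total[of "of_real q"] q by simp
  finally show ?thesis .
qed

lemma pull_norm_mono:
  assumes f: "holomorphic_fun_on f tetrablock" and r: "0 \<le> r" "r \<le> r'" "r' < 1"
  shows "L2_norm \<Theta> (pull f r) \<le> L2_norm \<Theta> (pull f r')"
proof (cases "r = r'")
  case False
  then have r': "0 < r'" "r < r'" using r by auto
  define q where "q = r / r'"
  have q: "0 \<le> q" "q < 1" "r' * q = r" using r r' by (auto simp: q_def)
  have "(\<integral>\<^sup>+z. pull_sq f r z \<partial>\<Theta>) = (\<integral>\<^sup>+z. pull_sq f r' (q *\<^sub>R z) \<partial>\<Theta>)"
  proof (rule nn_integral_cong)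
    fix z assume "z \<in> space \<Theta>"
    then have c: "contr 1 z" by (simp add: space_\<Theta> contr_shilov)
    have "contr 1 (q *\<^sub>R z)" using contr_shrink[OF c] q by simp
    then show "pull_sq f r z = pull_sq f r' (q *\<^sub>R z)" using c by (simp add: pull_sq_def pull_scaleR q)
  qed
  also have "\<dots> \<le> (\<integral>\<^sup>+z. pull_sq f r' z \<partial>\<Theta>)" 
    by (rule nn_integral_pull_sq_scaled[OF f _ r(3) q(1,2)]) (use r' in simp)
  finally have "(L2_norm \<Theta> (pull f r))^2 \<le> (L2_norm \<Theta> (pull f r'))^2"
    unfolding nn_integral_pull_sq[OF f r(1) less_trans[OF r'(2) r(3)]]
      nn_integral_pull_sq[OF f less_imp_le[OF r'(1)] r(3)] ennreal_le_iff[OF zero_le_power2] .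
  then show ?thesis by (rule power2_le_imp_le) simp
qed simp

definition boundary_of :: "(complex^3 \<Rightarrow> complex) \<Rightarrow> (complex^3 \<Rightarrow> complex) \<Rightarrow> bool" where
  "boundary_of f G \<longleftrightarrow> holomorphic_fun_on f tetrablock \<and>
     radial_limit \<Theta> (\<lambda>z. tetra_jac z * f (tetra_map z)) G"

lemma boundary_ofD:
  assumes "boundary_of f G"
  shows "holomorphic_fun_on f tetrablock" "G \<in> L2 \<Theta>"
    "((\<lambda>r. L2_norm \<Theta> (\<lambda>z. pull f r z - G z)) \<longlongrightarrow> 0) (at_left 1)"
  using assms by (auto simp: boundary_of_def radial_limit_def pull_def)

lemma eventually_at_left_1: "\<forall>\<^sub>F r in at_left (1::real). a < r \<and> r < 1" if "a < 1"
  using that by (auto simp: eventually_at_left)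

lemma pull_norm_le_boundary:
  assumes b: "boundary_of f G" and r: "0 \<le> r" "r < 1"
  shows "L2_norm \<Theta> (pull f r) \<le> L2_norm \<Theta> G"
proof -
  note f = boundary_ofD(1)[OF b] and G = boundary_ofD(2)[OF b]
  have "((\<lambda>r. L2_norm \<Theta> G + L2_norm \<Theta> (\<lambda>z. pull f r z - G z)) \<longlongrightarrow> L2_norm \<Theta> G + 0) (at_left 1)"
    by (intro tendsto_intros boundary_ofD(3)[OF b])
  moreover have "\<forall>\<^sub>F r' in at_left 1. L2_norm \<Theta> (pull f r) \<le> L2_norm \<Theta> G + L2_norm \<Theta> (\<lambda>z. pull f r' z - G z)"
    using eventually_at_left_1[OF r(2)]
  proof eventually_elim
    fix r' :: real assume r': "r < r' \<and> r' < 1"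
    then have "L2_norm \<Theta> (pull f r) \<le> L2_norm \<Theta> (pull f r')" using r by (intro pull_norm_mono f) auto
    also have "\<dots> \<le> L2_norm \<Theta> G + L2_norm \<Theta> (\<lambda>z. pull f r' z - G z)"
      using L2_norm_diff_bound[OF pull_L2[OF f, of r'] G] r r' by simp
    finally show "L2_norm \<Theta> (pull f r) \<le> L2_norm \<Theta> G + L2_norm \<Theta> (\<lambda>z. pull f r' z - G z)" .
  qed
  ultimately show ?thesis using tendsto_lowerbound[of _ _ "at_left (1::real)"] by fastforce
qed

text \<open>The dilation \<open>r\<close> is split as \<open>\<rho>\<^sup>6 \<rho>\<^sup>6\<close>: one factor makes \<open>J (f \<circ> \<phi>)\<close> holomorphic
  beyond the closed domain, the other is the gain needed for the averaging bound.\<close>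

lemma pull_pointwise_bound:
  assumes r: "0 < r" "r < 1"
  obtains A where "A \<ge> 0" "\<And>f G z. boundary_of f G \<Longrightarrow> z \<in> shilov_cartan_II \<Longrightarrow> cmod (pull f r z) \<le> A * L2_norm \<Theta> G"
proof -
  define \<rho> where "\<rho> = root 12 r"
  have \<rho>: "0 \<le> \<rho>" "\<rho> < 1" using r by (simp_all add: \<rho>_def)
  have r12: "\<rho>^6 * \<rho>^6 = r" using r real_root_pow_pos2[of 12 r] by (simp add: \<rho>_def power_add[symmetric])
  have s: "0 \<le> \<rho>^6" "\<rho>^6 < 1" using \<rho> by (auto simp: power_less_one_iff)
  define A where "A = (1 / (1 - \<rho>)^2)^3"
  have A0: "A \<ge> 0" by (simp add: A_def)
  have "cmod (pull f r z) \<le> A * L2_norm \<Theta> G" if b: "boundary_of f G" and z: "z \<in> shilov_cartan_II" for f G z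
  proof -
    note f = boundary_ofD(1)[OF b]
    have c: "contr 1 (\<rho>^6 *\<^sub>R z)" using contr_shrink[OF contr_shilov[OF z]] s by simp
    have "ennreal ((cmod (pull f r z))^2) = pull_sq f (\<rho>^6) (\<rho>^6 *\<^sub>R z)"
      using c by (simp only: pull_sq_def pull_scaleR r12 if_True)
    also have "\<dots> \<le> ennreal ((1 / (1 - \<rho>)^2)^6) * ennreal ((L2_norm \<Theta> (pull f (\<rho>^6)))^2)"
      using submean_bound[OF submean_pull_sq[OF f s \<rho>(2)] \<rho> z] by (simp add: nn_integral_pull_sq[OF f s])
    also have "\<dots> = ennreal ((A * L2_norm \<Theta> (pull f (\<rho>^6)))^2)"
      by (simp add: ennreal_mult'[symmetric] A_def power_mult_distrib power_mult[symmetric])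
    finally have "(cmod (pull f r z))^2 \<le> (A * L2_norm \<Theta> (pull f (\<rho>^6)))^2"
      unfolding ennreal_le_iff[OF zero_le_power2] .
    then have "cmod (pull f r z) \<le> A * L2_norm \<Theta> (pull f (\<rho>^6))" by (rule power2_le_imp_le) (simp add: A0)
    also have "\<dots> \<le> A * L2_norm \<Theta> G" by (intro mult_left_mono pull_norm_le_boundary b s A0)
    finally show ?thesis .
  qed
  then show ?thesis using that A0 by blast
qed

text \<open>Maximum principle on the disc.  On its boundary \<open>|z\<^sub>3|\<^sup>2 \<ge> 1 - \<rho>\<^sup>2\<close>, so the factor
  \<open>-2 r z\<^sub>3\<close> contributed by \<open>J\<close> can be divided out.\<close>

lemma evaluation_bound:
  assumes r: "0 < r" "r < 1" and \<rho>: "0 \<le> \<rho>" "\<rho> < 1"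
  obtains A where "A \<ge> 0" "\<And>f G a b s. boundary_of f G \<Longrightarrow> cmod a + cmod b \<le> \<rho> \<Longrightarrow> cmod s \<le> 1 \<Longrightarrow>
     cmod (f (dil r (disc a b s))) \<le> A * L2_norm \<Theta> G"
proof -
  obtain A where A: "A \<ge> 0" "\<And>f G z. boundary_of f G \<Longrightarrow> z \<in> shilov_cartan_II \<Longrightarrow> cmod (pull f r z) \<le> A * L2_norm \<Theta> G"
    using pull_pointwise_bound[OF r] by blast
  define \<kappa> where "\<kappa> = sqrt (1 - \<rho>^2)"
  have "\<rho>^2 < 1" using \<rho> by (simp add: power_less_one_iff)
  then have \<kappa>: "\<kappa> > 0" "\<kappa>^2 = 1 - \<rho>^2" by (simp_all add: \<kappa>_def)
  define B where "B = A / (2 * r * \<kappa>)"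
  have B0: "B \<ge> 0" using A(1) r \<kappa> by (simp add: B_def)
  have "cmod (f (dil r (disc a b s))) \<le> B * L2_norm \<Theta> G"
    if bd: "boundary_of f G" and ab: "cmod a + cmod b \<le> \<rho>" and s: "cmod s \<le> 1" for f G a b s
  proof -
    note f = boundary_ofD(1)[OF bd]
    have ab1: "cmod a + cmod b < 1" using ab \<rho> by simp
    define g where "g = (\<lambda>s. f (dil r (disc a b s)))"
    have fd: "g field_differentiable (at s)" if s: "cmod s \<le> 1" for s
      unfolding g_def
    proof (rule holomorphic_fun_on_curve[OF f])
      show "dil r (disc a b s) \<in> tetrablock" using dil_disc_in_tetrablock[OF ab1 s] r by simp
      fix i :: 3
      have "i = 1 \<or> i = 2 \<or> i = 3" using exhaust_3 by blast
      then show "(\<lambda>s. dil r (disc a b s) $ i) field_differentiable (at s)"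
        by (elim disjE; simp only: dil_nth disc_nth; intro derivative_intros)
    qed
    have hol: "g holomorphic_on cball 0 1"
      unfolding holomorphic_on_def
    proof
      fix s :: complex assume "s \<in> cball 0 1"
      then have "g field_differentiable (at s)" by (intro fd) simp
      then show "g field_differentiable (at s within cball 0 1)" by (rule field_differentiable_at_within)
    qed
    have "cmod (g s) \<le> B * L2_norm \<Theta> G"
    proof (rule maximum_modulus_frontier[of g "cball 0 1"])
      show "g holomorphic_on interior (cball 0 1)" by (rule holomorphic_on_subset[OF hol]) (rule interior_subset)
      show "continuous_on (closure (cball 0 1)) g" using holomorphic_on_imp_continuous_on[OF hol] by simp
      show "cmod (g t) \<le> B * L2_norm \<Theta> G" if "t \<in> frontier (cball 0 1)" for t
      proof -
        have t: "cmod t = 1" using that by simp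
        obtain z where z: "z \<in> shilov_cartan_II" "tetra_map z = disc a b t" "1 - \<rho>^2 \<le> (cmod (z$3))^2"
          using disc_boundary[OF ab \<rho>(2) t] .
        have "\<kappa> \<le> cmod (z$3)" using z(3) \<kappa> by (auto intro: power2_le_imp_le[of \<kappa> "cmod (z$3)"])
        then have "2 * r * \<kappa> * cmod (g t) \<le> 2 * r * cmod (z$3) * cmod (g t)"
          using r by (intro mult_right_mono mult_left_mono) auto
        also have "\<dots> = cmod (pull f r z)"
          unfolding pull_eq z(2) g_def using r by (simp add: norm_mult)
        also have "\<dots> \<le> A * L2_norm \<Theta> G" by (rule A(2)[OF bd z(1)])
        finally show ?thesis unfolding B_def using r \<kappa> by (simp add: field_simps)
      qed
    qed (use s in auto)
    then show ?thesis by (simp add: g_def)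
  qed
  then show ?thesis using that B0 by blast
qed

end

section \<open>Limits of holomorphic functions of several variables\<close>

lemma holomorphic_fun_on_lin:
  assumes "holomorphic_fun_on f U" "holomorphic_fun_on g U"
  shows "holomorphic_fun_on (\<lambda>z. a * f z + b * g z) U"
  unfolding holomorphic_fun_on_def
proof
  fix z assume z: "z \<in> U"
  obtain D where D: "(f has_derivative D) (at z)" "\<forall>c v. D (c *s v) = c * D v"
    using assms(1) z unfolding holomorphic_fun_on_def by blast
  obtain E where E: "(g has_derivative E) (at z)" "\<forall>c v. E (c *s v) = c * E v"
    using assms(2) z unfolding holomorphic_fun_on_def by blast
  have "((\<lambda>z. a * f z + b * g z) has_derivative (\<lambda>h. a * D h + b * E h)) (at z)"
    by (intro derivative_intros D E)
  moreover have "\<forall>c v. a * D (c *s v) + b * E (c *s v) = c * (a * D v + b * E v)"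
    using D(2) E(2) by (simp add: algebra_simps)
  ultimately show "\<exists>D. ((\<lambda>z. a * f z + b * g z) has_derivative D) (at z) \<and> (\<forall>c v. D (c *s v) = c * D v)" by blast
qed

lemma holomorphic_fun_on_coord:
  assumes "holomorphic_fun_on f U" shows "holomorphic_fun_on (\<lambda>z. z$i * f z) U"
  unfolding holomorphic_fun_on_def
proof
  fix z assume z: "z \<in> U"
  obtain D where D: "(f has_derivative D) (at z)" "\<forall>c v. D (c *s v) = c * D v"
    using assms(1) z unfolding holomorphic_fun_on_def by blast
  have "((\<lambda>z. z$i * f z) has_derivative (\<lambda>h. z$i * D h + h$i * f z)) (at z)"
    by (rule has_derivative_mult[OF bounded_linear_imp_has_derivative[OF bounded_linear_vec_nth] D(1)])
  moreover have "\<forall>c v. z$i * D (c *s v) + (c *s v)$i * f z = c * (z$i * D v + v$i * f z)"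
    using D(2) by (simp add: algebra_simps)
  ultimately show "\<exists>D. ((\<lambda>z. z$i * f z) has_derivative D) (at z) \<and> (\<forall>c v. D (c *s v) = c * D v)" by blast
qed

lemma holomorphic_fun_on_const: "holomorphic_fun_on (\<lambda>z. c) U"
  unfolding holomorphic_fun_on_def by (intro ballI exI[of _ "\<lambda>_. 0"]) auto

lemma norm_scalar_mult: "norm (c *s (v :: complex^'n)) = cmod c * norm v"
  by (simp add: norm_vec_def norm_mult L2_set_right_distrib)

text \<open>Cauchy's inequality on the complex line through \<open>z\<close> in direction \<open>v\<close>, on the circle that
  moves \<open>z\<close> by \<open>\<epsilon> / 4\<close>.\<close>

lemma directional_Cauchy_estimate:
  fixes f :: "complex^'n \<Rightarrow> complex"
  assumes f: "holomorphic_fun_on f (ball w \<epsilon>)" and B: "\<And>z. z \<in> ball w \<epsilon> \<Longrightarrow> cmod (f z) \<le> B"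
    and z: "z \<in> ball w (\<epsilon> / 2)" and D: "(f has_derivative D) (at z)" "\<And>c v. D (c *s v) = c * D v"
  shows "cmod (D v) \<le> 4 / \<epsilon> * B * norm v"
proof (cases "v = 0")
  case True
  then show ?thesis using D(2)[of 0 v] by simp
next
  case False
  have \<epsilon>: "\<epsilon> > 0" using z by (metis ball_eq_empty empty_iff half_gt_zero_iff not_le)
  define r where "r = \<epsilon> / (4 * norm v)"
  have r: "r > 0" using False \<epsilon> by (simp add: r_def)
  define g where "g = (\<lambda>s. z + s *s v)"
  have nv: "norm (c *s v) \<le> \<epsilon> / 4" if "cmod c \<le> r" for c
  proof -
    have "norm (c *s v) \<le> r * norm v" unfolding norm_scalar_mult using that by (intro mult_right_mono) auto
    then show ?thesis using False by (simp add: r_def)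
  qed
  have gb: "g c \<in> ball w \<epsilon>" if "cmod c \<le> r" for c
  proof -
    have "dist w (g c) \<le> dist w z + norm (c *s v)"
      using norm_triangle_ineq4[of "w - z" "c *s v"] by (simp add: g_def dist_norm algebra_simps)
    also have "\<dots> < \<epsilon> / 2 + \<epsilon> / 2" using z nv[OF that] \<epsilon> by simp
    finally show ?thesis by simp
  qed
  have fd: "(\<lambda>s. f (g s)) field_differentiable (at s)" if s: "cmod s \<le> r" for s
  proof (rule holomorphic_fun_on_curve[OF f])
    show "g s \<in> ball w \<epsilon>" by (rule gb[OF s])
  qed (auto simp: g_def intro!: derivative_intros)
  have hol: "(\<lambda>s. f (g s)) holomorphic_on cball 0 r"
    unfolding holomorphic_on_def
  proof
    fix s :: complex assume "s \<in> cball 0 r"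
    then have "(\<lambda>s. f (g s)) field_differentiable (at s)" by (intro fd) simp
    then show "(\<lambda>s. f (g s)) field_differentiable (at s within cball 0 r)" by (rule field_differentiable_at_within)
  qed
  have "norm ((deriv ^^ 1) (\<lambda>s. f (g s)) 0) \<le> fact 1 * B / r^1"
  proof (rule Cauchy_inequality)
    show "(\<lambda>s. f (g s)) holomorphic_on ball 0 r" by (rule holomorphic_on_subset[OF hol]) auto
    show "continuous_on (cball 0 r) (\<lambda>s. f (g s))" by (rule holomorphic_on_imp_continuous_on[OF hol])
  qed (use r B gb in auto)
  moreover have "deriv (\<lambda>s. f (g s)) 0 = D v"
  proof (rule DERIV_imp_deriv)
    have gd: "(g has_derivative (\<lambda>h. h *s v)) (at 0)"
    proof (rule has_derivative_vec_components)
      fix i show "((\<lambda>s. g s $ i) has_derivative (\<lambda>h. (h *s v) $ i)) (at 0)"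
        by (auto simp: g_def intro!: derivative_eq_intros)
    qed
    have "g 0 = z" by (simp add: g_def vec_eq_iff)
    then have "((\<lambda>s. f (g s)) has_derivative (\<lambda>h. D (h *s v))) (at 0)"
      using has_derivative_compose[OF gd] D(1) by simp
    then show "((\<lambda>s. f (g s)) has_field_derivative D v) (at 0)"
      unfolding has_field_derivative_def
      by (rule has_derivative_eq_rhs) (auto simp: fun_eq_iff D(2) mult.commute)
  qed
  ultimately have "cmod (D v) \<le> B / r" by simp
  also have "\<dots> = 4 / \<epsilon> * B * norm v" using False \<epsilon> by (simp add: r_def)
  finally show ?thesis .
qed

text \<open>The directional Cauchy estimate makes the derivatives uniformly Cauchy on the smaller ball, and
  the limit of complex-linear derivatives is complex-linear.\<close>

lemma holomorphic_local_limit: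
  fixes f :: "nat \<Rightarrow> complex^'n \<Rightarrow> complex"
  assumes f: "\<And>n. holomorphic_fun_on (f n) (ball w \<epsilon>)" and \<epsilon>: "\<epsilon> > 0"
    and cau: "\<And>e. e > 0 \<Longrightarrow> \<exists>N. \<forall>m\<ge>N. \<forall>n\<ge>N. \<forall>z\<in>ball w \<epsilon>. cmod (f m z - f n z) \<le> e"
  obtains g where "holomorphic_fun_on g (ball w (\<epsilon> / 2))" "\<And>z. z \<in> ball w (\<epsilon> / 2) \<Longrightarrow> (\<lambda>n. f n z) \<longlonglongrightarrow> g z"
proof -
  let ?S = "ball w (\<epsilon> / 2)"
  have "\<forall>n z. \<exists>D. z \<in> ball w \<epsilon> \<longrightarrow> (f n has_derivative D) (at z) \<and> (\<forall>c v. D (c *s v) = c * D v)"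
    using f unfolding holomorphic_fun_on_def by blast
  then obtain D where D': "\<And>n z. z \<in> ball w \<epsilon> \<longrightarrow> (f n has_derivative D n z) (at z) \<and> (\<forall>c v. D n z (c *s v) = c * D n z v)"
    by metis
  have sub: "z \<in> ball w \<epsilon>" if "z \<in> ?S" for z using that \<epsilon> by simp
  have D: "(f n has_derivative D n z) (at z)" "D n z (c *s v) = c * D n z v" if "z \<in> ?S" for n z c v
    using D' sub[OF that] by auto
  have Dc: "\<exists>N. \<forall>m\<ge>N. \<forall>n\<ge>N. \<forall>z\<in>?S. \<forall>v. cmod (D m z v - D n z v) \<le> e * norm v" if "e > 0" for e
  proof -
    obtain N where N: "\<forall>m\<ge>N. \<forall>n\<ge>N. \<forall>z\<in>ball w \<epsilon>. cmod (f m z - f n z) \<le> \<epsilon> / 4 * e"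
      using cau[of "\<epsilon> / 4 * e"] \<epsilon> \<open>e > 0\<close> by auto
    have "cmod (D m z v - D n z v) \<le> e * norm v" if mn: "m \<ge> N" "n \<ge> N" and z: "z \<in> ?S" for m n z v
    proof -
      have "holomorphic_fun_on (\<lambda>z. f m z - f n z) (ball w \<epsilon>)"
        using holomorphic_fun_on_lin[OF f f, of 1 m "-1" n] by simp
      then have "cmod (D m z v - D n z v) \<le> 4 / \<epsilon> * (\<epsilon> / 4 * e) * norm v"
        by (rule directional_Cauchy_estimate[OF _ _ z, of _ _ "\<lambda>v. D m z v - D n z v"])
           (use N mn in \<open>auto simp: D(2)[OF z] right_diff_distrib intro!: has_derivative_diff D(1)[OF z]\<close>)
      then show ?thesis using \<epsilon> by simp
    qed
    then show ?thesis by blast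
  qed
  define g' where "g' = (\<lambda>z v. lim (\<lambda>n. D n z v))"
  have Dlim: "(\<lambda>n. D n z v) \<longlonglongrightarrow> g' z v" if z: "z \<in> ?S" for z v
  proof -
    have "Cauchy (\<lambda>n. D n z v)"
    proof (rule metric_CauchyI)
      fix e :: real assume "e > 0"
      define e' where "e' = e / (norm v + 1)"
      have e': "e' > 0" "e' * norm v < e" using \<open>e > 0\<close> by (auto simp: e'_def field_simps add_pos_nonneg)
      obtain N where N: "\<forall>m\<ge>N. \<forall>n\<ge>N. \<forall>z\<in>?S. \<forall>v. cmod (D m z v - D n z v) \<le> e' * norm v" using Dc[OF e'(1)] by blast
      have "dist (D m z v) (D n z v) < e" if "m \<ge> N" "n \<ge> N" for m n
      proof -
        have "cmod (D m z v - D n z v) \<le> e' * norm v" using N that z by blast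
        then show ?thesis using e'(2) by (simp add: dist_norm)
      qed
      then show "\<exists>M. \<forall>m\<ge>M. \<forall>n\<ge>M. dist (D m z v) (D n z v) < e" by blast
    qed
    then show ?thesis by (simp add: g'_def Cauchy_convergent_iff convergent_LIMSEQ_iff)
  qed
  have unif: "\<forall>\<^sub>F n in sequentially. \<forall>z\<in>?S. \<forall>v. cmod (D n z v - g' z v) \<le> e * norm v" if e: "e > 0" for e
  proof -
    obtain N where N: "\<forall>m\<ge>N. \<forall>n\<ge>N. \<forall>z\<in>?S. \<forall>v. cmod (D m z v - D n z v) \<le> e * norm v"
      using Dc[OF e] by blast
    have "cmod (D n z v - g' z v) \<le> e * norm v" if n: "n \<ge> N" and z: "z \<in> ?S" for n z v
    proof (rule tendsto_upperbound)
      show "(\<lambda>m. cmod (D n z v - D m z v)) \<longlonglongrightarrow> cmod (D n z v - g' z v)"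
        by (intro tendsto_intros Dlim z)
      show "\<forall>\<^sub>F m in sequentially. cmod (D n z v - D m z v) \<le> e * norm v"
        using eventually_ge_at_top[of N] by eventually_elim (use N n z in blast)
    qed simp
    then show ?thesis by (intro eventually_sequentiallyI[of N]) blast
  qed
  have wS: "w \<in> ?S" using \<epsilon> by simp
  have "Cauchy (\<lambda>n. f n w)"
  proof (rule metric_CauchyI)
    fix e :: real assume e: "e > 0"
    then obtain N where N: "\<forall>m\<ge>N. \<forall>n\<ge>N. \<forall>z\<in>ball w \<epsilon>. cmod (f m z - f n z) \<le> e / 2" using cau[of "e / 2"] by auto
    have "dist (f m w) (f n w) < e" if "m \<ge> N" "n \<ge> N" for m n
    proof -
      have "cmod (f m w - f n w) \<le> e / 2" using N that sub[OF wS] by blast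
      then show ?thesis using e by (simp add: dist_norm)
    qed
    then show "\<exists>M. \<forall>m\<ge>M. \<forall>n\<ge>M. dist (f m w) (f n w) < e" by blast
  qed
  then obtain l where l: "(\<lambda>n. f n w) \<longlonglongrightarrow> l" using Cauchy_convergent_iff convergent_def by blast
  obtain g where g: "\<And>z. z \<in> ?S \<Longrightarrow> (\<lambda>n. f n z) \<longlonglongrightarrow> g z" "\<And>z. z \<in> ?S \<Longrightarrow> (g has_derivative g' z) (at z within ?S)"
    using has_derivative_sequence[OF convex_ball has_derivative_at_withinI[OF D(1)] unif wS l] by blast
  have "holomorphic_fun_on g ?S"
    unfolding holomorphic_fun_on_def
  proof (intro ballI exI conjI allI)
    fix z c v assume z: "z \<in> ?S"
    show "(g has_derivative g' z) (at z)" using g(2)[OF z] unfolding at_within_open[OF z open_ball] .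
    have "(\<lambda>n. D n z (c *s v)) \<longlonglongrightarrow> c * g' z v" unfolding D(2)[OF z] by (intro tendsto_intros Dlim z)
    then show "g' z (c *s v) = c * g' z v" using LIMSEQ_unique Dlim[OF z] by blast
  qed
  then show ?thesis using that g(1) by blast
qed

lemma holomorphic_limit:
  fixes f :: "nat \<Rightarrow> complex^'n \<Rightarrow> complex"
  assumes f: "\<And>n. holomorphic_fun_on (f n) U"
    and cau: "\<And>w. w \<in> U \<Longrightarrow> \<exists>\<epsilon>>0. ball w \<epsilon> \<subseteq> U \<and>
      (\<forall>e>0. \<exists>N. \<forall>m\<ge>N. \<forall>n\<ge>N. \<forall>z\<in>ball w \<epsilon>. cmod (f m z - f n z) \<le> e)"
  obtains g where "holomorphic_fun_on g U" "\<And>z. z \<in> U \<Longrightarrow> (\<lambda>n. f n z) \<longlonglongrightarrow> g z"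
proof -
  define g where "g = (\<lambda>z. lim (\<lambda>n. f n z))"
  have loc: "\<exists>\<delta>>0. \<exists>h. holomorphic_fun_on h (ball w \<delta>) \<and> (\<forall>z\<in>ball w \<delta>. (\<lambda>n. f n z) \<longlonglongrightarrow> h z)" if w: "w \<in> U" for w
  proof -
    obtain \<epsilon> where \<epsilon>: "\<epsilon> > 0" "ball w \<epsilon> \<subseteq> U"
      "\<And>e. e > 0 \<Longrightarrow> \<exists>N. \<forall>m\<ge>N. \<forall>n\<ge>N. \<forall>z\<in>ball w \<epsilon>. cmod (f m z - f n z) \<le> e"
      using cau[OF w] by blast
    have "holomorphic_fun_on (f n) (ball w \<epsilon>)" for n
      using f[of n] \<epsilon>(2) unfolding holomorphic_fun_on_def by blast
    from holomorphic_local_limit[OF this \<epsilon>(1,3)] obtain h where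
      "holomorphic_fun_on h (ball w (\<epsilon> / 2))" "\<And>z. z \<in> ball w (\<epsilon> / 2) \<Longrightarrow> (\<lambda>n. f n z) \<longlonglongrightarrow> h z" by blast
    then show ?thesis using \<epsilon>(1) by (intro exI[of _ "\<epsilon> / 2"]) auto
  qed
  have lim: "(\<lambda>n. f n z) \<longlonglongrightarrow> g z" if z: "z \<in> U" for z
  proof -
    obtain \<delta> h where "\<delta> > 0" "\<forall>z\<in>ball z \<delta>. (\<lambda>n. f n z) \<longlonglongrightarrow> h z" using loc[OF z] by blast
    then have "(\<lambda>n. f n z) \<longlonglongrightarrow> h z" by simp
    then show ?thesis by (simp add: g_def limI)
  qed
  have "holomorphic_fun_on g U"
    unfolding holomorphic_fun_on_def
  proof
    fix w assume w: "w \<in> U"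
    obtain \<delta> h where h: "\<delta> > 0" "holomorphic_fun_on h (ball w \<delta>)" "\<forall>z\<in>ball w \<delta>. (\<lambda>n. f n z) \<longlonglongrightarrow> h z"
      using loc[OF w] by blast
    have gh: "h z = g z" if "z \<in> ball w \<delta>" for z 
    proof -
      have "(\<lambda>n. f n z) \<longlonglongrightarrow> h z" using h(3) that by blast
      then show ?thesis unfolding g_def by (rule limI[symmetric])
    qed
    obtain D where D: "(h has_derivative D) (at w)" "\<forall>c v. D (c *s v) = c * D v"
      using h(1,2) unfolding holomorphic_fun_on_def by (metis centre_in_ball)
    have "(g has_derivative D) (at w)"
      by (rule has_derivative_transform_within_open[OF D(1) open_ball[of w \<delta>]]) (use h(1) gh in auto)
    then show "\<exists>D. (g has_derivative D) (at w) \<and> (\<forall>c v. D (c *s v) = c * D v)" using D(2) by blast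
  qed
  then show ?thesis using that lim by blast
qed

section \<open>The Hardy space of the tetrablock is closed\<close>

context boundary_measure
begin

abbreviation "M \<equiv> tetra_measure \<Theta>"

definition jac_mass where "jac_mass = (\<integral>z. (cmod (tetra_jac z))^2 \<partial>\<Theta>)"

lemma continuous_jac: "continuous_on S tetra_jac"
  unfolding tetra_jac_eq[abs_def] by (intro continuous_intros)

lemma jac_L2: "tetra_jac \<in> L2 \<Theta>"
  by (rule continuous_L2_\<Theta>[OF continuous_jac])

lemma jac_mass_nonneg: "0 \<le> jac_mass" by (simp add: jac_mass_def)

lemma jac_measurable [measurable]: "tetra_jac \<in> borel_measurable \<Theta>"
  by (rule L2_measurable[OF jac_L2])

lemma sets_M: "sets M = sets (restrict_space borel shilov_tetrablock)"
  by (simp add: tetra_measure_def Let_def)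

lemma tetra_map_measurable: "tetra_map \<in> measurable \<Theta> (restrict_space borel shilov_tetrablock)"
proof -
  have "tetra_map \<in> measurable (restrict_space borel shilov_cartan_II) (restrict_space borel shilov_tetrablock)"
    using borel_measurable_continuous_onI[OF continuous_on_tetra_map] tetra_map_shilov
    by (intro measurable_restrict_space3) auto
  then show ?thesis using measurable_cong_sets[OF sets_\<Theta> refl] by blast
qed

lemma borel_M: "g \<in> borel_measurable M \<Longrightarrow> (\<lambda>z. g (tetra_map z)) \<in> borel_measurable \<Theta>"
  using measurable_compose[OF tetra_map_measurable] measurable_cong_sets[OF sets_M refl] by blast

lemma nn_integral_M:
  fixes h :: "complex^3 \<Rightarrow> ennreal"
  assumes h: "h \<in> borel_measurable M"
  shows "(\<integral>\<^sup>+w. h w \<partial>M) = (\<integral>\<^sup>+z. ennreal ((cmod (tetra_jac z))^2 / jac_mass) * h (tetra_map z) \<partial>\<Theta>)"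
proof -
  note [measurable] = borel_M[OF h]
  let ?d = "density \<Theta> (\<lambda>z. ennreal ((cmod (tetra_jac z))^2 / jac_mass))"
  have M: "M = distr ?d (restrict_space borel shilov_tetrablock) tetra_map"
    by (simp add: tetra_measure_def Let_def jac_mass_def)
  have "(\<integral>\<^sup>+w. h w \<partial>M) = (\<integral>\<^sup>+z. h (tetra_map z) \<partial>?d)"
    unfolding M
  proof (rule nn_integral_distr)
    show "tetra_map \<in> measurable ?d (restrict_space borel shilov_tetrablock)" using tetra_map_measurable by simp
    show "h \<in> borel_measurable (distr ?d (restrict_space borel shilov_tetrablock) tetra_map)" using h unfolding M .
  qed
  also have "\<dots> = (\<integral>\<^sup>+z. ennreal ((cmod (tetra_jac z))^2 / jac_mass) * h (tetra_map z) \<partial>\<Theta>)"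
    by (rule nn_integral_density) measurable
  finally show ?thesis .
qed

lemma finite_M: "finite_measure M"
proof
  have "emeasure M (space M) = (\<integral>\<^sup>+w. 1 \<partial>M)" by simp
  also have "\<dots> = (\<integral>\<^sup>+z. ennreal ((cmod (tetra_jac z))^2 / jac_mass) \<partial>\<Theta>)"
    by (subst nn_integral_M) simp_all
  also have "\<dots> = ennreal (jac_mass / jac_mass)"
    using L2_integrable[OF jac_L2] jac_mass_nonneg unfolding jac_mass_def by (subst nn_integral_eq_integral) auto
  finally show "emeasure M (space M) \<noteq> \<infinity>" by simp
qed

definition jac_lift where "jac_lift g z = tetra_jac z * g (tetra_map z)"

text \<open>Up to the constant, \<open>g \<mapsto> J (g \<circ> \<phi>)\<close> is an isometry of \<open>L\<^sup>2\<close> of the tetrablock boundary into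
  \<open>L\<^sup>2(\<Theta>)\<close>.  If the constant were zero, \<open>J\<close> would vanish almost everywhere and both sides would be
  zero.\<close>

lemma nn_integral_jac_lift:
  assumes g: "g \<in> borel_measurable M"
  shows "(\<integral>\<^sup>+z. ennreal ((cmod (jac_lift g z))^2) \<partial>\<Theta>) = ennreal jac_mass * (\<integral>\<^sup>+w. ennreal ((cmod (g w))^2) \<partial>M)"
proof -
  have h: "(\<lambda>w. ennreal ((cmod (g w))^2)) \<in> borel_measurable M" using g by measurable
  note [measurable] = borel_M[OF g]
  have "ennreal jac_mass * (\<integral>\<^sup>+w. ennreal ((cmod (g w))^2) \<partial>M)
    = (\<integral>\<^sup>+z. ennreal jac_mass * (ennreal ((cmod (tetra_jac z))^2 / jac_mass) * ennreal ((cmod (g (tetra_map z)))^2)) \<partial>\<Theta>)"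
    unfolding nn_integral_M[OF h] by (rule nn_integral_cmult[symmetric]) measurable
  also have "\<dots> = (\<integral>\<^sup>+z. ennreal ((cmod (jac_lift g z))^2) \<partial>\<Theta>)"
  proof (cases "jac_mass = 0")
    case True
    then have "AE z in \<Theta>. (cmod (tetra_jac z))^2 = 0"
      using integral_nonneg_eq_0_iff_AE[OF L2_integrable[OF jac_L2]] unfolding jac_mass_def by simp
    then show ?thesis by (intro nn_integral_cong_AE) (auto simp: True jac_lift_def elim!: eventually_mono)
  next
    case False
    then have "jac_mass > 0" using jac_mass_nonneg by simp
    then show ?thesis
      by (intro nn_integral_cong) (simp add: jac_lift_def norm_mult power_mult_distrib ennreal_mult'[symmetric] mult.assoc[symmetric])
  qed
  finally show ?thesis by simp
qed

lemma jac_lift_measurable: "g \<in> borel_measurable M \<Longrightarrow> jac_lift g \<in> borel_measurable \<Theta>"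
  unfolding jac_lift_def[abs_def] using borel_M jac_measurable by measurable

lemma jac_lift_L2:
  assumes g: "g \<in> L2 M" shows "jac_lift g \<in> L2 \<Theta>" "L2_norm \<Theta> (jac_lift g) = sqrt jac_mass * L2_norm M g"
proof -
  have e: "(\<integral>\<^sup>+z. ennreal ((cmod (jac_lift g z))^2) \<partial>\<Theta>) = ennreal ((sqrt jac_mass * L2_norm M g)^2)"
    unfolding nn_integral_jac_lift[OF L2_measurable[OF g]] L2_nn_integral[OF g]
    using jac_mass_nonneg by (simp add: ennreal_mult'[symmetric] power_mult_distrib)
  show l: "jac_lift g \<in> L2 \<Theta>"
    by (rule L2_by_nn_integral(1)[OF jac_lift_measurable[OF L2_measurable[OF g]], of "sqrt jac_mass * L2_norm M g"])
       (use e jac_mass_nonneg in auto)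
  have "(L2_norm \<Theta> (jac_lift g))^2 = (sqrt jac_mass * L2_norm M g)^2"
    using e unfolding L2_nn_integral[OF l] by (subst (asm) ennreal_inj) simp_all
  then show "L2_norm \<Theta> (jac_lift g) = sqrt jac_mass * L2_norm M g"
    by (rule power2_eq_imp_eq) (simp_all add: jac_mass_nonneg)
qed

lemma boundary_ofI:
  assumes "holomorphic_fun_on f tetrablock" "G \<in> L2 \<Theta>"
    "((\<lambda>r. L2_norm \<Theta> (\<lambda>z. pull f r z - G z)) \<longlongrightarrow> 0) (at_left 1)"
  shows "boundary_of f G"
  using assms by (simp add: boundary_of_def radial_limit_def pull_def)

lemma boundary_of_lin:
  assumes "boundary_of f F" "boundary_of g G"
  shows "boundary_of (\<lambda>w. a * f w + b * g w) (\<lambda>z. a * F z + b * G z)"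
proof -
  note f = boundary_ofD[OF assms(1)] and g = boundary_ofD[OF assms(2)]
  have "((\<lambda>r. L2_norm \<Theta> (\<lambda>z. pull (\<lambda>w. a * f w + b * g w) r z - (a * F z + b * G z))) \<longlongrightarrow> 0) (at_left 1)"
  proof (rule Lim_null_comparison)
    show "((\<lambda>r. cmod a * L2_norm \<Theta> (\<lambda>z. pull f r z - F z) + cmod b * L2_norm \<Theta> (\<lambda>z. pull g r z - G z)) \<longlongrightarrow> 0) (at_left 1)"
      using tendsto_add[OF tendsto_mult_left[OF f(3), of "cmod a"] tendsto_mult_left[OF g(3), of "cmod b"]] by simp
    show "\<forall>\<^sub>F r in at_left 1. norm (L2_norm \<Theta> (\<lambda>z. pull (\<lambda>w. a * f w + b * g w) r z - (a * F z + b * G z)))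
      \<le> cmod a * L2_norm \<Theta> (\<lambda>z. pull f r z - F z) + cmod b * L2_norm \<Theta> (\<lambda>z. pull g r z - G z)"
      using eventually_at_left_1[of 0, simplified]
    proof eventually_elim
      fix r :: real assume r: "0 < r \<and> r < 1"
      have d: "(\<lambda>z. pull f r z - F z) \<in> L2 \<Theta>" "(\<lambda>z. pull g r z - G z) \<in> L2 \<Theta>"
        by (intro L2_diff pull_L2 f g; use r in simp)+
      have e: "(\<lambda>z. pull (\<lambda>w. a * f w + b * g w) r z - (a * F z + b * G z)) = (\<lambda>z. a * (pull f r z - F z) + b * (pull g r z - G z))"
        by (auto simp: pull_def algebra_simps)
      show "norm (L2_norm \<Theta> (\<lambda>z. pull (\<lambda>w. a * f w + b * g w) r z - (a * F z + b * G z)))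
        \<le> cmod a * L2_norm \<Theta> (\<lambda>z. pull f r z - F z) + cmod b * L2_norm \<Theta> (\<lambda>z. pull g r z - G z)"
        unfolding e using L2_triangle[OF L2_cmult[OF d(1), of a] L2_cmult[OF d(2), of b]] by (simp add: L2_norm_cmult)
    qed
  qed
  then show ?thesis
    by (intro boundary_ofI holomorphic_fun_on_lin[OF f(1) g(1)] L2_lin[OF f(2) g(2)])
qed

lemma boundary_of_diff:
  assumes "boundary_of f F" "boundary_of g G"
  shows "boundary_of (\<lambda>w. f w - g w) (\<lambda>z. F z - G z)"
  using boundary_of_lin[OF assms, of 1 "-1"] by simp

lemma boundary_of_one: "boundary_of (\<lambda>_. 1) tetra_jac"
proof -
  have e: "L2_norm \<Theta> (\<lambda>z. pull (\<lambda>_. 1) r z - tetra_jac z) = \<bar>r - 1\<bar> * L2_norm \<Theta> tetra_jac" for r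
  proof -
    have "(\<lambda>z. pull (\<lambda>_. 1) r z - tetra_jac z) = (\<lambda>z. of_real (r - 1) * tetra_jac z)"
      unfolding pull_eq tetra_jac_eq by (auto simp: algebra_simps)
    then show ?thesis by (simp only: L2_norm_cmult norm_of_real)
  qed
  have "((\<lambda>r. \<bar>r - 1\<bar> * L2_norm \<Theta> tetra_jac) \<longlongrightarrow> \<bar>1 - 1\<bar> * L2_norm \<Theta> tetra_jac) (at_left 1)"
    by (intro tendsto_intros)
  then have "((\<lambda>r. L2_norm \<Theta> (\<lambda>z. pull (\<lambda>_. 1) r z - tetra_jac z)) \<longlongrightarrow> 0) (at_left 1)"
    unfolding e by simp
  then show ?thesis by (intro boundary_ofI holomorphic_fun_on_const jac_L2)
qed

lemma boundary_of_coord: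
  assumes "boundary_of f F"
  shows "boundary_of (\<lambda>w. w$i * f w) (\<lambda>z. tetra_map z $ i * F z)"
proof -
  note f = boundary_ofD[OF assms]
  obtain k :: nat where k: "\<And>r w. dil r w $ i = of_real (r^k) * w $ i"
  proof -
    have "i = 1 \<or> i = 2 \<or> i = 3" using exhaust_3 by blast
    then show ?thesis using that[of 1] that[of 2] by auto
  qed
  have m: "(\<lambda>z. tetra_map z $ i) \<in> borel_measurable \<Theta>"
    by (intro borel_imp_\<Theta> borel_measurable_continuous_onI continuous_intros continuous_on_tetra_map)
  have b: "cmod (tetra_map z $ i) \<le> 1" if "z \<in> space \<Theta>" for z
    using shilov_tetrablockD(7)[OF tetra_map_shilov] that by (simp add: space_\<Theta>)
  have mult: "(\<lambda>z. tetra_map z $ i * g z) \<in> L2 \<Theta>" "L2_norm \<Theta> (\<lambda>z. tetra_map z $ i * g z) \<le> L2_norm \<Theta> g" if g: "g \<in> L2 \<Theta>" for g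
    using L2_bounded_mult[OF g m AE_I2[OF b]] L2_norm_bounded_mult[OF g m AE_I2[OF b]] by auto
  have "((\<lambda>r. L2_norm \<Theta> (\<lambda>z. pull (\<lambda>w. w$i * f w) r z - tetra_map z $ i * F z)) \<longlongrightarrow> 0) (at_left 1)"
  proof (rule Lim_null_comparison)
    have "((\<lambda>r. \<bar>r^k\<bar> * L2_norm \<Theta> (\<lambda>z. pull f r z - F z) + \<bar>r^k - 1\<bar> * L2_norm \<Theta> F) \<longlongrightarrow>
      \<bar>1^k\<bar> * 0 + \<bar>1^k - 1\<bar> * L2_norm \<Theta> F) (at_left 1)"
      by (intro tendsto_intros f(3))
    then show "((\<lambda>r. \<bar>r^k\<bar> * L2_norm \<Theta> (\<lambda>z. pull f r z - F z) + \<bar>r^k - 1\<bar> * L2_norm \<Theta> F) \<longlongrightarrow> 0) (at_left 1)" by simp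
    show "\<forall>\<^sub>F r in at_left 1. norm (L2_norm \<Theta> (\<lambda>z. pull (\<lambda>w. w$i * f w) r z - tetra_map z $ i * F z))
      \<le> \<bar>r^k\<bar> * L2_norm \<Theta> (\<lambda>z. pull f r z - F z) + \<bar>r^k - 1\<bar> * L2_norm \<Theta> F"
      using eventually_at_left_1[of 0, simplified]
    proof eventually_elim
      fix r :: real assume r: "0 < r \<and> r < 1"
      have d: "(\<lambda>z. pull f r z - F z) \<in> L2 \<Theta>" by (intro L2_diff pull_L2 f; use r in simp)
      have e: "(\<lambda>z. pull (\<lambda>w. w$i * f w) r z - tetra_map z $ i * F z)
        = (\<lambda>z. of_real (r^k) * (tetra_map z $ i * (pull f r z - F z)) + of_real (r^k - 1) * (tetra_map z $ i * F z))"
        unfolding pull_def tetra_map_scaleR k by (auto simp: algebra_simps)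
      have "L2_norm \<Theta> (\<lambda>z. pull (\<lambda>w. w$i * f w) r z - tetra_map z $ i * F z)
        \<le> \<bar>r^k\<bar> * L2_norm \<Theta> (\<lambda>z. tetra_map z $ i * (pull f r z - F z)) + \<bar>r^k - 1\<bar> * L2_norm \<Theta> (\<lambda>z. tetra_map z $ i * F z)"
        unfolding e using L2_triangle[OF L2_cmult[OF mult(1)[OF d], of "of_real (r^k)"] L2_cmult[OF mult(1)[OF f(2)], of "of_real (r^k - 1)"]]
        unfolding L2_norm_cmult norm_of_real .
      also have "\<dots> \<le> \<bar>r^k\<bar> * L2_norm \<Theta> (\<lambda>z. pull f r z - F z) + \<bar>r^k - 1\<bar> * L2_norm \<Theta> F"
        by (intro add_mono mult_left_mono mult(2) d f(2)) auto
      finally show "norm (L2_norm \<Theta> (\<lambda>z. pull (\<lambda>w. w$i * f w) r z - tetra_map z $ i * F z))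
        \<le> \<bar>r^k\<bar> * L2_norm \<Theta> (\<lambda>z. pull f r z - F z) + \<bar>r^k - 1\<bar> * L2_norm \<Theta> F" by simp
    qed
  qed
  then show ?thesis
    by (intro boundary_ofI holomorphic_fun_on_coord[OF f(1)] mult(1)[OF f(2)])
qed

text \<open>The existence of a radial limit bounds all dilates, by monotonicity of their norms.\<close>

lemma hardy_boundary_iff: "g \<in> hardy_boundary \<Theta> \<longleftrightarrow> g \<in> L2 M \<and> (\<exists>f. boundary_of f (jac_lift g))"
proof
  assume "g \<in> L2 M \<and> (\<exists>f. boundary_of f (jac_lift g))"
  then obtain f where g: "g \<in> L2 M" and f: "boundary_of f (jac_lift g)" by blast
  have "hardy_norm \<Theta> (\<lambda>z. tetra_jac z * f (tetra_map z)) \<le> ennreal (L2_norm \<Theta> (jac_lift g))"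
    unfolding hardy_norm_def pull_def[symmetric]
    by (intro SUP_least ennreal_leI pull_norm_le_boundary[OF f]) auto
  then have "hardy_norm \<Theta> (\<lambda>z. tetra_jac z * f (tetra_map z)) < \<infinity>" by (rule le_less_trans) simp
  then show "g \<in> hardy_boundary \<Theta>"
    using g f unfolding hardy_boundary_def hardy_tetrablock_def boundary_of_def jac_lift_def[abs_def] by blast
qed (auto simp: hardy_boundary_def hardy_tetrablock_def boundary_of_def jac_lift_def[abs_def])

text \<open>Enlarging a point of the open tetrablock slightly keeps it inside, so a neighbourhood of it
  consists of points \<open>dil r (disc a b s)\<close> with a fixed \<open>r < 1\<close> and \<open>|a| + |b|\<close> bounded away from one.\<close>

lemma local_evaluation_bound:
  assumes w: "w0 \<in> tetrablock"
  obtains \<epsilon> A where "\<epsilon> > 0" "A \<ge> 0" "ball w0 \<epsilon> \<subseteq> tetrablock"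
    "\<And>f G w. boundary_of f G \<Longrightarrow> w \<in> ball w0 \<epsilon> \<Longrightarrow> cmod (f w) \<le> A * L2_norm \<Theta> G"
proof -
  have "open {t. dil t w0 \<in> tetrablock}"
  proof -
    have "continuous_on UNIV (\<lambda>t. dil t w0)"
    proof (rule continuous_on_vec_components)
      fix i :: 3
      have "i = 1 \<or> i = 2 \<or> i = 3" using exhaust_3 by blast
      then show "continuous_on UNIV (\<lambda>t. dil t w0 $ i)"
        by (elim disjE; simp only: dil_nth; intro continuous_intros)
    qed
    then show ?thesis using open_vimage[OF open_tetrablock] by (simp add: vimage_def)
  qed
  then obtain e where e: "e > 0" "ball 1 e \<subseteq> {t. dil t w0 \<in> tetrablock}"
    using w dil_1[of w0] by (metis (mono_tags, lifting) mem_Collect_eq open_contains_ball)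
  define t where "t = 1 + e / 2"
  have "t \<in> ball 1 e" using e(1) by (simp add: t_def dist_real_def)
  then have t: "t > 1" "dil t w0 \<in> tetrablock" using e by (auto simp: t_def)
  define N where "N = (\<lambda>w :: complex^3. cmod (w$1 - cnj (w$2) * w$3) + cmod (w$2 - cnj (w$1) * w$3))"
  define D where "D = (\<lambda>w :: complex^3. 1 - (cmod (w$3))^2)"
  have w1: "cmod (dil t w0 $ 3) < 1" "N (dil t w0) < D (dil t w0)"
    using tetrablock_bound[OF t(2)] by (auto simp: N_def D_def)
  have Dpos: "D w > 0" if "cmod (w$3) < 1" for w using that by (simp add: D_def power_less_one_iff)
  have N0: "N w \<ge> 0" for w by (simp add: N_def)
  \<comment> \<open>Halfway between \<open>|a| + |b|\<close> at the enlarged point and one.\<close>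
  define \<rho> where "\<rho> = (N (dil t w0) / D (dil t w0) + 1) / 2"
  have q: "N (dil t w0) / D (dil t w0) < 1" "0 \<le> N (dil t w0) / D (dil t w0)" using w1 Dpos[OF w1(1)] N0 by auto
  have \<rho>: "0 \<le> \<rho>" "\<rho> < 1" using q by (auto simp: \<rho>_def)
  have "N (dil t w0) / D (dil t w0) < \<rho>" 
  proof -
    have "x < (x + 1) / 2" if "x < 1" for x :: real using that by simp
    then show ?thesis unfolding \<rho>_def using q(1) by blast
  qed
  then have w1': "N (dil t w0) < \<rho> * D (dil t w0)" using Dpos[OF w1(1)] by (simp add: divide_simps)
  have "open {w. cmod (dil t w $ 3) < 1 \<and> N (dil t w) < \<rho> * D (dil t w)}"
    unfolding N_def D_def dil_nth by (intro open_Collect_conj open_Collect_less continuous_intros)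
  moreover have "w0 \<in> {w. cmod (dil t w $ 3) < 1 \<and> N (dil t w) < \<rho> * D (dil t w)}" using w1(1) w1' by simp
  ultimately obtain \<epsilon> where \<epsilon>: "\<epsilon> > 0" "ball w0 \<epsilon> \<subseteq> {w. cmod (dil t w $ 3) < 1 \<and> N (dil t w) < \<rho> * D (dil t w)}"
    using open_contains_ball by blast
  define r where "r = 1 / t"
  have r: "0 < r" "r < 1" "r * t = 1" using t by (auto simp: r_def)
  obtain A where A: "A \<ge> 0" "\<And>f G a b s. boundary_of f G \<Longrightarrow> cmod a + cmod b \<le> \<rho> \<Longrightarrow> cmod s \<le> 1 \<Longrightarrow>
     cmod (f (dil r (disc a b s))) \<le> A * L2_norm \<Theta> G" using evaluation_bound[OF r(1,2) \<rho>] by blast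
  have repr: "\<exists>a b s. cmod a + cmod b \<le> \<rho> \<and> cmod s < 1 \<and> w = dil r (disc a b s)" if "w \<in> ball w0 \<epsilon>" for w
  proof -
    let ?v = "dil t w"
    have v: "cmod (?v$3) < 1" "N ?v < \<rho> * D ?v" using \<epsilon>(2) that by auto
    have "N ?v / D ?v \<le> \<rho>" using v(2) Dpos[OF v(1)] by (simp add: divide_simps)
    moreover have "w = dil r ?v" by (simp only: dil_dil r(3) dil_1)
    ultimately show ?thesis using disc_parameters[OF v(1)] v(1) unfolding N_def D_def by metis
  qed
  have "ball w0 \<epsilon> \<subseteq> tetrablock"
  proof
    fix w assume "w \<in> ball w0 \<epsilon>"
    then obtain a b s where "cmod a + cmod b \<le> \<rho>" "cmod s < 1" "w = dil r (disc a b s)" using repr by blast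
    then show "w \<in> tetrablock" using dil_disc_in_tetrablock[of a b s r] r \<rho> by simp
  qed
  moreover have "cmod (f w) \<le> A * L2_norm \<Theta> G" if "boundary_of f G" "w \<in> ball w0 \<epsilon>" for f G w
    using repr[OF that(2)] A(2)[OF that(1)] by (metis less_imp_le)
  ultimately show ?thesis using that \<epsilon>(1) A(1) by blast
qed

text \<open>Bounded point evaluations give a holomorphic limit \<open>g\<close>.  Since the norm of each dilate is at most
  that of the boundary value, \<open>f n\<close> approximates \<open>g\<close> uniformly in \<open>r\<close>, and the radial limits
  may be exchanged with the limit in \<open>n\<close>.\<close>

lemma boundary_of_closed:
  assumes f: "\<And>n. boundary_of (f n) (F n)" and G: "G \<in> L2 \<Theta>"
    and lim: "(\<lambda>n. L2_norm \<Theta> (\<lambda>z. F n z - G z)) \<longlonglongrightarrow> 0"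
  obtains g where "boundary_of g G"
proof -
  note fh = boundary_ofD(1)[OF f] and FL = boundary_ofD(2)[OF f]
  have cau: "\<exists>N. \<forall>m\<ge>N. \<forall>n\<ge>N. L2_norm \<Theta> (\<lambda>z. F m z - F n z) < e" if "e > 0" for e
    using L2_convergent_imp_Cauchy[OF FL G lim that] .
  obtain g where g: "holomorphic_fun_on g tetrablock" "\<And>w. w \<in> tetrablock \<Longrightarrow> (\<lambda>n. f n w) \<longlonglongrightarrow> g w"
  proof (rule holomorphic_limit[OF fh])
    fix w assume "w \<in> tetrablock"
    then obtain \<epsilon> A where A: "\<epsilon> > 0" "A \<ge> 0" "ball w \<epsilon> \<subseteq> tetrablock"
      "\<And>f G v. boundary_of f G \<Longrightarrow> v \<in> ball w \<epsilon> \<Longrightarrow> cmod (f v) \<le> A * L2_norm \<Theta> G"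
      using local_evaluation_bound by blast
    have "\<exists>N. \<forall>m\<ge>N. \<forall>n\<ge>N. \<forall>z\<in>ball w \<epsilon>. cmod (f m z - f n z) \<le> e" if "e > 0" for e
    proof -
      have "e / (A + 1) > 0" using that A(2) by simp
      then obtain N where N: "\<forall>m\<ge>N. \<forall>n\<ge>N. L2_norm \<Theta> (\<lambda>z. F m z - F n z) < e / (A + 1)" using cau by blast
      have "cmod (f m z - f n z) \<le> e" if mn: "m \<ge> N" "n \<ge> N" and z: "z \<in> ball w \<epsilon>" for m n z
      proof -
        have "cmod (f m z - f n z) \<le> A * L2_norm \<Theta> (\<lambda>z. F m z - F n z)" by (rule A(4)[OF boundary_of_diff[OF f f] z])
        also have "\<dots> \<le> A * (e / (A + 1))" using N mn A(2) by (intro mult_left_mono) (auto intro: less_imp_le)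
        also have "\<dots> \<le> e" using A(2) \<open>e > 0\<close> by (simp add: field_simps)
        finally show ?thesis .
      qed
      then show ?thesis by blast
    qed
    then show "\<exists>\<epsilon>>0. ball w \<epsilon> \<subseteq> tetrablock \<and>
      (\<forall>e>0. \<exists>N. \<forall>m\<ge>N. \<forall>n\<ge>N. \<forall>z\<in>ball w \<epsilon>. cmod (f m z - f n z) \<le> e)" using A(1,3) by blast
  qed blast
  have close: "L2_norm \<Theta> (\<lambda>z. pull g r z - pull (f n) r z) \<le> e"
    if N: "\<forall>m\<ge>N. \<forall>n\<ge>N. L2_norm \<Theta> (\<lambda>z. F m z - F n z) < e" and n: "n \<ge> N" and r: "0 \<le> r" "r < 1" for N n e r
  proof (rule L2_limit_by_Fatou(2)[where f="\<lambda>m z. pull (f m) r z - pull (f n) r z"])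
    show "(\<lambda>z. pull (f m) r z - pull (f n) r z) \<in> L2 \<Theta>" for m by (intro L2_diff pull_L2 fh r)
    show "(\<lambda>z. pull g r z - pull (f n) r z) \<in> borel_measurable \<Theta>" by (intro L2_measurable L2_diff pull_L2 fh g r)
    show "AE z in \<Theta>. (\<lambda>m. pull (f m) r z - pull (f n) r z) \<longlonglongrightarrow> pull g r z - pull (f n) r z"
    proof (rule AE_I2)
      fix z assume "z \<in> space \<Theta>"
      then have "tetra_map (r *\<^sub>R z) \<in> tetrablock" using tetra_map_scaled[OF contr_shilov r] by (simp add: space_\<Theta>)
      then show "(\<lambda>m. pull (f m) r z - pull (f n) r z) \<longlonglongrightarrow> pull g r z - pull (f n) r z"
        unfolding pull_def by (intro tendsto_intros g(2))
    qed
    show "\<forall>\<^sub>F m in sequentially. L2_norm \<Theta> (\<lambda>z. pull (f m) r z - pull (f n) r z) \<le> e"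
      using eventually_ge_at_top[of N]
    proof eventually_elim
      fix m assume m: "m \<ge> N"
      have "(\<lambda>z. pull (f m) r z - pull (f n) r z) = pull (\<lambda>w. f m w - f n w) r"
        by (auto simp: pull_def algebra_simps)
      then have "L2_norm \<Theta> (\<lambda>z. pull (f m) r z - pull (f n) r z) \<le> L2_norm \<Theta> (\<lambda>z. F m z - F n z)"
        using pull_norm_le_boundary[OF boundary_of_diff[OF f f] r] by simp
      then show "L2_norm \<Theta> (\<lambda>z. pull (f m) r z - pull (f n) r z) \<le> e" using N m n by (meson less_imp_le order_trans)
    qed
  qed
  have "((\<lambda>r. L2_norm \<Theta> (\<lambda>z. pull g r z - G z)) \<longlongrightarrow> 0) (at_left 1)"
  proof (rule tendstoI)
    fix e :: real assume e: "e > 0"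
    obtain N where N: "\<forall>m\<ge>N. \<forall>n\<ge>N. L2_norm \<Theta> (\<lambda>z. F m z - F n z) < e / 3" using cau[of "e / 3"] e by auto
    obtain N' where N': "\<And>n. n \<ge> N' \<Longrightarrow> L2_norm \<Theta> (\<lambda>z. F n z - G z) < e / 3"
      using LIMSEQ_D[OF lim, of "e / 3"] e by auto
    define n where "n = max N N'"
    have n: "n \<ge> N" "n \<ge> N'" by (auto simp: n_def)
    have "\<forall>\<^sub>F r in at_left 1. L2_norm \<Theta> (\<lambda>z. pull (f n) r z - F n z) < e / 3"
      using order_tendstoD(2)[OF boundary_ofD(3)[OF f[of n]], of "e / 3"] e by simp
    then show "\<forall>\<^sub>F r in at_left 1. dist (L2_norm \<Theta> (\<lambda>z. pull g r z - G z)) 0 < e"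
      using eventually_at_left_1[of 0, simplified]
    proof eventually_elim
      fix r :: real assume r: "L2_norm \<Theta> (\<lambda>z. pull (f n) r z - F n z) < e / 3" and r01: "0 < r \<and> r < 1"
      have L: "pull g r \<in> L2 \<Theta>" "pull (f n) r \<in> L2 \<Theta>" using pull_L2 g(1) fh r01 by auto
      have "L2_norm \<Theta> (\<lambda>z. pull g r z - G z) \<le> L2_norm \<Theta> (\<lambda>z. pull g r z - pull (f n) r z) +
         (L2_norm \<Theta> (\<lambda>z. pull (f n) r z - F n z) + L2_norm \<Theta> (\<lambda>z. F n z - G z))"
        using L2_triangle_diff[OF L G] L2_triangle_diff[OF L(2) FL[of n] G] by linarith
      moreover have "L2_norm \<Theta> (\<lambda>z. pull g r z - pull (f n) r z) \<le> e / 3"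
        using close[OF N n(1), of r] r01 by simp
      ultimately show "dist (L2_norm \<Theta> (\<lambda>z. pull g r z - G z)) 0 < e" using r N'[OF n(2)] by (simp add: dist_real_def)
    qed
  qed
  then have "boundary_of g G" by (intro boundary_ofI g(1) G)
  then show ?thesis using that by blast
qed

lemma hardy_boundary_L2: "g \<in> hardy_boundary \<Theta> \<Longrightarrow> g \<in> L2 M"
  by (simp add: hardy_boundary_iff)

lemma hardy_boundary_one: "(\<lambda>_. 1) \<in> hardy_boundary \<Theta>"
proof -
  have one: "(\<lambda>_. 1) \<in> L2 M" by (rule L2_bounded[OF finite_M, of _ 1]) auto
  have "jac_lift (\<lambda>_. 1) = tetra_jac" by (auto simp: jac_lift_def)
  then show ?thesis using one boundary_of_one unfolding hardy_boundary_iff by metis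
qed

lemma hardy_boundary_subspace: "L2_subspace M (hardy_boundary \<Theta>)"
  unfolding L2_subspace_def
proof (intro conjI ballI allI)
  show "hardy_boundary \<Theta> \<subseteq> L2 M" using hardy_boundary_L2 by blast
  show "hardy_boundary \<Theta> \<noteq> {}" using hardy_boundary_one by blast
  fix f g a b assume fg: "f \<in> hardy_boundary \<Theta>" "g \<in> hardy_boundary \<Theta>"
  obtain f' g' where *: "boundary_of f' (jac_lift f)" "boundary_of g' (jac_lift g)" using fg hardy_boundary_iff by blast
  have "jac_lift (\<lambda>x. a * f x + b * g x) = (\<lambda>z. a * jac_lift f z + b * jac_lift g z)" by (auto simp: jac_lift_def algebra_simps)
  then show "(\<lambda>x. a * f x + b * g x) \<in> hardy_boundary \<Theta>"
    using boundary_of_lin[OF *, of a b] L2_lin[OF fg[THEN hardy_boundary_L2]] unfolding hardy_boundary_iff by metis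
qed

lemma hardy_boundary_coord:
  assumes g: "g \<in> hardy_boundary \<Theta>" shows "coord_mult i g \<in> hardy_boundary \<Theta>"
proof -
  obtain f where f: "boundary_of f (jac_lift g)" using g hardy_boundary_iff by blast
  have space: "space M = shilov_tetrablock"
    by (rule space_compact_measure[OF compact_shilov_tetrablock finite_M sets_M])
  have m: "(\<lambda>z. z $ i) \<in> borel_measurable M"
    by (intro continuous_measurable[OF compact_shilov_tetrablock finite_M sets_M] continuous_intros)
  have b: "cmod (z $ i) \<le> 1" if "z \<in> space M" for z using that by (simp add: space shilov_tetrablockD(7))
  have "coord_mult i g \<in> L2 M"
    unfolding coord_mult_def by (rule L2_bounded_mult[OF hardy_boundary_L2[OF g] m AE_I2[OF b]])
  moreover have "jac_lift (coord_mult i g) = (\<lambda>z. tetra_map z $ i * jac_lift g z)" by (auto simp: jac_lift_def coord_mult_def)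
  ultimately show ?thesis using boundary_of_coord[OF f, of i] unfolding hardy_boundary_iff by metis
qed

lemma hardy_boundary_closed: "L2_closed M (hardy_boundary \<Theta>)"
  unfolding L2_closed_def
proof (intro allI impI)
  fix v :: "nat \<Rightarrow> complex^3 \<Rightarrow> complex" and u
  assume v: "\<forall>n. v n \<in> hardy_boundary \<Theta>" and u: "u \<in> L2 M"
    and lim: "(\<lambda>n. L2_norm M (\<lambda>x. v n x - u x)) \<longlonglongrightarrow> 0"
  have "\<forall>n. \<exists>f. boundary_of f (jac_lift (v n))" using v hardy_boundary_iff by blast
  then obtain f where f: "\<And>n. boundary_of (f n) (jac_lift (v n))" by metis
  have "L2_norm \<Theta> (\<lambda>z. jac_lift (v n) z - jac_lift u z) = sqrt jac_mass * L2_norm M (\<lambda>x. v n x - u x)" for n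
  proof -
    have "jac_lift (\<lambda>x. v n x - u x) = (\<lambda>z. jac_lift (v n) z - jac_lift u z)" by (auto simp: jac_lift_def algebra_simps)
    then show ?thesis using jac_lift_L2(2)[OF L2_diff[OF hardy_boundary_L2 u], of "v n"] v by simp
  qed
  then have "(\<lambda>n. L2_norm \<Theta> (\<lambda>z. jac_lift (v n) z - jac_lift u z)) \<longlonglongrightarrow> 0"
    using tendsto_mult_left[OF lim, of "sqrt jac_mass"] by simp
  from boundary_of_closed[OF f jac_lift_L2(1)[OF u] this] obtain g where "boundary_of g (jac_lift u)" by blast
  then show "u \<in> hardy_boundary \<Theta>" using u hardy_boundary_iff by blast
qed

end

theorem theorem1p1:
  fixes \<Theta> :: "(complex^3) measure"
    and T :: "(complex^3 \<Rightarrow> complex) \<Rightarrow> (complex^3 \<Rightarrow> complex)"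
  defines "M \<equiv> tetra_measure \<Theta>"
    and "H \<equiv> hardy_boundary \<Theta>"
  assumes "invariant_boundary_measure \<Theta>"
    and "bounded_operator_on M H T"
  shows "(\<exists>u\<in>Linf M. operator_eq_on M H T (toeplitz M H u)) \<longleftrightarrow>
     operator_eq_on M H (T \<circ> coord_mult 1) (adjoint_on M H (coord_mult 2) \<circ> T \<circ> coord_mult 3) \<and>
     operator_eq_on M H (T \<circ> coord_mult 2) (adjoint_on M H (coord_mult 1) \<circ> T \<circ> coord_mult 3) \<and>
     operator_eq_on M H (adjoint_on M H (coord_mult 3) \<circ> T \<circ> coord_mult 3) T"
proof -
  interpret boundary_measure \<Theta> by unfold_locales (rule assms(3))
  have "boundary_hardy_space M H"
    unfolding M_def H_def
    by (rule boundary_hardy_space.intro)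
       (rule finite_M sets_M hardy_boundary_subspace hardy_boundary_closed hardy_boundary_coord hardy_boundary_one | assumption)+
  then interpret op: boundary_operator M H T
    using assms(4) by (simp add: boundary_operator_def boundary_operator_axioms_def)
  show ?thesis by (rule op.brown_halmos)
qed

end
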